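(* Fix $q\in\mathbb R$ and assume that one of the following conditions is satisfied: (i) the Open Set Condition (OSC) is satisfied and $0\le q$; (ii) the Strong Separation Condition (SSC) is satisfied. Define $\lambda_q:(0,\infty)\to\mathbb R$ by $$\lambda_q(r)=V_{\mu,r}^q(K)-\sum_{i=1}^N p_i^q\,\mathbf 1_{(0,r_i]}(r)\,V_{\mu,r_i^{-1}r}^q(K).$$ Then the following holds. (1) (Non-arithmetic case) If the set $\{\log r_1^{-1},\dots,\log r_N^{-1}\}$ is not contained in a discrete additive subgroup of $\mathbb R$, then $$\frac{1}{r^{-\beta(q)}}V_{\mu,r}^q(K)=c_q+\varepsilon_q(r),$$ where $c_q\in\mathbb R$ is the constant $$c_q=\frac{1}{-\sum_i p_i^q r_i^{\beta(q)}\log r_i}\int_0^1 r^{\beta(q)}\lambda_q(r)\,\frac{dr}{r}$$ and $\varepsilon_q(r)\to0$ as $r\searrow0$. In addition, $K$ is $(q,\beta(q))$ multifractal Minkowski measurable with respect to $\mu$ with $$M_\mu^{q,\beta(q)}(K)=\frac{1}{-\sum_i p_i^q r_i^{\beta(q)}\log r_i}\int_0^1 r^{\beta(q)}\lambda_q(r)\,\frac{dr}{r}.$$ (2) (Arithmetic case) If the set $\{\log r_1^{-1},\dots,\log r_N^{-1}\}$ is contained in a discrete additive subgroup of $\mathbb R$ and the subgroup generated by it is $\langle\log r_1^{-1},\dots,\log r_N^{-1}\rangle=u\mathbb Z$ with $u>0$, then $$\frac{1}{r^{-\beta(q)}}V_{\mu,r}^q(K)=\pi_q(r)+\varepsilon_q(r),$$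 where $\pi_q:(0,\infty)\to\mathbb R$ is the multiplicatively periodic function with period $e^u$ (i.e. $\pi_q(e^ur)=\pi_q(r)$ for all $r\in(0,\infty)$) given by $$\pi_q(r)=\frac{1}{-\sum_i p_i^q r_i^{\beta(q)}\log r_i}\sum_{n\in\mathbb Z,\ re^{nu}\le1}(re^{nu})^{\beta(q)}\lambda_q(re^{nu})\,u$$ and $\varepsilon_q(r)\to0$ as $r\searrow0$. In addition, $K$ is $(q,\beta(q))$ averagely multifractal Minkowski measurable with respect to $\mu$ with $$M_{\mu,\mathrm{ave}}^{q,\beta(q)}(K)=\frac{1}{-\sum_i p_i^q r_i^{\beta(q)}\log r_i}\int_0^1 r^{\beta(q)}\lambda_q(r)\,\frac{dr}{r}.$$
   Context: Let $d\ge1$ and $N\ge2$ be integers, let $S_1,\dots,S_N:\mathbb R^d\to\mathbb R^d$ be contracting similarities with Lipschitz constants (ratios) $r_1,\dots,r_N\in(0,1)$, and let $(p_1,\dots,p_N)$ be a probability vector with $p_i>0$ for all $i$. $K$ is the unique non-empty compact subset of $\mathbb R^d$ with $K=\bigcup_iS_i(K)$, and $\mu$ is the unique Borel probability measure on $\mathbb R^d$ with $\mu=\sum_ip_i\,\mu\circ S_i^{-1}$; one has $\operatorname{supp}\mu=K$. OSC: there is an open, non-empty, bounded $U\subseteq\mathbb R^d$ with $\bigcup_iS_iU\subseteq U$ and $S_iU\cap S_jU=\varnothing$ for all $i\ne j$. SSC: there is an open, non-empty, bounded $U\subseteq\mathbb R^d$ with $\bigcup_iS_iU\subseteq U$ and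 $\overline{S_iU}\cap\overline{S_jU}=\varnothing$ for all $i\neq j$. For $q\in\mathbb R$, $\beta(q)\in\mathbb R$ is the unique number with $\sum_ip_i^qr_i^{\beta(q)}=1$. $B(x,r)$ is the open ball and, for $E\subseteq\mathbb R^d$, $B(E,r)=\{x\in\mathbb R^d:\operatorname{dist}(x,E)<r\}$. $\mathcal L^d$ is Lebesgue measure. The multifractal $q$ Minkowski volume of $E$ is $$V_{\mu,r}^q(E)=\frac1{r^d}\int_{B(E,r)}\mu(B(x,r))^q\,d\mathcal L^d(x).$$ For $q,t\in\mathbb R$, $E$ is $(q,t)$ multifractal Minkowski measurable with respect to $\mu$ if the limit $M_\mu^{q,t}(E)=\lim_{r\searrow0}\frac1{r^{-t}}V_{\mu,r}^q(E)$ exists, and $(q,t)$ averagely multifractal Minkowski measurable with respect to $\mu$ if the limit $M_{\mu,\mathrm{ave}}^{q,t}(E)=\lim_{r\searrow0}\frac1{-\log r}\int_r^1\frac1{s^{-t}}V_{\mu,s}^q(E)\frac{ds}s$ exists. $\mathbf 1_A$ denotes the indicator function of $A$.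
   Formalization: Under the SSC with very negative q (e.g. middle-third Cantor set, equal weights, q ≤ −log 3/log 2) the integral defining V diverges and λ_q is undefined; here a divergent integral is read as 0, so all terms vanish in that case; wherever V is finite the statement is as given. *)

theory Defs
  imports "HOL-Analysis.Analysis" "HOL-Probability.Probability_Measure" "HOL-Computational_Algebra.Group_Closure"
begin

definition similarity :: "real \<Rightarrow> ('a::metric_space \<Rightarrow> 'a) \<Rightarrow> bool" where
  "similarity c f \<longleftrightarrow> (\<forall>x y. dist (f x) (f y) = c * dist x y)"

definition self_similar_set ::
  "nat \<Rightarrow> (nat \<Rightarrow> 'a::metric_space \<Rightarrow> 'a) \<Rightarrow> 'a set \<Rightarrow> bool" where
  "self_similar_set N S K \<longleftrightarrow> compact K \<and> K \<noteq> {} \<and> K = (\<Union>i\<in>{1..N}. S i ` K)"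

definition self_similar_measure ::
  "nat \<Rightarrow> (nat \<Rightarrow> 'a::metric_space \<Rightarrow> 'a) \<Rightarrow> (nat \<Rightarrow> real) \<Rightarrow> 'a measure \<Rightarrow> bool" where
  "self_similar_measure N S p \<mu> \<longleftrightarrow>
     prob_space \<mu> \<and> sets \<mu> = sets borel \<and>
     (\<forall>A\<in>sets borel. measure \<mu> A = (\<Sum>i=1..N. p i * measure \<mu> (S i -` A)))"

definition open_set_condition ::
  "nat \<Rightarrow> (nat \<Rightarrow> 'a::metric_space \<Rightarrow> 'a) \<Rightarrow> bool" where
  "open_set_condition N S \<longleftrightarrow>
     (\<exists>U. open U \<and> U \<noteq> {} \<and> bounded U \<and> (\<Union>i\<in>{1..N}. S i ` U) \<subseteq> U \<and>
          (\<forall>i\<in>{1..N}. \<forall>j\<in>{1..N}. i \<noteq> j \<longrightarrow> S i ` U \<inter> S j ` U = {}))"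

definition strong_separation_condition ::
  "nat \<Rightarrow> (nat \<Rightarrow> 'a::metric_space \<Rightarrow> 'a) \<Rightarrow> bool" where
  "strong_separation_condition N S \<longleftrightarrow>
     (\<exists>U. open U \<and> U \<noteq> {} \<and> bounded U \<and> (\<Union>i\<in>{1..N}. S i ` U) \<subseteq> U \<and>
          (\<forall>i\<in>{1..N}. \<forall>j\<in>{1..N}. i \<noteq> j \<longrightarrow> closure (S i ` U) \<inter> closure (S j ` U) = {}))"

definition mf_beta :: "nat \<Rightarrow> (nat \<Rightarrow> real) \<Rightarrow> (nat \<Rightarrow> real) \<Rightarrow> real \<Rightarrow> real" where
  "mf_beta N p r q = (THE b. (\<Sum>i=1..N. p i powr q * r i powr b) = 1)"

text \<open>Only used for non-empty \<open>E\<close>, where \<^const>\<open>infdist\<close> is the distance to \<open>E\<close>.\<close>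
definition open_nbhd :: "'a::metric_space set \<Rightarrow> real \<Rightarrow> 'a set" where
  "open_nbhd E s = {x. infdist x E < s}"

text \<open>
  For \<open>E\<close> contained in the support of \<open>\<mu>\<close>, the balls occurring in the integrand have positive
  measure, so the value of \<open>0 powr q\<close> plays no role. For sufficiently negative \<open>q\<close> the integral
  may diverge, in which case the Lebesgue integral is \<open>0\<close> by convention.
\<close>
definition mf_minkowski_volume ::
  "'a::euclidean_space measure \<Rightarrow> real \<Rightarrow> real \<Rightarrow> 'a set \<Rightarrow> real" where
  "mf_minkowski_volume \<mu> q s E =
     1 / s ^ DIM('a) * (LINT x:open_nbhd E s|lborel. measure \<mu> (ball x s) powr q)"

definition mf_minkowski_measurable ::
  "'a::euclidean_space measure \<Rightarrow> real \<Rightarrow> real \<Rightarrow> 'a set \<Rightarrow> bool" where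
  "mf_minkowski_measurable \<mu> q t E \<longleftrightarrow>
     (\<exists>M. ((\<lambda>s. 1 / s powr (- t) * mf_minkowski_volume \<mu> q s E) \<longlongrightarrow> M) (at_right 0))"

definition mf_minkowski_content ::
  "'a::euclidean_space measure \<Rightarrow> real \<Rightarrow> real \<Rightarrow> 'a set \<Rightarrow> real" where
  "mf_minkowski_content \<mu> q t E =
     Lim (at_right 0) (\<lambda>s. 1 / s powr (- t) * mf_minkowski_volume \<mu> q s E)"

definition mf_minkowski_average ::
  "'a::euclidean_space measure \<Rightarrow> real \<Rightarrow> real \<Rightarrow> 'a set \<Rightarrow> real \<Rightarrow> real" where
  "mf_minkowski_average \<mu> q t E x =
     1 / (- ln x) * (LINT s:{x..1}|lborel. 1 / s powr (- t) * mf_minkowski_volume \<mu> q s E / s)"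

text \<open>The integrability clause says that the averages are genuine integrals.\<close>
definition mf_avg_minkowski_measurable ::
  "'a::euclidean_space measure \<Rightarrow> real \<Rightarrow> real \<Rightarrow> 'a set \<Rightarrow> bool" where
  "mf_avg_minkowski_measurable \<mu> q t E \<longleftrightarrow>
     (\<forall>x\<in>{0<..<1}. set_integrable lborel {x..1}
        (\<lambda>s. 1 / s powr (- t) * mf_minkowski_volume \<mu> q s E / s)) \<and>
     (\<exists>M. (mf_minkowski_average \<mu> q t E \<longlongrightarrow> M) (at_right 0))"

definition mf_avg_minkowski_content ::
  "'a::euclidean_space measure \<Rightarrow> real \<Rightarrow> real \<Rightarrow> 'a set \<Rightarrow> real" where
  "mf_avg_minkowski_content \<mu> q t E = Lim (at_right 0) (mf_minkowski_average \<mu> q t E)"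

definition mf_lambda ::
  "nat \<Rightarrow> (nat \<Rightarrow> real) \<Rightarrow> (nat \<Rightarrow> real) \<Rightarrow> 'a::euclidean_space measure \<Rightarrow> 'a set \<Rightarrow>
   real \<Rightarrow> real \<Rightarrow> real" where
  "mf_lambda N p r \<mu> K q s =
     mf_minkowski_volume \<mu> q s K -
     (\<Sum>i=1..N. p i powr q * indicator {0<..r i} s * mf_minkowski_volume \<mu> q (inverse (r i) * s) K)"

definition mf_entropy :: "nat \<Rightarrow> (nat \<Rightarrow> real) \<Rightarrow> (nat \<Rightarrow> real) \<Rightarrow> real \<Rightarrow> real" where
  "mf_entropy N p r q = - (\<Sum>i=1..N. p i powr q * r i powr mf_beta N p r q * ln (r i))"

definition mf_constant ::
  "nat \<Rightarrow> (nat \<Rightarrow> real) \<Rightarrow> (nat \<Rightarrow> real) \<Rightarrow> 'a::euclidean_space measure \<Rightarrow> 'a set \<Rightarrow>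
   real \<Rightarrow> real" where
  "mf_constant N p r \<mu> K q =
     1 / mf_entropy N p r q *
     (LINT s:{0<..1}|lborel. s powr mf_beta N p r q * mf_lambda N p r \<mu> K q s / s)"

definition mf_periodic ::
  "nat \<Rightarrow> (nat \<Rightarrow> real) \<Rightarrow> (nat \<Rightarrow> real) \<Rightarrow> 'a::euclidean_space measure \<Rightarrow> 'a set \<Rightarrow>
   real \<Rightarrow> real \<Rightarrow> real \<Rightarrow> real" where
  "mf_periodic N p r \<mu> K q u s =
     1 / mf_entropy N p r q *
     (\<Sum>\<^sub>\<infinity>n\<in>{n::int. s * exp (of_int n * u) \<le> 1}.
        (s * exp (of_int n * u)) powr mf_beta N p r q *
        mf_lambda N p r \<mu> K q (s * exp (of_int n * u)) * u)"

definition in_discrete_subgroup :: "real set \<Rightarrow> bool" where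
  "in_discrete_subgroup X \<longleftrightarrow>
     (\<exists>G. 0 \<in> G \<and> (\<forall>x\<in>G. \<forall>y\<in>G. x + y \<in> G) \<and> (\<forall>x\<in>G. - x \<in> G) \<and> discrete G \<and> X \<subseteq> G)"

end

theory Submission
  imports Defs "HOL-Real_Asymp.Real_Asymp"
begin

text \<open>
  With \<open>r = exp (- t)\<close>, the function \<open>F t = r powr \<beta> * V r\<close> for \<open>t \<ge> 0\<close> solves the renewal equation
  \<open>F t = (\<Sum>i. \<omega> i * F (t - \<tau> i)) + g t\<close> with weights \<open>\<omega> i = p i powr q * r i powr \<beta>\<close> of total mass one, steps
  \<open>\<tau> i = - ln (r i)\<close>, and \<open>g t = r powr \<beta> * \<lambda> r\<close>. Everything follows once \<open>g\<close> decays exponentially.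

  Under the open set condition, \<open>\<lambda>\<close> only sees points close to two different first level pieces.
  A word with the maximal number of neighbours, prefixed arbitrarily, lies deep inside one first level
  piece, so the cylinders contributing to \<open>\<lambda>\<close> avoid that word and carry exponentially small total weight.
  Under strong separation, \<open>\<lambda>\<close> vanishes near zero.

  The renewal equation is treated without Blackwell's theorem. The primitive of \<open>F\<close>, corrected by a
  linear term, is a bounded solution \<open>Y\<close> of a renewal equation with vanishing error. If the upper limit \<open>A\<close> of
  the increments \<open>Y (t + x) - Y t\<close> is attained along a sequence of times, it is attained along all its
  translates by sums of steps; for \<open>x\<close> in the group generated by the steps these contain long
  arithmetic progressions of difference \<open>x\<close>, so \<open>A > 0\<close> would make \<open>Y\<close> unbounded. In the
  non-arithmetic case \<open>V r\<close> or \<open>r ^ d * V r\<close> is monotone, which upgrades convergence of averages of \<open>F\<close>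
  to convergence of \<open>F\<close>; in the arithmetic case the primitive is replaced by a sum over a lattice.
\<close>

section \<open>Renewal equations\<close>

text \<open>The obstacle in the limit theorem is regularity: \<open>F\<close> is measurable but not
  known to be continuous, so a small shift of time cannot be controlled for \<open>F\<close> itself.
  Its primitive is Lipschitz, which lets small group elements approximate an arbitrary increment.
  The slope of the linear correction is \<open>total / mean\<close>, the only one for which the
  forcing of the integrated equation tends to 0 instead of a nonzero constant. Boundedness of
  \<open>F\<close> is not an input about \<open>V\<close>; it comes out of the renewal equation and
  the decay of \<open>g\<close>. For \<open>q < 0\<close> the integral behind \<open>V\<close> may
  be infinite. Finiteness at one scale is equivalent to finiteness at every scale, so under strong
  separation either the recursion holds between finite values or all its terms take the default
  value 0; in both cases \<open>\<Lambda>\<close> vanishes near zero. Monotonicity of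
  \<open>V\<close> for \<open>q < 0\<close> uses a map built from a choice of nearest points, whose
  measurability is not established. The volume comparison is therefore proved by Vitali coverings
  for arbitrary maps, and the scaling of Lebesgue measure under similarities is obtained from the
  same lemma.\<close>

locale renewal =
  fixes I :: "'i set" and w \<tau> :: "'i \<Rightarrow> real"
  assumes finite_I: "finite I"
    and w_pos: "i \<in> I \<Longrightarrow> 0 < w i"
    and w_sum: "(\<Sum>i\<in>I. w i) = 1"
    and \<tau>_pos: "i \<in> I \<Longrightarrow> 0 < \<tau> i"
begin

lemma I_nonempty: "I \<noteq> {}"
  using w_sum by auto

definition mean :: real where
  "mean = (\<Sum>i\<in>I. w i * \<tau> i)"

lemma mean_pos: "0 < mean"
  unfolding mean_def using I_nonempty finite_I by (intro sum_pos) (auto simp: w_pos \<tau>_pos)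

section \<open>Sums of steps and the group generated by the steps\<close>

inductive_set arrivals :: "real set" where
  zero: "0 \<in> arrivals"
| step: "a \<in> arrivals \<Longrightarrow> i \<in> I \<Longrightarrow> a + \<tau> i \<in> arrivals"

lemma arrivals_add: "b \<in> arrivals \<Longrightarrow> a \<in> arrivals \<Longrightarrow> a + b \<in> arrivals"
proof (induction b rule: arrivals.induct)
  case (step b i)
  then show ?case using arrivals.step[of "a + b" i] by (simp add: add.assoc)
qed simp

lemma arrivals_scale: "a \<in> arrivals \<Longrightarrow> of_nat n * a \<in> arrivals"
  by (induction n) (auto simp: algebra_simps intro: arrivals.zero arrivals_add)

text \<open>Sums of steps are closed under addition, so their differences already form a group. If
  \<open>s\<close> and \<open>t\<close> are differences starting at \<open>a\<close> and
  \<open>b\<close>, then \<open>s - t\<close> is one starting at \<open>a + (b + t)\<close>.\<close>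

lemma group_closure_imp_difference:
  assumes "x \<in> group_closure (\<tau> ` I)"
  shows "\<exists>a\<in>arrivals. a + x \<in> arrivals"
  using assms
proof (induction rule: group_closure.induct)
  case (base s)
  then show ?case
    using arrivals.zero arrivals.step[OF arrivals.zero] by (intro bexI[of _ 0]) auto
next
  case (diff s t)
  then obtain a b where "a \<in> arrivals" "a + s \<in> arrivals" "b \<in> arrivals" "b + t \<in> arrivals"
    by blast
  then have "a + (b + t) \<in> arrivals" "(a + s) + b \<in> arrivals"
    by (auto intro: arrivals_add)
  then show ?case
    by (intro bexI[of _ "a + (b + t)"]) (auto simp: algebra_simps)
qed

text \<open>With \<open>a\<close> and \<open>a + x\<close> both sums of steps,
  \<open>(k - j) * a + j * (a + x) = k * a + j * x\<close> is one too. The common start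
  \<open>k * a\<close> depends on the length of the progression.\<close>

lemma arithmetic_progression_in_arrivals:
  assumes "x \<in> group_closure (\<tau> ` I)"
  obtains a where "\<And>j. j \<le> k \<Longrightarrow> a + of_nat j * x \<in> arrivals"
proof -
  obtain a where a: "a \<in> arrivals" "a + x \<in> arrivals"
    using group_closure_imp_difference[OF assms] by metis
  have "of_nat k * a + of_nat j * x \<in> arrivals" if "j \<le> k" for j
  proof -
    have "of_nat (k - j) * a + of_nat j * (a + x) \<in> arrivals"
      by (intro arrivals_add arrivals_scale a)
    also have "of_nat (k - j) * a + of_nat j * (a + x) = of_nat k * a + of_nat j * x"
      using that by (simp add: algebra_simps)
    finally show ?thesis .
  qed
  then show ?thesis by (rule that)
qed

text \<open>A group without elements in the interval from 0 to \<open>h\<close> has all its points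
  at distance at least \<open>h\<close> from each other, hence is discrete.\<close>

lemma group_closure_small:
  assumes "\<not> in_discrete_subgroup (\<tau> ` I)" "0 < h"
  obtains x where "x \<in> group_closure (\<tau> ` I)" "0 < x" "x < h"
proof (rule ccontr)
  assume *: "\<not> thesis"
  let ?G = "group_closure (\<tau> ` I)"
  have gap: "x = y" if "x \<in> ?G" "y \<in> ?G" "\<bar>x - y\<bar> < h" for x y
  proof (rule ccontr)
    assume "x \<noteq> y"
    then have "x - y > 0 \<or> y - x > 0" by auto
    moreover have "x - y \<in> ?G" "y - x \<in> ?G" using that by (auto intro: group_closure.diff)
    ultimately show False using * that(3) \<open>\<And>x. \<lbrakk>x \<in> ?G; 0 < x; x < h\<rbrakk> \<Longrightarrow> thesis\<close> by force
  qed
  have "discrete ?G"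
  proof (rule discreteI)
    fix x assume "x \<in> ?G"
    then show "x isolated_in ?G"
      unfolding isolated_in_def using gap[of _ x] assms(2)
      by (intro conjI exI[of _ "ball x h"]) (auto simp: dist_real_def abs_minus_commute)
  qed
  then have "in_discrete_subgroup (\<tau> ` I)"
    unfolding in_discrete_subgroup_def
    by (intro exI[of _ ?G]) (auto intro: group_closure_add group_closure.base)
  then show False using assms by simp
qed

text \<open>Induction over time slabs of length \<open>\<delta>\<close>, the smallest step: from one
  slab the equation only looks into earlier ones. The weights average, so they do not enlarge the
  bound; each slab adds one error term, and these form a geometric series.\<close>

lemma bounded_solution:
  assumes T: "\<And>i. i \<in> I \<Longrightarrow> \<tau> i \<le> T"
    and B: "\<And>t. - T \<le> t \<Longrightarrow> t < 0 \<Longrightarrow> \<bar>Y t\<bar> \<le> B"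
    and eq: "\<And>t. 0 \<le> t \<Longrightarrow> Y t = (\<Sum>i\<in>I. w i * Y (t - \<tau> i)) + e t"
    and e: "\<And>t. 0 \<le> t \<Longrightarrow> \<bar>e t\<bar> \<le> C * exp (- \<gamma> * t)" and \<gamma>: "0 < \<gamma>"
  obtains B' where "\<And>t. - T \<le> t \<Longrightarrow> \<bar>Y t\<bar> \<le> B'"
proof -
  define \<delta> where "\<delta> = Min (\<tau> ` I)"
  have \<delta>: "0 < \<delta>" "\<And>i. i \<in> I \<Longrightarrow> \<delta> \<le> \<tau> i"
    unfolding \<delta>_def using finite_I I_nonempty \<tau>_pos by auto
  have C: "0 \<le> C" using e[of 0] by simp
  have "\<bar>Y t\<bar> \<le> B + C * (\<Sum>k<n. exp (- \<gamma> * (of_nat k * \<delta>)))"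
    if "- T \<le> t" "t < of_nat n * \<delta>" for t n
    using that
  proof (induction n arbitrary: t)
    case 0 then show ?case using B by simp
  next
    case (Suc n)
    let ?b = "B + C * (\<Sum>k<n. exp (- \<gamma> * (of_nat k * \<delta>)))"
    show ?case
    proof (cases "t < of_nat n * \<delta>")
      case True
      then have "\<bar>Y t\<bar> \<le> ?b" using Suc by simp
      also have "\<dots> \<le> B + C * (\<Sum>k<Suc n. exp (- \<gamma> * (of_nat k * \<delta>)))"
        using C by (simp add: distrib_left)
      finally show ?thesis .
    next
      case False
      then have t: "0 \<le> t" using \<delta>(1) by (meson not_less order_trans mult_nonneg_nonneg of_nat_0_le_iff less_imp_le)
      have "\<bar>Y (t - \<tau> i)\<bar> \<le> ?b" if "i \<in> I" for i
        using Suc.prems T[OF that] \<delta>(2)[OF that] t by (intro Suc.IH) (auto simp: algebra_simps)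
      then have "(\<Sum>i\<in>I. w i * \<bar>Y (t - \<tau> i)\<bar>) \<le> (\<Sum>i\<in>I. w i * ?b)"
        using w_pos by (intro sum_mono mult_left_mono) (auto intro: less_imp_le)
      also have "\<dots> = ?b" by (simp add: w_sum flip: sum_distrib_right)
      finally have 1: "(\<Sum>i\<in>I. w i * \<bar>Y (t - \<tau> i)\<bar>) \<le> ?b" .
      have "\<bar>\<Sum>i\<in>I. w i * Y (t - \<tau> i)\<bar> \<le> (\<Sum>i\<in>I. \<bar>w i * Y (t - \<tau> i)\<bar>)" by (rule sum_abs)
      also have "\<dots> = (\<Sum>i\<in>I. w i * \<bar>Y (t - \<tau> i)\<bar>)"
        by (intro sum.cong) (auto simp: abs_mult dest: w_pos)
      finally have 2: "\<bar>\<Sum>i\<in>I. w i * Y (t - \<tau> i)\<bar> \<le> ?b" using 1 by simp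
      have "\<bar>e t\<bar> \<le> C * exp (- \<gamma> * t)" using e t by simp
      also have "\<dots> \<le> C * exp (- \<gamma> * (of_nat n * \<delta>))"
        using False C \<gamma> by (intro mult_left_mono) auto
      finally show ?thesis using 2 eq[OF t] by (simp add: distrib_left)
    qed
  qed note bound = this
  have geo: "(\<Sum>k<n. exp (- \<gamma> * (of_nat k * \<delta>))) \<le> 1 / (1 - exp (- \<gamma> * \<delta>))" for n
  proof -
    have s: "(\<lambda>k. exp (- \<gamma> * \<delta>) ^ k) sums (1 / (1 - exp (- \<gamma> * \<delta>)))"
      using \<gamma> \<delta>(1) by (intro geometric_sums) auto
    have "(\<Sum>k<n. exp (- \<gamma> * (of_nat k * \<delta>))) = (\<Sum>k<n. exp (- \<gamma> * \<delta>) ^ k)"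
      by (intro sum.cong) (auto simp: algebra_simps simp flip: exp_of_nat_mult)
    also have "\<dots> \<le> (\<Sum>k. exp (- \<gamma> * \<delta>) ^ k)"
      using s by (intro sum_le_suminf) (auto simp: sums_iff)
    finally show ?thesis using s by (simp add: sums_iff)
  qed
  have "\<bar>Y t\<bar> \<le> B + C * (1 / (1 - exp (- \<gamma> * \<delta>)))" if "- T \<le> t" for t
  proof -
    obtain n where "t / \<delta> < of_nat n" using reals_Archimedean2 by blast
    then have "t < of_nat n * \<delta>" using \<delta>(1) by (simp add: field_simps)
    from bound[OF that this] show ?thesis
      using mult_left_mono[OF geo[of n] C] by linarith
  qed
  then show ?thesis by (rule that)
qed

lemma increment_eventually_less:
  assumes x: "x \<in> group_closure (\<tau> ` I)" "0 < x"
    and B: "\<And>t. T0 \<le> t \<Longrightarrow> \<bar>Y t\<bar> \<le> B"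
    and eq: "\<And>t. T0 \<le> t \<Longrightarrow> Y t = (\<Sum>i\<in>I. w i * Y (t - \<tau> i)) + \<eta> t"
    and \<eta>: "(\<eta> \<longlongrightarrow> 0) at_top" and \<epsilon>: "0 < \<epsilon>"
  shows "\<forall>\<^sub>F t in at_top. Y (t + x) - Y t < \<epsilon>"
proof -
  define D where "D t = Y (t + x) - Y t" for t
  define e where "e t = \<eta> (t + x) - \<eta> t" for t
  have eqD: "D t = (\<Sum>i\<in>I. w i * D (t - \<tau> i)) + e t" if "T0 \<le> t" for t
  proof -
    have "D t = (\<Sum>i\<in>I. w i * Y (t + x - \<tau> i)) + \<eta> (t + x) - ((\<Sum>i\<in>I. w i * Y (t - \<tau> i)) + \<eta> t)"
      using eq[of t] eq[of "t + x"] x that by (simp add: D_def)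
    then show ?thesis
      by (simp add: D_def e_def algebra_simps sum_subtractf)
  qed
  have "filterlim (\<lambda>t. t + x) at_top at_top"
    using filterlim_tendsto_add_at_top[OF tendsto_const[of x] filterlim_ident] by (simp add: add.commute)
  then have "((\<lambda>t. \<eta> (t + x)) \<longlongrightarrow> 0) at_top"
    using \<eta> by (rule filterlim_compose[rotated])
  then have e0: "(e \<longlongrightarrow> 0) at_top"
    unfolding e_def using tendsto_diff[OF _ \<eta>] by fastforce
  have DB: "\<bar>D t\<bar> \<le> 2 * B" if "T0 \<le> t" for t
    using B[of t] B[of "t + x"] that x unfolding D_def by linarith
  \<comment> \<open>The infimum \<open>A\<close> of the eventual upper bounds is the upper limit of
    \<open>D\<close>; \<open>upper\<close> and \<open>lower\<close> are its two defining
    properties.\<close>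
  define As where "As = {a. \<forall>\<^sub>F t in at_top. D t \<le> a}"
  define A where "A = Inf As"
  have ge: "\<forall>\<^sub>F t in at_top. T0 \<le> t" by (rule eventually_ge_at_top)
  have "2 * B \<in> As"
    unfolding As_def mem_Collect_eq by (rule eventually_mono[OF ge]) (rule abs_le_D1[OF DB])
  moreover have low: "- (2 * B) \<le> a" if a: "\<forall>\<^sub>F t in at_top. D t \<le> a" for a
  proof -
    obtain t where "T0 \<le> t" "D t \<le> a"
      using eventually_happens'[OF _ eventually_conj[OF ge a]] by auto
    then show ?thesis using DB[of t] by simp
  qed
  moreover have "bdd_below As" unfolding As_def by (rule bdd_belowI[of _ "- (2 * B)"]) (simp add: low)
  ultimately have Asne: "As \<noteq> {}" and Asbdd: "bdd_below As" by auto
  have upper: "\<forall>\<^sub>F t in at_top. D t < A + \<delta>" if \<delta>: "0 < \<delta>" for \<delta>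
  proof -
    obtain b where "b \<in> As" "b < A + \<delta>"
      using cInf_lessD[OF Asne, of "A + \<delta>"] \<delta> unfolding A_def by auto
    then show ?thesis unfolding As_def by (auto elim: eventually_mono)
  qed
  have lower: "\<exists>\<^sub>F t in at_top. A - \<delta> < D t" if "0 < \<delta>" for \<delta>
  proof (rule ccontr)
    assume "\<not> ?thesis"
    then have "A - \<delta> \<in> As" by (simp add: As_def not_frequently not_less)
    then show False using cInf_lower[OF _ Asbdd] that unfolding A_def by fastforce
  qed
  have shift: "\<forall>\<^sub>F t in at_top. P (t - c)" if "\<forall>\<^sub>F t in at_top. P t" for P and c :: real
  proof (rule eventually_compose_filterlim[OF that])
    show "filterlim (\<lambda>t. t - c) at_top at_top" by real_asymp
  qed
  \<comment> \<open>\<open>D t\<close> is, up to a vanishing error, an average of earlier values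
    which eventually barely exceed \<open>A\<close>. If the average is close to \<open>A\<close>,
    each value with positive weight must be close to \<open>A\<close> as well.\<close>
  have backward: "\<exists>\<delta>>0. \<forall>\<^sub>F t in at_top. A - \<delta> < D t \<longrightarrow> A - \<theta> < D (t - a)"
    if "a \<in> arrivals" "0 < \<theta>" for a \<theta>
    using that
  proof (induction a arbitrary: \<theta> rule: arrivals.induct)
    case zero
    then show ?case by (intro exI[of _ \<theta>]) auto
  next
    case (step a i)
    obtain \<delta> where IH: "0 < \<delta>" "\<forall>\<^sub>F t in at_top. A - \<delta> < D t \<longrightarrow> A - \<theta> < D (t - a)"
      using step.IH[OF step.prems] by blast
    \<comment> \<open>A third each for the deficit of \<open>D t\<close>, for the error
      \<open>e t\<close>, and for the excess of the other terms over \<open>A\<close>. Division by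
      \<open>w i\<close> then costs at most \<open>\<delta>\<close>.\<close>
    define \<delta>' where "\<delta>' = \<delta> * w i / 3"
    have wi: "0 < w i" using step w_pos by simp
    have \<delta>': "0 < \<delta>'" using IH(1) wi by (simp add: \<delta>'_def)
    have "\<forall>\<^sub>F t in at_top. \<forall>j\<in>I. D (t - \<tau> j) < A + \<delta>'"
      by (intro eventually_ball_finite[OF finite_I] ballI shift upper \<delta>')
    then have "\<forall>\<^sub>F t in at_top. A - \<delta>' < D t \<longrightarrow> A - \<theta> < D (t - (a + \<tau> i))"
      using tendstoD[OF e0 \<delta>'] ge shift[OF IH(2), of "\<tau> i"]
    proof eventually_elim
      case (elim t)
      show ?case
      proof
        assume Dt: "A - \<delta>' < D t"
        have s1: "(\<Sum>j\<in>I - {i}. w j * D (t - \<tau> j)) \<le> (\<Sum>j\<in>I - {i}. w j * (A + \<delta>'))"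
          using elim(1) w_pos by (intro sum_mono mult_left_mono) (auto intro: less_imp_le)
        have s2: "(\<Sum>j\<in>I - {i}. w j) = 1 - w i"
          using w_sum sum.remove[OF finite_I step.hyps(2), of w] by simp
        have "D t \<le> w i * D (t - \<tau> i) + (1 - w i) * (A + \<delta>') + \<delta>'"
          using eqD[OF elim(3)] s1 elim(2) sum.remove[OF finite_I step.hyps(2), of "\<lambda>j. w j * D (t - \<tau> j)"]
          by (simp add: s2 dist_real_def flip: sum_distrib_right)
        then have "w i * D (t - \<tau> i) > A - \<delta>' - \<delta>' - (1 - w i) * (A + \<delta>')" using Dt by linarith
        also have "A - \<delta>' - \<delta>' - (1 - w i) * (A + \<delta>') = w i * (A - \<delta>) + w i * \<delta>'"
          unfolding \<delta>'_def by (simp add: field_simps)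
        finally have "w i * (A - \<delta>) < w i * D (t - \<tau> i)"
          using mult_pos_pos[OF wi \<delta>'] by linarith
        then have "A - \<delta> < D (t - \<tau> i)" using wi by simp
        then show "A - \<theta> < D (t - (a + \<tau> i))" using elim(4) by (simp add: algebra_simps)
      qed
    qed
    then show ?case using \<delta>' by blast
  qed
  have "A < \<epsilon>"
  proof (rule ccontr)
    assume "\<not> A < \<epsilon>"
    then have A: "0 < A" using \<epsilon> by simp
    \<comment> \<open>Then \<open>k\<close> increments of size \<open>A / 2\<close> add up to more
      than \<open>2 * B\<close>, the largest possible variation of \<open>Y\<close>.\<close>
    obtain k :: nat where k: "4 * B / A < of_nat k" using reals_Archimedean2 by blast
    obtain a where a: "\<And>j. j \<le> k \<Longrightarrow> a + of_nat j * x \<in> arrivals"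
      using arithmetic_progression_in_arrivals[OF x(1)] by blast
    have "\<forall>j\<in>{..k}. \<exists>\<delta>>0. \<forall>\<^sub>F t in at_top. A - \<delta> < D t \<longrightarrow> A - A / 2 < D (t - (a + of_nat j * x))"
      using backward[OF a, of _ "A / 2"] A by auto
    then obtain f where f: "\<And>j. j \<le> k \<Longrightarrow> 0 < f j"
      "\<And>j. j \<le> k \<Longrightarrow> \<forall>\<^sub>F t in at_top. A - f j < D t \<longrightarrow> A - A / 2 < D (t - (a + of_nat j * x))"
      by (auto dest!: bchoice)
    define \<delta> where "\<delta> = Min (f ` {..k})"
    have \<delta>: "0 < \<delta>" "\<And>j. j \<le> k \<Longrightarrow> \<delta> \<le> f j" using f(1) by (auto simp: \<delta>_def)
    have "\<forall>\<^sub>F t in at_top. \<forall>j\<in>{..k}. A - f j < D t \<longrightarrow> A - A / 2 < D (t - (a + of_nat j * x))"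
      using f(2) by (intro eventually_ball_finite) auto
    with eventually_ge_at_top[of "T0 + a + of_nat k * x"]
    have "\<forall>\<^sub>F t in at_top. T0 + a + of_nat k * x \<le> t \<and>
        (\<forall>j\<in>{..k}. A - f j < D t \<longrightarrow> A - A / 2 < D (t - (a + of_nat j * x)))"
      by (rule eventually_conj)
    \<comment> \<open>The progression is finite, so a single time \<open>t\<close> with
      \<open>D t\<close> close to \<open>A\<close> serves all of its members.\<close>
    from frequently_ex[OF frequently_eventually_frequently[OF lower[OF \<delta>(1)] this]]
    obtain t where t: "T0 + a + of_nat k * x \<le> t" "A - \<delta> < D t"
      "\<And>j. j \<le> k \<Longrightarrow> A - f j < D t \<Longrightarrow> A / 2 < D (t - (a + of_nat j * x))"
      by auto
    \<comment> \<open>The earliest time reached. Counting from \<open>s\<close> reverses the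
      progression: the member with index \<open>k - j\<close> becomes
      \<open>s + j * x\<close>.\<close>
    define s where "s = t - a - of_nat k * x"
    have s: "s \<ge> T0" using t unfolding s_def by simp
    have Dj: "D (s + of_nat j * x) > A / 2" if "j \<le> k" for j
    proof -
      have "D (t - (a + of_nat (k - j) * x)) > A / 2" using t(2,3) \<delta>(2)[of "k - j"] by (auto simp del: of_nat_diff)
      also have "t - (a + of_nat (k - j) * x) = s + of_nat j * x"
        using that by (simp add: s_def of_nat_diff algebra_simps)
      finally show ?thesis .
    qed
    have "Y (s + of_nat m * x) - Y s \<ge> of_nat m * (A / 2)" if "m \<le> k" for m
      using that
    proof (induction m)
      case (Suc m)
      have "of_nat (Suc m) * (A / 2) = of_nat m * (A / 2) + A / 2" by (simp add: algebra_simps)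
      moreover have "s + of_nat (Suc m) * x = s + of_nat m * x + x" by (simp add: algebra_simps)
      ultimately show ?case using Suc Dj[of m] by (simp only: D_def) (smt (verit) Suc_leD)
    qed auto
    then have "of_nat k * (A / 2) \<le> Y (s + of_nat k * x) - Y s" by simp
    also have "\<dots> \<le> 2 * B" using B[of s] B[of "s + of_nat k * x"] s x(2)
      by (smt (verit) of_nat_0_le_iff mult_nonneg_nonneg)
    finally show False using k A by (simp add: field_simps)
  qed
  then show ?thesis using upper[of "\<epsilon> - A"] by (simp add: D_def)
qed

text \<open>The hypotheses are invariant under negating \<open>Y\<close> and \<open>\<eta>\<close>,
  so the one-sided bound gives both sides.\<close>

lemma increment_tendsto_0:
  assumes x: "x \<in> group_closure (\<tau> ` I)" "0 < x"
    and B: "\<And>t. T0 \<le> t \<Longrightarrow> \<bar>Y t\<bar> \<le> B"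
    and eq: "\<And>t. T0 \<le> t \<Longrightarrow> Y t = (\<Sum>i\<in>I. w i * Y (t - \<tau> i)) + \<eta> t"
    and \<eta>: "(\<eta> \<longlongrightarrow> 0) at_top"
  shows "((\<lambda>t. Y (t + x) - Y t) \<longlongrightarrow> 0) at_top"
proof (rule tendstoI)
  fix \<epsilon> :: real assume \<epsilon>: "0 < \<epsilon>"
  have "\<forall>\<^sub>F t in at_top. Y (t + x) - Y t < \<epsilon>"
    by (rule increment_eventually_less[OF x B eq \<eta> \<epsilon>])
  moreover have "\<forall>\<^sub>F t in at_top. - Y (t + x) - - Y t < \<epsilon>"
  proof (rule increment_eventually_less[OF x, of T0 "\<lambda>t. - Y t" B "\<lambda>t. - \<eta> t"])
    show "\<bar>- Y t\<bar> \<le> B" if "T0 \<le> t" for t using B[OF that] by simp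
    show "- Y t = (\<Sum>i\<in>I. w i * - Y (t - \<tau> i)) + - \<eta> t" if "T0 \<le> t" for t
      using eq[OF that] by (simp add: sum_negf)
    show "((\<lambda>t. - \<eta> t) \<longlongrightarrow> 0) at_top" using tendsto_minus[OF \<eta>] by simp
  qed (rule \<epsilon>)
  ultimately show "\<forall>\<^sub>F t in at_top. dist (Y (t + x) - Y t) 0 < \<epsilon>"
    by eventually_elim (auto simp: dist_real_def)
qed

end

text \<open>Extending \<open>F\<close> by 0 to negative times makes the equation hold on the whole
  line and moves all initial data into \<open>g\<close>. In the application this truncation is what
  the indicators in \<open>mf_lambda\<close> express.\<close>

locale renewal_equation = renewal +
  fixes F g :: "real \<Rightarrow> real" and C \<gamma> :: real
  assumes F_neg: "t < 0 \<Longrightarrow> F t = 0"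
    and F_eq: "F t = (\<Sum>i\<in>I. w i * F (t - \<tau> i)) + g t"
    and F_meas [measurable]: "F \<in> borel_measurable borel"
    and g_le: "0 \<le> t \<Longrightarrow> \<bar>g t\<bar> \<le> C * exp (- \<gamma> * t)"
    and \<gamma>_pos: "0 < \<gamma>"
begin

lemma g_neg:
  assumes "t < 0"
  shows "g t = 0"
proof -
  have "(\<Sum>i\<in>I. w i * F (t - \<tau> i)) = 0"
  proof (intro sum.neutral ballI)
    fix i assume "i \<in> I"
    then have "t - \<tau> i < 0" using \<tau>_pos[of i] assms by simp
    then show "w i * F (t - \<tau> i) = 0" by (simp add: F_neg)
  qed
  then show ?thesis using F_eq[of t] F_neg[OF assms] by simp
qed

lemma C_nonneg: "0 \<le> C"
  using g_le[of 0] by simp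

lemma abs_g_le: "\<bar>g t\<bar> \<le> C * exp (- \<gamma> * t)"
  using g_le[of t] g_neg[of t] C_nonneg by (cases "0 \<le> t") auto

lemma g_meas [measurable]: "g \<in> borel_measurable borel"
proof -
  have "g = (\<lambda>t. F t - (\<Sum>i\<in>I. w i * F (t - \<tau> i)))"
  proof
    show "g t = F t - (\<Sum>i\<in>I. w i * F (t - \<tau> i))" for t using F_eq[of t] by simp
  qed
  also have "\<dots> \<in> borel_measurable borel" by measurable
  finally show ?thesis .
qed

definition \<tau>_max :: real where "\<tau>_max = Max (\<tau> ` I)"

lemma \<tau>_le_max: "i \<in> I \<Longrightarrow> \<tau> i \<le> \<tau>_max"
  unfolding \<tau>_max_def using finite_I by auto

lemma F_bounded: obtains B where "0 \<le> B" "\<And>t. \<bar>F t\<bar> \<le> B"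
proof -
  obtain B where B: "\<And>t. - \<tau>_max \<le> t \<Longrightarrow> \<bar>F t\<bar> \<le> B"
    by (rule bounded_solution[of \<tau>_max F 0 g C \<gamma>])
       (use g_le in \<open>auto simp: \<tau>_le_max F_neg \<gamma>_pos intro: F_eq\<close>)
  have "\<bar>F t\<bar> \<le> max 0 B" for t
    using B[of t] F_neg[of t] \<tau>_le_max \<tau>_pos I_nonempty by (cases "t < 0") force+
  then show ?thesis using that[of "max 0 B"] by auto
qed

section \<open>The primitive of \<open>F\<close> and averages of \<open>F\<close>\<close>

definition cum :: "real \<Rightarrow> real" where
  "cum T = (LINT t:{0..T}|lborel. F t)"

definition total :: real where
  "total = (LINT t|lborel. g t)"

text \<open>The limit predicted by the renewal theorem: the integral of the forcing over the mean
  step.\<close>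

definition level :: real where
  "level = total / mean"

lemma F_integrable: "set_integrable lborel {a..b} F"
proof -
  obtain B where B: "\<And>t. \<bar>F t\<bar> \<le> B" using F_bounded by blast
  show ?thesis
    unfolding set_integrable_def
    by (rule integrableI_bounded_set[where A = "{a..b}" and B = B])
       (use B in \<open>auto simp: indicator_def emeasure_lborel_Icc_eq\<close>)
qed

lemma exp_tail:
  assumes "0 \<le> a"
  shows "integrable lborel (\<lambda>t. indicator {a..} t * exp (- \<gamma> * t))"
    and "(LINT t|lborel. indicator {a..} t * exp (- \<gamma> * t)) = exp (- \<gamma> * a) / \<gamma>"
proof -
  have eq: "(\<integral>\<^sup>+ t. ennreal (indicator {a..} t * exp (- \<gamma> * t)) \<partial>lborel) = ennreal (exp (- \<gamma> * a) / \<gamma>)"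
  proof -
    have "(\<integral>\<^sup>+ t. ennreal (indicator {a..} t * exp (- \<gamma> * t)) \<partial>lborel) =
        (\<integral>\<^sup>+ t. ennreal (exp (- \<gamma> * t)) * indicator {a..} t \<partial>lborel)"
      by (intro nn_integral_cong) (auto simp: indicator_def)
    also have "\<dots> = ennreal (0 - (- exp (- \<gamma> * a) / \<gamma>))"
    proof (rule nn_integral_FTC_atLeast)
      show "((\<lambda>x. - exp (- \<gamma> * x) / \<gamma>) has_real_derivative exp (- \<gamma> * x)) (at x)" for x
        using \<gamma>_pos by (auto intro!: derivative_eq_intros)
      show "((\<lambda>x. - exp (- \<gamma> * x) / \<gamma>) \<longlongrightarrow> 0) at_top"
        using \<gamma>_pos by real_asymp
    qed auto
    finally show ?thesis by simp
  qed
  have "has_bochner_integral lborel (\<lambda>t. indicator {a..} t * exp (- \<gamma> * t)) (exp (- \<gamma> * a) / \<gamma>)"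
    using \<gamma>_pos by (intro has_bochner_integral_nn_integral eq) auto
  then show "integrable lborel (\<lambda>t. indicator {a..} t * exp (- \<gamma> * t))"
    "(LINT t|lborel. indicator {a..} t * exp (- \<gamma> * t)) = exp (- \<gamma> * a) / \<gamma>"
    by (auto simp: has_bochner_integral_iff)
qed

lemma g_integrable: "integrable lborel g"
proof (rule Bochner_Integration.integrable_bound)
  show "integrable lborel (\<lambda>t. C * (indicator {0..} t * exp (- \<gamma> * t)))"
    using exp_tail(1)[of 0] by simp
  show "AE x in lborel. norm (g x) \<le> norm (C * (indicator {0..} x * exp (- \<gamma> * x)))"
    using abs_g_le C_nonneg by (auto simp: indicator_def g_neg)
qed auto

lemma cum_neg: "T < 0 \<Longrightarrow> cum T = 0"
  by (simp add: cum_def set_lebesgue_integral_def)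

lemma cum_conv: "cum T = (LINT t|lborel. indicator {..T} t * F t)"
  unfolding cum_def set_lebesgue_integral_def
  by (intro Bochner_Integration.integral_cong) (auto simp: indicator_def F_neg)

lemma cum_shift: "cum (T - a) = (LINT t|lborel. indicator {..T} t * F (t - a))"
proof -
  have "cum (T - a) = (LINT t|lborel. indicator {..T - a} (- a + 1 * t) * F (- a + 1 * t))"
    unfolding cum_conv by (subst lborel_integral_real_affine[where c = 1 and t = "- a"]) auto
  also have "\<dots> = (LINT t|lborel. indicator {..T} t * F (t - a))"
    by (intro Bochner_Integration.integral_cong) (auto simp: indicator_def)
  finally show ?thesis .
qed

lemma F_shift_integrable:
  assumes "0 \<le> a"
  shows "integrable lborel (\<lambda>t. indicator {..T} t * F (t - a))"
proof -
  obtain B where B: "0 \<le> B" "\<And>t. \<bar>F t\<bar> \<le> B" using F_bounded by blast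
  show ?thesis
    by (rule integrableI_bounded_set[where A = "{0..T}" and B = B])
       (use B assms in \<open>auto simp: indicator_def F_neg not_le emeasure_lborel_Icc_eq\<close>)
qed

lemma cum_eq:
  "cum T = (\<Sum>i\<in>I. w i * cum (T - \<tau> i)) + (LINT t|lborel. indicator {..T} t * g t)"
proof -
  have ig: "integrable lborel (\<lambda>t. indicator {..T} t * g t)"
    using integrable_mult_indicator[OF _ g_integrable, of "{..T}"] by simp
  have iF: "integrable lborel (\<lambda>t. indicator {..T} t * F (t - \<tau> i))" if "i \<in> I" for i
    using F_shift_integrable \<tau>_pos[OF that] by simp
  have "cum T = (LINT t|lborel. (\<Sum>i\<in>I. w i * (indicator {..T} t * F (t - \<tau> i))) + indicator {..T} t * g t)"
    unfolding cum_conv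
    by (intro Bochner_Integration.integral_cong refl, subst F_eq)
       (auto simp: indicator_def)
  also have "\<dots> = (LINT t|lborel. (\<Sum>i\<in>I. w i * (indicator {..T} t * F (t - \<tau> i)))) + (LINT t|lborel. indicator {..T} t * g t)"
    using iF ig by (intro Bochner_Integration.integral_add) auto
  also have "(LINT t|lborel. (\<Sum>i\<in>I. w i * (indicator {..T} t * F (t - \<tau> i)))) =
      (\<Sum>i\<in>I. w i * cum (T - \<tau> i))"
    using iF by (simp add: Bochner_Integration.integral_sum cum_shift)
  finally show ?thesis .
qed

lemma g_tail_le:
  assumes "0 \<le> T"
  shows "\<bar>(LINT t|lborel. indicator {..T} t * g t) - total\<bar> \<le> C / \<gamma> * exp (- \<gamma> * T)"
proof -
  have "(LINT t|lborel. indicator {..T} t * g t) - total = - (LINT t|lborel. g t - indicator {..T} t * g t)"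
    using g_integrable integrable_mult_indicator[OF _ g_integrable, of "{..T}"]
    by (simp add: total_def)
  also have "\<bar>\<dots>\<bar> \<le> (LINT t|lborel. \<bar>g t - indicator {..T} t * g t\<bar>)"
    by simp
  also have "\<dots> \<le> (LINT t|lborel. C * (indicator {T..} t * exp (- \<gamma> * t)))"
    using exp_tail(1)[OF assms] g_integrable integrable_mult_indicator[OF _ g_integrable, of "{..T}"] abs_g_le
    by (intro integral_mono) (auto simp: indicator_def intro: order_trans[OF abs_ge_zero])
  also have "\<dots> = C / \<gamma> * exp (- \<gamma> * T)"
    using exp_tail(2)[OF assms] by simp
  finally show ?thesis .
qed

definition excess :: "real \<Rightarrow> real" where
  "excess T = cum T - level * T"

text \<open>Shifting the linear term by the steps produces \<open>level * mean = total\<close>. This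
  cancels the limit of the integrated forcing and leaves only the tail of \<open>g\<close>, which
  decays exponentially.\<close>

lemma excess_eq:
  "excess T = (\<Sum>i\<in>I. w i * excess (T - \<tau> i)) + ((LINT t|lborel. indicator {..T} t * g t) - total)"
proof -
  have "(\<Sum>i\<in>I. w i * excess (T - \<tau> i)) =
      (\<Sum>i\<in>I. w i * cum (T - \<tau> i)) - level * T * (\<Sum>i\<in>I. w i) + level * mean"
    by (simp add: excess_def mean_def algebra_simps sum_subtractf sum.distrib sum_distrib_left sum_distrib_right)
  then show ?thesis
    using cum_eq[of T] mean_pos by (simp add: w_sum excess_def level_def)
qed

lemma excess_bounded: obtains B where "\<And>t. - \<tau>_max \<le> t \<Longrightarrow> \<bar>excess t\<bar> \<le> B"
proof (rule bounded_solution[of \<tau>_max excess])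
  show "\<bar>excess t\<bar> \<le> \<bar>level\<bar> * \<tau>_max" if "- \<tau>_max \<le> t" "t < 0" for t
  proof -
    have "\<bar>level\<bar> * \<bar>t\<bar> \<le> \<bar>level\<bar> * \<tau>_max" using that by (intro mult_left_mono) auto
    then show ?thesis using that by (simp add: excess_def cum_neg abs_mult)
  qed
  show "excess t = (\<Sum>i\<in>I. w i * excess (t - \<tau> i)) + ((LINT s|lborel. indicator {..t} s * g s) - total)" for t
    by (rule excess_eq)
  show "\<bar>(LINT s|lborel. indicator {..t} s * g s) - total\<bar> \<le> C / \<gamma> * exp (- \<gamma> * t)" if "0 \<le> t" for t
    using g_tail_le[OF that] .
qed (use that \<tau>_le_max \<gamma>_pos in auto)

text \<open>The primitive differs from \<open>level * T\<close> by a bounded amount. No arithmetic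
  property of the steps enters, so this covers the averaged content in the arithmetic case.\<close>

theorem average_tendsto: "((\<lambda>T. cum T / T) \<longlongrightarrow> level) at_top"
proof -
  obtain B where B: "\<And>t. - \<tau>_max \<le> t \<Longrightarrow> \<bar>excess t\<bar> \<le> B" using excess_bounded by blast
  have \<tau>_max: "0 \<le> \<tau>_max" using \<tau>_le_max \<tau>_pos I_nonempty by force
  have "((\<lambda>T. excess T / T) \<longlongrightarrow> 0) at_top"
  proof (rule Lim_null_comparison)
    show "\<forall>\<^sub>F T in at_top. norm (excess T / T) \<le> B / T"
      using eventually_gt_at_top[of 0]
      by eventually_elim (use B \<tau>_max in \<open>auto intro!: divide_right_mono\<close>)
    show "((\<lambda>T. B / T) \<longlongrightarrow> 0) at_top" by real_asymp
  qed
  then have "((\<lambda>T. excess T / T + level) \<longlongrightarrow> 0 + level) at_top"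
    by (intro tendsto_add tendsto_const)
  moreover have "\<forall>\<^sub>F T in at_top. excess T / T + level = cum T / T"
    using eventually_gt_at_top[of 0] by eventually_elim (auto simp: excess_def field_simps)
  ultimately show ?thesis by (simp add: tendsto_cong)
qed

lemma cum_diff:
  assumes "0 \<le> a" "a \<le> b"
  shows "cum b - cum a = (LINT t:{a<..b}|lborel. F t)"
proof -
  have "cum b = (LINT t:{0..a} \<union> {a<..b}|lborel. F t)"
    unfolding cum_def using assms by (simp add: ivl_disj_un)
  also have "\<dots> = cum a + (LINT t:{a<..b}|lborel. F t)"
    unfolding cum_def by (intro set_integral_Un) (auto intro: set_integrable_subset[OF F_integrable[of 0 a]] set_integrable_subset[OF F_integrable[of a b]])
  finally show ?thesis by simp
qed

lemma Ioc_const: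
  fixes a b c :: real
  assumes "a \<le> b"
  shows "set_integrable lborel {a<..b} (\<lambda>_. c)" "(LINT t:{a<..b}|lborel. c) = c * (b - a)"
proof -
  show "set_integrable lborel {a<..b} (\<lambda>_. c)"
    unfolding set_integrable_def
    by (rule integrableI_bounded_set[where A = "{a<..b}" and B = "\<bar>c\<bar>"])
       (use assms in \<open>auto simp: indicator_def\<close>)
  show "(LINT t:{a<..b}|lborel. c) = c * (b - a)"
    using assms by (simp add: set_lebesgue_integral_def)
qed

lemma cum_lipschitz:
  obtains B where "0 \<le> B" "\<And>a b. 0 \<le> a \<Longrightarrow> a \<le> b \<Longrightarrow> \<bar>cum b - cum a\<bar> \<le> B * (b - a)"
proof -
  obtain B where B: "0 \<le> B" "\<And>t. \<bar>F t\<bar> \<le> B" using F_bounded by blast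
  have "\<bar>cum b - cum a\<bar> \<le> B * (b - a)" if "0 \<le> a" "a \<le> b" for a b
  proof -
    have int: "set_integrable lborel {a<..b} F"
      by (rule set_integrable_subset[OF F_integrable[of a b]]) auto
    have "\<bar>cum b - cum a\<bar> \<le> (LINT t:{a<..b}|lborel. \<bar>F t\<bar>)"
      unfolding cum_diff[OF that] using set_integral_norm_bound[OF int] by simp
    also have "\<dots> \<le> (LINT t:{a<..b}|lborel. B)"
      using B int Ioc_const that by (intro set_integral_mono) (auto intro: set_integrable_abs)
    also have "\<dots> = B * (b - a)" using that by (simp add: Ioc_const)
    finally show ?thesis .
  qed
  with B(1) show ?thesis by (rule that)
qed

text \<open>Blackwell's statement for the primitive. It holds for small elements \<open>x\<close> of
  the step group, hence for their multiples; \<open>h\<close> differs from such a multiple by at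
  most \<open>x\<close>, which the Lipschitz bound absorbs.\<close>

lemma cum_increment_tendsto:
  assumes na: "\<not> in_discrete_subgroup (\<tau> ` I)" and h: "0 < h"
  shows "((\<lambda>t. cum (t + h) - cum t) \<longlongrightarrow> level * h) at_top"
proof -
  obtain B where B: "\<And>t. - \<tau>_max \<le> t \<Longrightarrow> \<bar>excess t\<bar> \<le> B" using excess_bounded by blast
  have \<tau>_max: "0 \<le> \<tau>_max" using \<tau>_le_max \<tau>_pos I_nonempty by force
  obtain L where L: "0 \<le> L" "\<And>a b. 0 \<le> a \<Longrightarrow> a \<le> b \<Longrightarrow> \<bar>cum b - cum a\<bar> \<le> L * (b - a)"
    using cum_lipschitz by blast
  define L' where "L' = L + \<bar>level\<bar> + 1"
  have L': "0 < L'" using L by (simp add: L'_def)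
  have lip: "\<bar>excess b - excess a\<bar> \<le> L' * (b - a)" if "0 \<le> a" "a \<le> b" for a b
  proof -
    have "\<bar>excess b - excess a\<bar> \<le> \<bar>cum b - cum a\<bar> + \<bar>level * (b - a)\<bar>"
      by (simp add: excess_def algebra_simps)
    also have "\<dots> \<le> L * (b - a) + \<bar>level\<bar> * (b - a)"
      using L(2)[OF that] that by (simp add: abs_mult)
    also have "\<dots> \<le> L' * (b - a)" using that by (simp add: L'_def algebra_simps)
    finally show ?thesis .
  qed
  have g0: "((\<lambda>t. (LINT s|lborel. indicator {..t} s * g s) - total) \<longlongrightarrow> 0) at_top"
  proof (rule Lim_null_comparison)
    show "\<forall>\<^sub>F t in at_top. norm ((LINT s|lborel. indicator {..t} s * g s) - total) \<le> C / \<gamma> * exp (- \<gamma> * t)"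
      using eventually_ge_at_top[of 0] by eventually_elim (use g_tail_le in auto)
    show "((\<lambda>t. C / \<gamma> * exp (- \<gamma> * t)) \<longlongrightarrow> 0) at_top" using \<gamma>_pos by real_asymp
  qed
  have "((\<lambda>t. excess (t + h) - excess t) \<longlongrightarrow> 0) at_top"
  proof (rule tendstoI)
    fix \<epsilon> :: real assume \<epsilon>: "0 < \<epsilon>"
    \<comment> \<open>With this choice the remainder \<open>h - n * x\<close>, at most
      \<open>x\<close>, changes \<open>excess\<close> by less than
      \<open>\<epsilon> / 2\<close>.\<close>
    obtain x where x: "x \<in> group_closure (\<tau> ` I)" "0 < x" "x < \<epsilon> / (2 * L')"
      using group_closure_small[OF na, of "\<epsilon> / (2 * L')"] \<epsilon> L' by auto
    have step: "((\<lambda>t. excess (t + x) - excess t) \<longlongrightarrow> 0) at_top"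
      by (rule increment_tendsto_0[OF x(1,2), of 0 excess B, OF _ excess_eq g0]) (use B \<tau>_max in auto)
    have many: "((\<lambda>t. excess (t + of_nat n * x) - excess t) \<longlongrightarrow> 0) at_top" for n
    proof (induction n)
      case (Suc n)
      have "filterlim (\<lambda>t. t + of_nat n * x) at_top at_top"
        using filterlim_tendsto_add_at_top[OF tendsto_const[of "of_nat n * x"] filterlim_ident]
        by (simp add: add.commute)
      from filterlim_compose[OF step this] Suc
      have "((\<lambda>t. (excess (t + of_nat n * x + x) - excess (t + of_nat n * x)) +
               (excess (t + of_nat n * x) - excess t)) \<longlongrightarrow> 0 + 0) at_top"
        by (rule tendsto_add)
      then show ?case by (simp add: algebra_simps)
    qed auto
    define n where "n = nat \<lfloor>h / x\<rfloor>"
    have n: "of_nat n * x \<le> h" "h \<le> of_nat n * x + x"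
    proof -
      have "real n = of_int \<lfloor>h / x\<rfloor>" unfolding n_def using h x by simp
      moreover have "of_int \<lfloor>h / x\<rfloor> \<le> h / x" "h / x \<le> (of_int \<lfloor>h / x\<rfloor> + 1 :: real)" by linarith+
      ultimately have "real n \<le> h / x" "h / x \<le> real n + 1" by simp_all
      then show "of_nat n * x \<le> h" "h \<le> of_nat n * x + x"
        using x(2) by (simp_all only: pos_le_divide_eq pos_divide_le_eq distrib_right mult_1_left)
    qed
    have "\<forall>\<^sub>F t in at_top. dist (excess (t + of_nat n * x) - excess t) 0 < \<epsilon> / 2"
      using many \<epsilon> by (intro tendstoD) auto
    then show "\<forall>\<^sub>F t in at_top. dist (excess (t + h) - excess t) 0 < \<epsilon>"
      using eventually_ge_at_top[of 0]
    proof eventually_elim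
      case (elim t)
      have "0 \<le> of_nat n * x" using x by simp
      then have "\<bar>excess (t + h) - excess (t + of_nat n * x)\<bar> \<le> L' * (h - of_nat n * x)"
        using lip[of "t + of_nat n * x" "t + h"] elim n by simp
      also have "\<dots> \<le> L' * x" using n L' by (intro mult_left_mono) auto
      also have "\<dots> < \<epsilon> / 2" using x L' by (simp add: field_simps)
      finally have "\<bar>excess (t + h) - excess (t + of_nat n * x)\<bar> < \<epsilon> / 2" .
      moreover have "\<bar>excess (t + of_nat n * x) - excess t\<bar> < \<epsilon> / 2" using elim(1) by (simp add: dist_real_def)
      ultimately have "\<bar>excess (t + h) - excess t\<bar> < \<epsilon>" by linarith
      then show ?case by (simp add: dist_real_def)
    qed
  qed
  then have "((\<lambda>t. (excess (t + h) - excess t) + level * h) \<longlongrightarrow> 0 + level * h) at_top"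
    by (intro tendsto_add tendsto_const)
  then show ?thesis by (simp add: excess_def algebra_simps)
qed

lemma small_exponent:
  assumes "open U" "x \<in> U"
  obtains h :: real where "0 < h" "exp (c * h) * x \<in> U"
proof -
  have "((\<lambda>h. exp (c * h) * x) \<longlongrightarrow> x) (at_right 0)"
    by (rule tendsto_eq_intros refl | simp)+
  from eventually_conj[OF topological_tendstoD[OF this assms] eventually_at_right_less]
  show ?thesis
    using that eventually_happens'[of "at_right (0::real)"] by auto
qed

text \<open>A Tauberian argument. The one-sided growth bound compares \<open>F t\<close> with the
  means of \<open>F\<close> over the windows of length \<open>h\<close> on both sides of
  \<open>t\<close>, up to the factor \<open>exp (a * h)\<close>. Both means tend to
  \<open>level\<close>, and then \<open>h\<close> can be taken small.\<close>

theorem nonarithmetic_tendsto: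
  assumes na: "\<not> in_discrete_subgroup (\<tau> ` I)"
    and a: "0 \<le> a" and F_nonneg: "\<And>t. 0 \<le> F t"
    and mono: "(\<forall>s t. 0 \<le> s \<longrightarrow> s \<le> t \<longrightarrow> F t \<le> exp (a * (t - s)) * F s) \<or>
               (\<forall>s t. 0 \<le> s \<longrightarrow> s \<le> t \<longrightarrow> F s \<le> exp (a * (t - s)) * F t)"
  shows "(F \<longlongrightarrow> level) at_top"
proof -
  have fwd: "((\<lambda>t. (cum (t + h) - cum t) / h) \<longlongrightarrow> level) at_top" if "0 < h" for h
    using tendsto_divide[OF cum_increment_tendsto[OF na that] tendsto_const[of h]] that by simp
  have bwd: "((\<lambda>t. (cum t - cum (t - h)) / h) \<longlongrightarrow> level) at_top" if "0 < h" for h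
  proof -
    have "filterlim (\<lambda>t. t - h) at_top at_top"
      using filterlim_tendsto_add_at_top[OF tendsto_const[of "- h"] filterlim_ident] by simp
    from filterlim_compose[OF fwd[OF that] this] show ?thesis by simp
  qed
  have int: "set_integrable lborel {x<..y} F" for x y
    by (rule set_integrable_subset[OF F_integrable[of x y]]) auto
  have le: "(cum y - cum x) \<le> b * (y - x)"
    if "0 \<le> x" "x < y" "\<And>t. x < t \<Longrightarrow> t \<le> y \<Longrightarrow> F t \<le> b" for x y b
  proof -
    have "(cum y - cum x) \<le> (LINT t:{x<..y}|lborel. b)"
      using that int by (subst cum_diff) (auto intro!: set_integral_mono Ioc_const)
    then show ?thesis using that(2) by (simp add: Ioc_const)
  qed
  have ge: "b * (y - x) \<le> (cum y - cum x)"
    if "0 \<le> x" "x < y" "\<And>t. x < t \<Longrightarrow> t \<le> y \<Longrightarrow> b \<le> F t" for x y b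
  proof -
    have "(LINT t:{x<..y}|lborel. b) \<le> (cum y - cum x)"
      using that int by (subst cum_diff) (auto intro!: set_integral_mono Ioc_const)
    then show ?thesis using that(2) by (simp add: Ioc_const)
  qed
  have grow: "exp (a * (t - s)) * F r \<le> exp (a * h) * F r" if "t - s \<le> h" for t s r h
    using a F_nonneg that by (intro mult_right_mono) (auto intro: mult_left_mono)
  have inv: "exp (- a * h) * exp (a * h) = 1" "exp (a * h) * exp (- a * h) = 1" for h
    by (simp_all add: exp_minus)
  have undo: "exp (- a * h) * y \<le> z" if "y \<le> exp (a * h) * z" for h y z
  proof -
    have "exp (- a * h) * y \<le> exp (- a * h) * (exp (a * h) * z)" using that by (intro mult_left_mono) auto
    also have "\<dots> = z" by (simp only: mult.assoc[symmetric] inv mult_1_left)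
    finally show ?thesis .
  qed
  have undo': "z \<le> exp (a * h) * y" if "exp (- a * h) * z \<le> y" for h y z
  proof -
    have "exp (a * h) * (exp (- a * h) * z) \<le> exp (a * h) * y" using that by (intro mult_left_mono) auto
    then show ?thesis by (simp only: mult.assoc[symmetric] inv mult_1_left)
  qed
  \<comment> \<open>Which window bounds \<open>F t\<close> from above and which from below depends
    on the alternative in \<open>mono\<close>; \<open>min\<close> and \<open>max\<close> treat both
    at once.\<close>
  have between: "exp (- a * h) * min ((cum (t + h) - cum t) / h) ((cum t - cum (t - h)) / h) \<le> F t \<and>
      F t \<le> exp (a * h) * max ((cum (t + h) - cum t) / h) ((cum t - cum (t - h)) / h)"
    (is "exp (- a * h) * min (?f h t) (?b h t) \<le> _ \<and> _ \<le> _") if h: "0 < h" "h \<le> t" for h t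
  proof -
    have "(exp (- a * h) * ?f h t \<le> F t \<and> F t \<le> exp (a * h) * ?b h t) \<or> (exp (- a * h) * ?b h t \<le> F t \<and> F t \<le> exp (a * h) * ?f h t)"
      using mono
    proof
      assume m: "\<forall>s t. 0 \<le> s \<longrightarrow> s \<le> t \<longrightarrow> F t \<le> exp (a * (t - s)) * F s"
      have m': "F t \<le> exp (a * h) * F s" if "0 \<le> s" "s \<le> t" "t - s \<le> h" for s t
        using m[rule_format, of s t] grow[of t s h s] that by linarith
      have "cum (t + h) - cum t \<le> (exp (a * h) * F t) * (t + h - t)"
        "(exp (- a * h) * F t) * (t - (t - h)) \<le> cum t - cum (t - h)"
        using h by (intro le m'; simp) (use h in \<open>intro ge undo m'; simp\<close>)
      then show ?thesis
        using h by (intro disjI1 conjI, intro undo, simp add: pos_divide_le_eq,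
          intro undo', simp add: pos_le_divide_eq)
    next
      assume m: "\<forall>s t. 0 \<le> s \<longrightarrow> s \<le> t \<longrightarrow> F s \<le> exp (a * (t - s)) * F t"
      have m': "F s \<le> exp (a * h) * F t" if "0 \<le> s" "s \<le> t" "t - s \<le> h" for s t
        using m[rule_format, of s t] grow[of t s h t] that by linarith
      have "(exp (- a * h) * F t) * (t + h - t) \<le> cum (t + h) - cum t"
        "cum t - cum (t - h) \<le> (exp (a * h) * F t) * (t - (t - h))"
        using h by (intro ge undo m'; simp) (use h in \<open>intro le m'; simp\<close>)
      then show ?thesis
        using h by (intro disjI2 conjI, intro undo, simp add: pos_divide_le_eq,
          intro undo', simp add: pos_le_divide_eq)
    qed
    moreover have "exp (- a * h) * min (?f h t) (?b h t) \<le> exp (- a * h) * x" "exp (a * h) * x \<le> exp (a * h) * max (?f h t) (?b h t)"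
      if "x \<in> {?f h t, ?b h t}" for x
      using that by (auto intro!: mult_left_mono)
    ultimately show ?thesis by (meson insertCI order_trans)
  qed
  show ?thesis
  proof (rule order_tendstoI)
    fix y assume "y < level"
    then obtain h where h: "0 < h" "y < exp (- a * h) * level"
      using small_exponent[of "{y<..}" level "- a"] by auto
    have "((\<lambda>t. exp (- a * h) * min (?f h t) (?b h t)) \<longlongrightarrow> exp (- a * h) * min level level) at_top"
      by (intro tendsto_mult_left tendsto_min fwd bwd h)
    then have "\<forall>\<^sub>F t in at_top. y < exp (- a * h) * min (?f h t) (?b h t)"
      using h(2) by (intro order_tendstoD(1)) auto
    with eventually_ge_at_top[of h] show "\<forall>\<^sub>F t in at_top. y < F t"
      by eventually_elim (use between[OF h(1)] in \<open>blast intro: less_le_trans\<close>)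
  next
    fix y assume "level < y"
    then obtain h where h: "0 < h" "exp (a * h) * level < y"
      using small_exponent[of "{..<y}" level a] by auto
    have "((\<lambda>t. exp (a * h) * max (?f h t) (?b h t)) \<longlongrightarrow> exp (a * h) * max level level) at_top"
      by (intro tendsto_mult_left tendsto_max fwd bwd h)
    then have "\<forall>\<^sub>F t in at_top. exp (a * h) * max (?f h t) (?b h t) < y"
      using h(2) by (intro order_tendstoD(2)) auto
    with eventually_ge_at_top[of h] show "\<forall>\<^sub>F t in at_top. F t < y"
      by eventually_elim (use between[OF h(1)] in \<open>blast intro: le_less_trans\<close>)
  qed
qed

section \<open>Lattice sums for the arithmetic case\<close>

lemma summable_past:
  fixes f :: "real \<Rightarrow> real"
  assumes "\<And>t. t < 0 \<Longrightarrow> f t = 0" "0 < u"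
  shows "summable (\<lambda>j. f (t - of_nat j * u))"
proof (rule summable_finite)
  fix j assume "j \<notin> {..nat \<lceil>t / u\<rceil>}"
  then have "t / u < of_nat j" by (simp add: not_le) linarith
  then show "f (t - of_nat j * u) = 0" using assms by (simp add: field_simps)
qed simp

definition past :: "real \<Rightarrow> real \<Rightarrow> real" where
  "past u t = (\<Sum>j. g (t - of_nat j * u))"

text \<open>Starting at \<open>Suc j\<close> leaves the term at \<open>t\<close> itself to
  \<open>past\<close>, so the two sums partition the lattice through \<open>t\<close>.\<close>

definition future :: "real \<Rightarrow> real \<Rightarrow> real" where
  "future u t = (\<Sum>j. g (t + of_nat (Suc j) * u))"

text \<open>The discrete counterpart of \<open>cum\<close>; its increment over one period is a value
  of \<open>F\<close>.\<close>

definition train :: "real \<Rightarrow> real \<Rightarrow> real" where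
  "train u t = (\<Sum>j. F (t - of_nat j * u))"

text \<open>The discrete counterpart of \<open>total\<close>: the sum of \<open>g\<close> over the
  whole lattice of mesh \<open>u\<close> through \<open>t\<close>. It depends on \<open>t\<close>
  only modulo \<open>u\<close>.\<close>

definition comb :: "real \<Rightarrow> real \<Rightarrow> real" where
  "comb u t = past u t + future u t"

context
  fixes u :: real
  assumes u_pos: "0 < u"
begin

lemma geometric_future:
  "(\<lambda>j. C * exp (- \<gamma> * t) * exp (- \<gamma> * u) ^ j) sums (C * exp (- \<gamma> * t) * (1 / (1 - exp (- \<gamma> * u))))"
  using u_pos \<gamma>_pos by (intro sums_mult geometric_sums) auto

lemma future_term_le: "\<bar>g (t + of_nat (Suc j) * u)\<bar> \<le> C * exp (- \<gamma> * t) * exp (- \<gamma> * u) ^ j"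
proof -
  have "\<bar>g (t + of_nat (Suc j) * u)\<bar> \<le> C * exp (- \<gamma> * (t + of_nat (Suc j) * u))" by (rule abs_g_le)
  also have "\<dots> \<le> C * exp (- \<gamma> * t + of_nat j * (- \<gamma> * u))"
    using C_nonneg u_pos \<gamma>_pos by (intro mult_left_mono) (auto simp: algebra_simps)
  also have "\<dots> = C * exp (- \<gamma> * t) * exp (- \<gamma> * u) ^ j"
    by (simp only: exp_add exp_of_nat_mult mult.assoc)
  finally show ?thesis .
qed

lemma summable_future_norm: "summable (\<lambda>j. norm (g (t + of_nat (Suc j) * u)))"
  by (rule summable_comparison_test'[OF sums_summable[OF geometric_future[of t]], of 0])
     (use future_term_le in auto)

lemma summable_future: "summable (\<lambda>j. g (t + of_nat (Suc j) * u))"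
  by (rule summable_norm_cancel[OF summable_future_norm])

lemma abs_future_le: "\<bar>future u t\<bar> \<le> C / (1 - exp (- \<gamma> * u)) * exp (- \<gamma> * t)"
proof -
  have "\<bar>future u t\<bar> \<le> (\<Sum>j. norm (g (t + of_nat (Suc j) * u)))"
    unfolding future_def using summable_norm[OF summable_future_norm] by simp
  also have "\<dots> \<le> (\<Sum>j. C * exp (- \<gamma> * t) * exp (- \<gamma> * u) ^ j)"
    using future_term_le by (intro suminf_le summable_future_norm sums_summable[OF geometric_future]) auto
  also have "\<dots> = C / (1 - exp (- \<gamma> * u)) * exp (- \<gamma> * t)"
    using sums_unique[OF geometric_future[of t]] by simp
  finally show ?thesis .
qed

lemma past_rec: "past u t = g t + past u (t - u)"
proof -
  have "past u t = g (t - of_nat 0 * u) + (\<Sum>j. g (t - of_nat (Suc j) * u))"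
    unfolding past_def using suminf_split_head[OF summable_past[of g u t]] g_neg u_pos by simp
  also have "(\<Sum>j. g (t - of_nat (Suc j) * u)) = past u (t - u)"
    unfolding past_def by (intro suminf_cong) (auto simp: algebra_simps)
  finally show ?thesis by simp
qed

lemma train_rec: "train u t = F t + train u (t - u)"
proof -
  have "train u t = F (t - of_nat 0 * u) + (\<Sum>j. F (t - of_nat (Suc j) * u))"
    unfolding train_def using suminf_split_head[OF summable_past[of F u t]] F_neg u_pos by simp
  also have "(\<Sum>j. F (t - of_nat (Suc j) * u)) = train u (t - u)"
    unfolding train_def by (intro suminf_cong) (auto simp: algebra_simps)
  finally show ?thesis by simp
qed

lemma future_rec: "future u (t - u) = g t + future u t"
proof -
  have "(\<Sum>j. g (t - u + of_nat (Suc (Suc j)) * u)) = future u (t - u) - g (t - u + of_nat (Suc 0) * u)"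
    unfolding future_def using suminf_split_head[OF summable_future[of "t - u"]] by simp
  moreover have "(\<Sum>j. g (t - u + of_nat (Suc (Suc j)) * u)) = future u t"
    unfolding future_def by (intro suminf_cong) (auto simp: algebra_simps)
  ultimately show ?thesis by simp
qed

text \<open>A shift by one period moves exactly one term between \<open>past\<close> and
  \<open>future\<close>.\<close>

lemma comb_periodic: "comb u (t - of_nat k * u) = comb u t"
proof (induction k)
  case (Suc k)
  have "comb u (t - of_nat (Suc k) * u) = comb u (t - of_nat k * u - u)" by (simp add: algebra_simps)
  also have "\<dots> = comb u (t - of_nat k * u)"
    unfolding comb_def using past_rec[of "t - of_nat k * u"] future_rec[of "t - of_nat k * u"] by simp
  finally show ?case using Suc by simp
qed simp

lemma train_eq: "train u t = (\<Sum>i\<in>I. w i * train u (t - \<tau> i)) + past u t"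
proof -
  have "train u t = (\<Sum>j. (\<Sum>i\<in>I. w i * F (t - of_nat j * u - \<tau> i)) + g (t - of_nat j * u))"
    unfolding train_def using F_eq by (intro suminf_cong)
  also have "\<dots> = (\<Sum>j. (\<Sum>i\<in>I. w i * F (t - \<tau> i - of_nat j * u)) + g (t - of_nat j * u))"
    by (simp add: algebra_simps)
  also have "\<dots> = (\<Sum>j. \<Sum>i\<in>I. w i * F (t - \<tau> i - of_nat j * u)) + past u t"
    unfolding past_def
    by (intro suminf_add[symmetric] summable_sum summable_mult summable_past) (auto simp: F_neg g_neg u_pos)
  also have "(\<Sum>j. \<Sum>i\<in>I. w i * F (t - \<tau> i - of_nat j * u)) = (\<Sum>i\<in>I. \<Sum>j. w i * F (t - \<tau> i - of_nat j * u))"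
    by (intro suminf_sum summable_mult summable_past) (auto simp: F_neg u_pos)
  also have "\<dots> = (\<Sum>i\<in>I. w i * train u (t - \<tau> i))"
    unfolding train_def by (intro sum.cong refl suminf_mult summable_past) (auto simp: F_neg u_pos)
  finally show ?thesis .
qed

lemma train_neg: "t < 0 \<Longrightarrow> train u t = 0"
  unfolding train_def using u_pos F_neg by (subst suminf_eq_zero_iff) (auto simp: add_pos_nonneg less_le_trans intro!: )

text \<open>Non-negative indices give \<open>past\<close>, negative ones \<open>future\<close>. The
  index set may be restricted because \<open>g\<close> vanishes at negative times.\<close>

lemma has_sum_comb: "((\<lambda>n::int. g (t - of_int n * u)) has_sum comb u t) {n. of_int n * u \<le> t}"
proof -
  have "((\<lambda>j::nat. g (t - of_nat j * u)) has_sum past u t) UNIV"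
  proof (rule norm_summable_imp_has_sum)
    show "summable (\<lambda>j. norm (g (t - of_nat j * u)))"
      using summable_past[of "\<lambda>t. norm (g t)" u t] g_neg u_pos by simp
    show "(\<lambda>j. g (t - of_nat j * u)) sums past u t"
      unfolding past_def using summable_past[of g u t] g_neg u_pos by (simp add: summable_sums)
  qed
  then have 1: "((\<lambda>n::int. g (t - of_int n * u)) has_sum past u t) (range int)"
    by (subst has_sum_reindex) (auto simp: o_def)
  have "((\<lambda>j::nat. g (t + of_nat (Suc j) * u)) has_sum future u t) UNIV"
    unfolding future_def
    by (intro norm_summable_imp_has_sum summable_future_norm summable_sums summable_future)
  then have 2: "((\<lambda>n::int. g (t - of_int n * u)) has_sum future u t) (range (\<lambda>j. - int (Suc j)))"
    by (subst has_sum_reindex) (auto simp: o_def inj_on_def algebra_simps)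
  have "((\<lambda>n::int. g (t - of_int n * u)) has_sum comb u t) (range int \<union> range (\<lambda>j. - int (Suc j)))"
    unfolding comb_def by (intro has_sum_Un_disjoint 1 2) auto
  also have "range int \<union> range (\<lambda>j. - int (Suc j)) = UNIV"
    by (metis (no_types, lifting) UNIV_eq_I UnI1 UnI2 int_cases rangeI)
  finally show ?thesis
    by (subst has_sum_cong_neutral[where g = "\<lambda>n::int. g (t - of_int n * u)" and T = UNIV])
       (auto simp: g_neg)
qed

theorem arithmetic_tendsto:
  assumes u: "u \<in> group_closure (\<tau> ` I)"
    and \<tau>_mult: "\<And>i. i \<in> I \<Longrightarrow> \<exists>k. \<tau> i = of_nat k * u"
  shows "((\<lambda>t. F t - u / mean * comb u t) \<longlongrightarrow> 0) at_top"
proof -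
  \<comment> \<open>The forcing \<open>past\<close> of \<open>train\<close> does not converge to a
    constant but approaches the periodic function \<open>comb\<close>. All steps are multiples of
    \<open>u\<close>, so \<open>comb\<close> behaves like a constant under them, and the linear
    correction leaves the forcing \<open>- future\<close>.\<close>
  define Y where "Y t = train u t - t / mean * comb u t" for t
  define B0 where "B0 = C / (1 - exp (- \<gamma> * u))"
  have B0: "0 \<le> B0" using C_nonneg u_pos \<gamma>_pos by (simp add: B0_def)
  have per: "comb u (t - \<tau> i) = comb u t" if "i \<in> I" for t i
    using comb_periodic \<tau>_mult[OF that] by auto
  have Y_eq: "Y t = (\<Sum>i\<in>I. w i * Y (t - \<tau> i)) + - future u t" for t
  proof -
    have "(\<Sum>i\<in>I. w i * Y (t - \<tau> i)) =
        (\<Sum>i\<in>I. w i * train u (t - \<tau> i) - (w i * t - w i * \<tau> i) * (comb u t / mean))"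
      unfolding Y_def by (intro sum.cong refl) (auto simp: per diff_divide_distrib algebra_simps)
    also have "\<dots> = (\<Sum>i\<in>I. w i * train u (t - \<tau> i)) - (\<Sum>i\<in>I. w i * t - w i * \<tau> i) * (comb u t / mean)"
      by (subst sum_subtractf) (simp only: sum_distrib_right)
    also have "(\<Sum>i\<in>I. w i * t - w i * \<tau> i) = t - mean"
      by (simp add: sum_subtractf w_sum mean_def flip: sum_distrib_right)
    finally show ?thesis
      using train_eq[of t] mean_pos unfolding Y_def comb_def by (simp add: field_simps)
  qed
  obtain B where B: "\<And>t. - \<tau>_max \<le> t \<Longrightarrow> \<bar>Y t\<bar> \<le> B"
  proof (rule bounded_solution[of \<tau>_max Y _ "\<lambda>t. - future u t" B0 \<gamma>, OF \<tau>_le_max _ Y_eq])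
    \<comment> \<open>At negative times \<open>train\<close> and \<open>past\<close> vanish, so only
      \<open>t / mean * future\<close> remains to be bounded.\<close>
    show "\<bar>Y t\<bar> \<le> \<tau>_max / mean * (B0 * exp (\<gamma> * \<tau>_max))" if "- \<tau>_max \<le> t" "t < 0" for t
    proof -
      have "past u t = 0" unfolding past_def using that u_pos
        by (subst suminf_cong[of _ "\<lambda>_. 0"]) (auto intro!: g_neg simp: less_le_trans[of _ 0])
      moreover have "\<bar>future u t\<bar> \<le> B0 * exp (\<gamma> * \<tau>_max)"
      proof -
        have "B0 * exp (- \<gamma> * t) \<le> B0 * exp (\<gamma> * \<tau>_max)"
          using mult_left_mono[of "- t" \<tau>_max \<gamma>] that B0 \<gamma>_pos by (intro mult_left_mono) auto
        then show ?thesis using abs_future_le[of t] by (simp add: B0_def)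
      qed
      moreover have "\<bar>t / mean\<bar> \<le> \<tau>_max / mean" using that mean_pos divide_right_mono[of "- t" \<tau>_max mean] by auto
      ultimately show ?thesis
        using that mean_pos unfolding Y_def comb_def train_neg[OF that(2)]
        by (simp only: abs_mult diff_0 abs_minus_cancel add_0) (intro mult_mono, auto)
    qed
    show "\<bar>- future u t\<bar> \<le> B0 * exp (- \<gamma> * t)" for t
      using abs_future_le[of t] by (simp add: B0_def)
  qed (auto simp: \<gamma>_pos)
  have \<tau>_max: "0 \<le> \<tau>_max" using \<tau>_le_max \<tau>_pos I_nonempty by force
  have fut0: "((\<lambda>t. - future u t) \<longlongrightarrow> 0) at_top"
  proof (rule Lim_null_comparison)
    show "\<forall>\<^sub>F t in at_top. norm (- future u t) \<le> B0 * exp (- \<gamma> * t)"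
      using abs_future_le by (simp add: B0_def)
    show "((\<lambda>t. B0 * exp (- \<gamma> * t)) \<longlongrightarrow> 0) at_top" using \<gamma>_pos by real_asymp
  qed
  have inc: "((\<lambda>t. Y (t + u) - Y t) \<longlongrightarrow> 0) at_top"
    by (rule increment_tendsto_0[OF u u_pos _ Y_eq fut0, of 0 B]) (use B \<tau>_max in auto)
  have sh: "filterlim (\<lambda>t. t - u) at_top at_top"
    using filterlim_tendsto_add_at_top[OF tendsto_const[of "- u"] filterlim_ident] by simp
  have "((\<lambda>t. Y t - Y (t - u)) \<longlongrightarrow> 0) at_top"
    using filterlim_compose[OF inc sh] by simp
  \<comment> \<open>One period of \<open>train\<close> contributes \<open>F t\<close>; one period of
    the linear factor contributes \<open>u / mean\<close> times the unchanged
    \<open>comb\<close>.\<close>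
  moreover have "Y t - Y (t - u) = F t - u / mean * comb u t" for t
    using train_rec[of t] comb_periodic[of t 1] by (simp add: Y_def algebra_simps diff_divide_distrib)
  ultimately show ?thesis by simp
qed

end

end

section \<open>Lipschitz images and similarities\<close>

text \<open>Vitali covers \<open>X\<close> up to a negligible set by disjoint balls inside
  \<open>A\<close>. The image of the trace of a ball lies in a ball with radius enlarged by
  \<open>L\<close>, and Lipschitz maps preserve negligibility of the rest. Only \<open>Y\<close> and
  \<open>A\<close> have to be measurable; \<open>X\<close> and \<open>\<phi>\<close> are
  arbitrary.\<close>

lemma lipschitz_image_emeasure_le_open:
  fixes \<phi> :: "'a::euclidean_space \<Rightarrow> 'a"
  assumes lip: "\<And>x y. x \<in> X \<Longrightarrow> y \<in> X \<Longrightarrow> dist (\<phi> x) (\<phi> y) \<le> L * dist x y"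
    and L: "0 < L" and O: "open A" "X \<subseteq> A" and Y: "Y \<in> sets borel" "Y \<subseteq> \<phi> ` X"
  shows "emeasure lborel Y \<le> ennreal (L ^ DIM('a)) * emeasure lborel A"
proof -
  define K where "K = {(a, \<rho>). a \<in> X \<and> 0 < \<rho> \<and> ball a \<rho> \<subseteq> A}"
  obtain C where C: "countable C" "C \<subseteq> K"
    "pairwise (\<lambda>i j. disjnt (ball (fst i) (snd i)) (ball (fst j) (snd j))) C"
    "negligible (X - (\<Union>i\<in>C. ball (fst i) (snd i)))"
  proof (rule Vitali_covering_theorem_balls[of X K fst snd])
    fix x and d :: real assume x: "x \<in> X" and d: "0 < d"
    obtain e where e: "0 < e" "ball x e \<subseteq> A" using O x by (meson openE subsetD)
    show "\<exists>i. i \<in> K \<and> x \<in> ball (fst i) (snd i) \<and> snd i < d"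
      using x d e by (intro exI[of _ "(x, min e (d / 2))"]) (auto simp: K_def)
  qed
  let ?Z = "X - (\<Union>i\<in>C. ball (fst i) (snd i))"
  have "negligible (\<phi> ` ?Z)"
  proof (rule negligible_locally_Lipschitz_image[OF _ C(4)])
    fix x assume "x \<in> ?Z"
    then show "\<exists>T B. open T \<and> x \<in> T \<and> (\<forall>y \<in> ?Z \<inter> T. norm (\<phi> y - \<phi> x) \<le> B * norm (y - x))"
      using lip[of _ x] by (intro exI[of _ UNIV] exI[of _ L]) (auto simp: dist_norm)
  qed simp
  then obtain N where N: "N \<in> null_sets lborel" "\<phi> ` ?Z \<subseteq> N"
    by (auto simp: negligible_iff_null_sets null_sets_completion_iff2)
  define i where "i = from_nat_into C"
  define J where "J = to_nat_on C ` C"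
  have iC: "i n \<in> C" if "n \<in> J" for n
    using that C(1) by (auto simp: i_def J_def)
  have iK: "fst (i n) \<in> X" "0 < snd (i n)" "ball (fst (i n)) (snd (i n)) \<subseteq> A" if "n \<in> J" for n
    using subsetD[OF C(2) iC[OF that]] by (simp_all add: K_def split_beta)
  have onto: "\<exists>n\<in>J. i n = j" if "j \<in> C" for j
    using that C(1) by (auto simp: i_def J_def)
  define b where "b n = (if n \<in> J then ball (fst (i n)) (snd (i n)) else {})" for n
  define B where "B n = (if n \<in> J then ball (\<phi> (fst (i n))) (L * snd (i n)) else {})" for n
  have cov: "Y \<subseteq> (\<Union>n. B n) \<union> N"
  proof
    fix y assume "y \<in> Y"
    then obtain x where x: "x \<in> X" "y = \<phi> x" using Y by blast
    show "y \<in> (\<Union>n. B n) \<union> N"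
    proof (cases "x \<in> ?Z")
      case True then show ?thesis using N x by blast
    next
      case False
      then obtain j where "j \<in> C" "x \<in> ball (fst j) (snd j)" using x by blast
      then obtain n where n: "n \<in> J" "x \<in> ball (fst (i n)) (snd (i n))" using onto by blast
      then have "dist (\<phi> (fst (i n))) y \<le> L * dist (fst (i n)) x" using lip iK(1) x by simp
      also have "\<dots> < L * snd (i n)" using n L by simp
      finally show ?thesis using n by (auto simp: B_def)
    qed
  qed
  have scale: "emeasure lborel (B n) = ennreal (L ^ DIM('a)) * emeasure lborel (b n)" for n
  proof (cases "n \<in> J")
    case True
    then show ?thesis
      using iK(2)[OF True] L by (simp add: B_def b_def emeasure_ball ennreal_mult[symmetric] power_mult_distrib ac_simps)
  qed (simp add: B_def b_def)
  have inj: "m = n" if "m \<in> J" "n \<in> J" "i m = i n" for m n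
    using that C(1) by (auto simp: i_def J_def)
  have "b m \<inter> b n = {}" if "m \<noteq> n" for m n
    using pairwiseD[OF C(3), of "i m" "i n"] iC inj[of m n] that by (auto simp: b_def disjnt_def)
  then have disj: "disjoint_family b" by (simp add: disjoint_family_on_def)
  have "emeasure lborel Y \<le> emeasure lborel ((\<Union>n. B n) \<union> N)"
    using cov N by (intro emeasure_mono) (auto simp: B_def)
  also have "\<dots> = emeasure lborel (\<Union>n. B n)"
    using N(1) by (intro emeasure_Un_null_set) (auto simp: B_def)
  also have "\<dots> \<le> (\<Sum>n. emeasure lborel (B n))"
    by (intro emeasure_subadditive_countably) (auto simp: B_def)
  also have "\<dots> = ennreal (L ^ DIM('a)) * (\<Sum>n. emeasure lborel (b n))"
    unfolding scale by (rule ennreal_suminf_cmult)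
  also have "(\<Sum>n. emeasure lborel (b n)) = emeasure lborel (\<Union>n. b n)"
    by (rule suminf_emeasure[OF _ disj]) (auto simp: b_def)
  also have "\<dots> \<le> emeasure lborel A"
  proof (rule emeasure_mono)
    show "(\<Union>n. b n) \<subseteq> A"
      by (rule UN_least) (use iK(3) in \<open>simp add: b_def\<close>)
  qed (use O in auto)
  finally show ?thesis by (simp add: mult_left_mono)
qed

text \<open>Outer regularity of Lebesgue measure replaces the open superset of \<open>X\<close> by a
  Borel one.\<close>

lemma lipschitz_image_emeasure_le:
  fixes \<phi> :: "'a::euclidean_space \<Rightarrow> 'a"
  assumes lip: "\<And>x y. x \<in> X \<Longrightarrow> y \<in> X \<Longrightarrow> dist (\<phi> x) (\<phi> y) \<le> L * dist x y"
    and L: "0 < L" and A: "A \<in> sets borel" "X \<subseteq> A" and Y: "Y \<in> sets borel" "Y \<subseteq> \<phi> ` X"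
  shows "emeasure lborel Y \<le> ennreal (L ^ DIM('a)) * emeasure lborel A"
proof (rule ennreal_le_epsilon)
  fix e :: real assume e: "0 < e"
  define d where "d = e / L ^ DIM('a)"
  have d: "0 < d" using e L by (simp add: d_def)
  obtain U where U: "open U" "A \<subseteq> U" "emeasure lborel (U - A) < d"
    using outer_regular_lborel[OF A(1) d] by blast
  have "emeasure lborel Y \<le> ennreal (L ^ DIM('a)) * emeasure lborel U"
    using U A by (intro lipschitz_image_emeasure_le_open[OF lip L _ _ Y]) auto
  also have "emeasure lborel U = emeasure lborel A + emeasure lborel (U - A)"
    using U A by (subst plus_emeasure) (auto intro!: arg_cong[of _ _ "emeasure lborel"])
  also have "ennreal (L ^ DIM('a)) * \<dots> \<le> ennreal (L ^ DIM('a)) * (emeasure lborel A + d)"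
    using U by (intro mult_left_mono add_left_mono) auto
  also have "\<dots> = ennreal (L ^ DIM('a)) * emeasure lborel A + e"
    using L d by (simp add: distrib_left ennreal_mult[symmetric]) (simp add: d_def)
  finally show "emeasure lborel Y \<le> ennreal (L ^ DIM('a)) * emeasure lborel A + ennreal e" .
qed

lemma nn_integral_layer_cake:
  fixes f :: "'a::euclidean_space \<Rightarrow> real"
  assumes [measurable]: "f \<in> borel_measurable borel"
  shows "(\<integral>\<^sup>+x. ennreal (f x) \<partial>lborel) = (\<integral>\<^sup>+t. indicator {0..} t * emeasure lborel {x. t < f x} \<partial>lborel)"
proof -
  have "(\<integral>\<^sup>+x. ennreal (f x) \<partial>lborel) = (\<integral>\<^sup>+x. (\<integral>\<^sup>+t. indicator {(x, t). 0 \<le> t \<and> t < f x} (x, t) \<partial>lborel) \<partial>lborel)"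
  proof (intro nn_integral_cong)
    fix x
    have "(\<integral>\<^sup>+t. indicator {(x, t). 0 \<le> t \<and> t < f x} (x, t) \<partial>lborel) = (\<integral>\<^sup>+t. indicator {0..<f x} t \<partial>lborel)"
      by (intro nn_integral_cong) (auto simp: indicator_def)
    also have "\<dots> = ennreal (f x)"
      by (cases "0 \<le> f x") (auto simp: ennreal_neg)
    finally show "ennreal (f x) = (\<integral>\<^sup>+t. indicator {(x, t). 0 \<le> t \<and> t < f x} (x, t) \<partial>lborel)" by simp
  qed
  also have "\<dots> = (\<integral>\<^sup>+t. (\<integral>\<^sup>+x. indicator {(x, t). 0 \<le> t \<and> t < f x} (x, t) \<partial>lborel) \<partial>lborel)"
    by (rule lborel_pair.Fubini'[symmetric]) measurable
  also have "\<dots> = (\<integral>\<^sup>+t. indicator {0..} t * emeasure lborel {x. t < f x} \<partial>lborel)"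
  proof (intro nn_integral_cong)
    fix t :: real
    have "(\<integral>\<^sup>+x. indicator {(x, t). 0 \<le> t \<and> t < f x} (x, t) \<partial>lborel) =
        (\<integral>\<^sup>+x. indicator {0..} t * indicator {x. t < f x} x \<partial>lborel)"
      by (intro nn_integral_cong) (auto simp: indicator_def)
    also have "\<dots> = indicator {0..} t * emeasure lborel {x. t < f x}"
      by (subst nn_integral_cmult_indicator) auto
    finally show "(\<integral>\<^sup>+x. indicator {(x, t). 0 \<le> t \<and> t < f x} (x, t) \<partial>lborel) =
        indicator {0..} t * emeasure lborel {x. t < f x}" .
  qed
  finally show ?thesis .
qed

text \<open>For \<open>t \<ge> 0\<close> the map \<open>T\<close> sends \<open>{x. t < f x}\<close>
  into \<open>{x. t < g x}\<close> and has an \<open>L\<close>-Lipschitz inverse there. So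
  superlevel sets compare with the factor \<open>L ^ DIM('a)\<close>, and integrating over
  \<open>t\<close> compares the integrals. \<open>T\<close> may be non-measurable.\<close>

lemma nn_integral_le_of_expanding:
  fixes f g :: "'a::euclidean_space \<Rightarrow> real" and T :: "'a \<Rightarrow> 'a"
  assumes [measurable]: "f \<in> borel_measurable borel" "g \<in> borel_measurable borel"
    and L: "0 < L"
    and exp: "\<And>x y. 0 < f x \<Longrightarrow> 0 < f y \<Longrightarrow> dist x y \<le> L * dist (T x) (T y)"
    and le: "\<And>x. 0 < f x \<Longrightarrow> f x \<le> g (T x)"
  shows "(\<integral>\<^sup>+x. ennreal (f x) \<partial>lborel) \<le> ennreal (L ^ DIM('a)) * (\<integral>\<^sup>+x. ennreal (g x) \<partial>lborel)"
proof -
  have level: "emeasure lborel {x. t < f x} \<le> ennreal (L ^ DIM('a)) * emeasure lborel {x. t < g x}"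
    if t: "0 \<le> t" for t
  proof (rule lipschitz_image_emeasure_le)
    let ?Y = "{x. t < f x}"
    have inj: "inj_on T ?Y"
    proof (rule inj_onI)
      fix x y assume "x \<in> ?Y" "y \<in> ?Y" "T x = T y"
      then have "dist x y \<le> 0" using exp[of x y] t by simp
      then show "x = y" by simp
    qed
    show "dist (inv_into ?Y T x) (inv_into ?Y T y) \<le> L * dist x y" if "x \<in> T ` ?Y" "y \<in> T ` ?Y" for x y
      using that inj exp t by force
    show "?Y \<subseteq> inv_into ?Y T ` (T ` ?Y)" using inj by force
    show "T ` ?Y \<subseteq> {x. t < g x}"
    proof (intro image_subsetI CollectI)
      fix x assume "x \<in> ?Y"
      then show "t < g (T x)" using le[of x] t by simp
    qed
    show "?Y \<in> sets borel" "{x. t < g x} \<in> sets borel" by measurable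
  qed (rule L)
  have "(\<integral>\<^sup>+x. ennreal (f x) \<partial>lborel) = (\<integral>\<^sup>+t. indicator {0..} t * emeasure lborel {x. t < f x} \<partial>lborel)"
    by (rule nn_integral_layer_cake) simp
  also have "\<dots> \<le> (\<integral>\<^sup>+t. ennreal (L ^ DIM('a)) * (indicator {0..} t * emeasure lborel {x. t < g x}) \<partial>lborel)"
    using level by (intro nn_integral_mono) (auto simp: indicator_def)
  also have "\<dots> = ennreal (L ^ DIM('a)) * (\<integral>\<^sup>+t. indicator {0..} t * emeasure lborel {x. t < g x} \<partial>lborel)"
  proof (rule nn_integral_cmult)
    have "{p \<in> space (lborel \<Otimes>\<^sub>M lborel). fst p < g (snd p)} \<in> sets (lborel \<Otimes>\<^sub>M lborel)"
      by measurable
    then have "{p. fst p < g (snd p)} \<in> sets (lborel \<Otimes>\<^sub>M lborel)"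
      by (simp add: space_pair_measure)
    then have "(\<lambda>t. emeasure lborel (Pair t -` {p. fst p < g (snd p)})) \<in> borel_measurable lborel"
      by (rule lborel.measurable_emeasure_Pair)
    then show "(\<lambda>t. indicator {0..} t * emeasure lborel {x. t < g x}) \<in> borel_measurable lborel"
      by (simp add: vimage_def)
  qed
  also have "(\<integral>\<^sup>+t. indicator {0..} t * emeasure lborel {x. t < g x} \<partial>lborel) = (\<integral>\<^sup>+x. ennreal (g x) \<partial>lborel)"
    by (rule nn_integral_layer_cake[symmetric]) simp
  finally show ?thesis .
qed

text \<open>Normalised to fix 0 and to have ratio 1, the map is an isometry fixing the origin, hence
  a linear orthogonal map of a finite-dimensional space.\<close>

lemma similarity_surj:
  fixes f :: "'a::euclidean_space \<Rightarrow> 'a"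
  assumes "similarity c f" "0 < c"
  shows "surj f"
proof -
  define h where "h x = (1 / c) *\<^sub>R (f x - f 0)" for x
  have "orthogonal_transformation h"
    unfolding orthogonal_transformation_isometry
  proof (intro conjI allI)
    fix x y
    have "h x - h y = (1 / c) *\<^sub>R (f x - f y)" by (simp add: h_def algebra_simps)
    then have "dist (h x) (h y) = (1 / c) * dist (f x) (f y)" using assms by (simp add: dist_norm)
    then show "dist (h x) (h y) = dist x y" using assms by (simp add: similarity_def)
  qed (simp add: h_def)
  then have "surj h" by (rule orthogonal_transformation_surj)
  show ?thesis
    unfolding surj_def
  proof
    fix y
    obtain x where "h x = (1 / c) *\<^sub>R (y - f 0)" using \<open>surj h\<close> by (metis surjD)
    then have "y = f x" using assms by (simp add: h_def)
    then show "\<exists>x. y = f x" by blast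
  qed
qed

lemma similarity_inj: "similarity c f \<Longrightarrow> 0 < c \<Longrightarrow> inj f"
  by (auto simp: similarity_def inj_def) (metis dist_eq_0_iff less_irrefl mult_eq_0_iff)

lemma similarity_continuous: "similarity c f \<Longrightarrow> continuous_on A f"
  by (rule lipschitz_on_continuous_on[of "\<bar>c\<bar>"])
     (auto simp: similarity_def intro!: lipschitz_onI mult_right_mono)

lemma similarity_ball_vimage:
  assumes "similarity c f" "0 < c"
  shows "f -` ball (f y) s = ball y (s / c)"
  using assms by (auto simp: similarity_def field_simps)

text \<open>A similarity and its inverse are both expanding with optimal factor, so the comparison
  for expanding maps yields the two inequalities.\<close>

lemma nn_integral_similarity:
  fixes f :: "'a::euclidean_space \<Rightarrow> real"
  assumes S: "similarity c S" "0 < c" and [measurable]: "f \<in> borel_measurable borel"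
  shows "(\<integral>\<^sup>+x. ennreal (f x) \<partial>lborel) = ennreal (c ^ DIM('a)) * (\<integral>\<^sup>+x. ennreal (f (S x)) \<partial>lborel)"
proof (rule antisym)
  have [measurable]: "S \<in> borel_measurable borel"
    using similarity_continuous[OF S(1)] by (rule borel_measurable_continuous_onI)
  have inv: "S (inv S x) = x" for x using similarity_surj[OF S] by (rule surj_f_inv_f)
  have dS: "dist (S x) (S y) = c * dist x y" for x y using S by (simp add: similarity_def)
  show "(\<integral>\<^sup>+x. ennreal (f x) \<partial>lborel) \<le> ennreal (c ^ DIM('a)) * (\<integral>\<^sup>+x. ennreal (f (S x)) \<partial>lborel)"
    by (rule nn_integral_le_of_expanding[where T = "inv S"]) (auto simp: inv S(2) simp flip: dS)
  have "(\<integral>\<^sup>+x. ennreal (f (S x)) \<partial>lborel) \<le> ennreal ((1 / c) ^ DIM('a)) * (\<integral>\<^sup>+x. ennreal (f x) \<partial>lborel)"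
    by (rule nn_integral_le_of_expanding[where T = S]) (use S in \<open>auto simp: dS\<close>)
  then have "ennreal (c ^ DIM('a)) * (\<integral>\<^sup>+x. ennreal (f (S x)) \<partial>lborel) \<le>
     ennreal (c ^ DIM('a)) * (ennreal ((1 / c) ^ DIM('a)) * (\<integral>\<^sup>+x. ennreal (f x) \<partial>lborel))"
    by (rule mult_left_mono) simp
  also have "\<dots> = (\<integral>\<^sup>+x. ennreal (f x) \<partial>lborel)"
    using S(2) by (simp add: mult.assoc[symmetric] ennreal_mult[symmetric] power_mult_distrib[symmetric])
  finally show "ennreal (c ^ DIM('a)) * (\<integral>\<^sup>+x. ennreal (f (S x)) \<partial>lborel) \<le> (\<integral>\<^sup>+x. ennreal (f x) \<partial>lborel)" .
qed

section \<open>Self-similar measures\<close>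

locale self_similar =
  fixes N :: nat and S :: "nat \<Rightarrow> 'a::euclidean_space \<Rightarrow> 'a" and r p :: "nat \<Rightarrow> real"
    and K :: "'a set" and \<mu> :: "'a measure" and q :: real
  assumes N: "2 \<le> N"
    and r: "i \<in> {1..N} \<Longrightarrow> 0 < r i \<and> r i < 1"
    and sim: "i \<in> {1..N} \<Longrightarrow> similarity (r i) (S i)"
    and p_pos: "i \<in> {1..N} \<Longrightarrow> 0 < p i"
    and p_sum: "(\<Sum>i=1..N. p i) = 1"
    and K: "self_similar_set N S K"
    and \<mu>: "self_similar_measure N S p \<mu>"
begin

lemma r_pos: "i \<in> {1..N} \<Longrightarrow> 0 < r i" and r_less: "i \<in> {1..N} \<Longrightarrow> r i < 1"
  using r by auto

lemma compact_K: "compact K" and K_nonempty: "K \<noteq> {}" and K_eq: "K = (\<Union>i\<in>{1..N}. S i ` K)"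
  using K by (auto simp: self_similar_set_def)

lemma closed_K: "closed K"
  using compact_K by (rule compact_imp_closed)

lemma S_in_K: "i \<in> {1..N} \<Longrightarrow> x \<in> K \<Longrightarrow> S i x \<in> K"
  using K_eq by blast

lemma dist_S: "i \<in> {1..N} \<Longrightarrow> dist (S i x) (S i y) = r i * dist x y"
  using sim by (simp add: similarity_def)

lemma S_inv: "i \<in> {1..N} \<Longrightarrow> S i (inv (S i) x) = x"
  using similarity_surj[OF sim r_pos] by (simp add: surj_f_inv_f)

lemma inv_S: "i \<in> {1..N} \<Longrightarrow> inv (S i) (S i x) = x"
  using similarity_inj[OF sim r_pos] by (simp add: inv_f_f)

lemma S_meas [measurable]: "i \<in> {1..N} \<Longrightarrow> S i \<in> borel_measurable borel"
  using similarity_continuous[OF sim] by (intro borel_measurable_continuous_onI)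

lemma vimage_ball: "i \<in> {1..N} \<Longrightarrow> S i -` ball x s = ball (inv (S i) x) (s / r i)"
  using similarity_ball_vimage[OF sim r_pos, of i "inv (S i) x" s] by (simp add: S_inv)

sublocale prob_space \<mu>
  using \<mu> by (simp add: self_similar_measure_def)

lemma sets_\<mu> [measurable_cong, simp]: "sets \<mu> = sets borel"
  using \<mu> by (simp add: self_similar_measure_def)

lemma space_\<mu> [simp]: "space \<mu> = UNIV"
  using sets_eq_imp_space_eq[OF sets_\<mu>] by simp

lemma measure_eq: "A \<in> sets borel \<Longrightarrow> measure \<mu> A = (\<Sum>i=1..N. p i * measure \<mu> (S i -` A))"
  using \<mu> by (simp add: self_similar_measure_def)

definition rmax :: real where "rmax = Max (r ` {1..N})"

definition rmin :: real where "rmin = Min (r ` {1..N})"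

lemma rmax: "0 < rmax" "rmax < 1" "i \<in> {1..N} \<Longrightarrow> r i \<le> rmax"
  and rmin: "0 < rmin" "rmin < 1" "i \<in> {1..N} \<Longrightarrow> rmin \<le> r i"
proof -
  have ne: "r ` {1..N} \<noteq> {}" "finite (r ` {1..N})" using N by auto
  have "rmax \<in> r ` {1..N}" "rmin \<in> r ` {1..N}"
    unfolding rmax_def rmin_def using ne by (auto intro: Max_in Min_in)
  then show "0 < rmax" "rmax < 1" "0 < rmin" "rmin < 1" using r by auto
  show "i \<in> {1..N} \<Longrightarrow> r i \<le> rmax" "i \<in> {1..N} \<Longrightarrow> rmin \<le> r i"
    unfolding rmax_def rmin_def using ne by auto
qed

text \<open>Maps with ratio at most \<open>rmax\<close> contract distances to \<open>K\<close>, so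
  the mass beyond distance \<open>s\<close> is at most the mass beyond \<open>s / rmax\<close>.
  Iterating pushes it out to infinity, where the decreasing sets have empty intersection.\<close>

lemma measure_far:
  assumes "0 < \<rho>"
  shows "measure \<mu> {x. \<rho> < infdist x K} = 0"
proof -
  define far where "far s = {x. s < infdist x K}" for s
  have far_borel: "far s \<in> sets borel" for s
    unfolding far_def by (intro borel_open open_Collect_less continuous_intros)
  have step: "measure \<mu> (far s) \<le> measure \<mu> (far (s / rmax))" if "0 < s" for s
  proof -
    have "measure \<mu> (far s) = (\<Sum>i=1..N. p i * measure \<mu> (S i -` far s))"
      using far_borel by (rule measure_eq)
    also have "\<dots> \<le> (\<Sum>i=1..N. p i * measure \<mu> (far (s / rmax)))"
    proof (intro sum_mono mult_left_mono finite_measure_mono)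
      fix i assume i: "i \<in> {1..N}"
      show "S i -` far s \<subseteq> far (s / rmax)"
      proof
        fix x assume "x \<in> S i -` far s"
        then have x: "s < infdist (S i x) K" by (simp add: far_def)
        obtain y where y: "y \<in> K" "infdist x K = dist x y"
          using infdist_attains_inf[OF closed_K K_nonempty] by blast
        have "infdist (S i x) K \<le> dist (S i x) (S i y)"
          using S_in_K[OF i y(1)] by (rule infdist_le)
        also have "\<dots> = r i * infdist x K" using dist_S[OF i] y by simp
        also have "\<dots> \<le> rmax * infdist x K"
          using rmax(3)[OF i] by (intro mult_right_mono) (auto simp: infdist_nonneg)
        finally show "x \<in> far (s / rmax)" using x rmax(1) by (simp add: far_def field_simps)
      qed
      show "0 \<le> p i" using p_pos[OF i] by simp
      show "far (s / rmax) \<in> sets \<mu>" using far_borel by simp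
    qed
    also have "\<dots> = measure \<mu> (far (s / rmax))"
      by (simp only: p_sum sum_distrib_right[symmetric] mult_1_left)
    finally show ?thesis .
  qed
  have iter: "measure \<mu> (far \<rho>) \<le> measure \<mu> (far (\<rho> / rmax ^ n))" for n
  proof (induction n)
    case (Suc n)
    also have "measure \<mu> (far (\<rho> / rmax ^ n)) \<le> measure \<mu> (far (\<rho> / rmax ^ n / rmax))"
      using assms rmax(1) by (intro step) simp
    finally show ?case by (simp add: mult.commute)
  qed simp
  have "(\<lambda>n. measure \<mu> (far (\<rho> / rmax ^ n))) \<longlonglongrightarrow> measure \<mu> (\<Inter>n. far (\<rho> / rmax ^ n))"
  proof (rule finite_Lim_measure_decseq)
    show "range (\<lambda>n. far (\<rho> / rmax ^ n)) \<subseteq> sets \<mu>" using far_borel by auto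
    show "decseq (\<lambda>n. far (\<rho> / rmax ^ n))"
    proof (rule decseq_SucI)
      fix n
      have "\<rho> / rmax ^ n \<le> \<rho> / rmax ^ Suc n"
        using assms rmax(1,2) by (intro divide_left_mono) (auto simp: mult_le_cancel_right1)
      then show "far (\<rho> / rmax ^ Suc n) \<subseteq> far (\<rho> / rmax ^ n)" by (auto simp: far_def)
    qed
  qed
  also have "(\<Inter>n. far (\<rho> / rmax ^ n)) = {}"
  proof (rule ccontr)
    assume "(\<Inter>n. far (\<rho> / rmax ^ n)) \<noteq> {}"
    then obtain x where x: "\<And>n. \<rho> / rmax ^ n < infdist x K" by (auto simp: far_def)
    then have pos: "0 < infdist x K" using x[of 0] assms by simp
    obtain n where "rmax ^ n < \<rho> / infdist x K"
      using real_arch_pow_inv[of "\<rho> / infdist x K" rmax] rmax assms pos by auto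
    then show False using x[of n] pos rmax(1) assms by (simp add: field_simps)
  qed
  finally have "(\<lambda>n. measure \<mu> (far (\<rho> / rmax ^ n))) \<longlonglongrightarrow> 0" by simp
  then have "measure \<mu> (far \<rho>) \<le> 0"
    by (rule LIMSEQ_le_const) (use iter in auto)
  then show ?thesis unfolding far_def by (simp add: measure_le_0_iff)
qed

lemma measure_compl_K: "measure \<mu> (- K) = 0"
proof -
  have "(\<Union>n. {x. 1 / of_nat (Suc n) < infdist x K}) = - K"
  proof (intro equalityI subsetI)
    fix x assume "x \<in> - K"
    then have "0 < infdist x K" using infdist_pos_not_in_closed[OF closed_K K_nonempty] by blast
    then obtain n where "1 / of_nat (Suc n) < infdist x K" using nat_approx_posE by blast
    then show "x \<in> (\<Union>n. {x. 1 / of_nat (Suc n) < infdist x K})" by blast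
  next
    fix x assume "x \<in> (\<Union>n. {x. 1 / of_nat (Suc n) < infdist x K})"
    then have "0 < infdist x K" by (auto intro: less_trans[rotated])
    then show "x \<in> - K" by auto
  qed
  moreover have "(\<Union>n. {x. 1 / real (Suc n) < infdist x K}) \<in> null_sets \<mu>"
  proof (intro null_sets_UN null_setsI)
    fix n
    show "emeasure \<mu> {x. 1 / real (Suc n) < infdist x K} = 0"
      using measure_far[of "1 / real (Suc n)"] by (simp add: emeasure_eq_measure)
    show "{x. 1 / real (Suc n) < infdist x K} \<in> sets \<mu>"
      by (simp, intro borel_open open_Collect_less continuous_intros)
  qed
  ultimately show ?thesis by (simp add: measure_eq_0_null_sets)
qed

lemma measure_disjoint_K:
  assumes "A \<in> sets borel" "A \<inter> K = {}"
  shows "measure \<mu> A = 0"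
proof -
  have "measure \<mu> A \<le> measure \<mu> (- K)"
    using assms closed_K by (intro finite_measure_mono) auto
  then show ?thesis using measure_compl_K measure_nonneg[of \<mu> A] by linarith
qed

lemma measure_superset_K:
  assumes "A \<in> sets borel" "K \<subseteq> A"
  shows "measure \<mu> A = 1"
proof -
  have "measure \<mu> (UNIV - A) = 0"
    using assms by (intro measure_disjoint_K) auto
  then show ?thesis using prob_compl[of A] assms(1) by simp
qed

section \<open>Measures of balls\<close>

definition bm :: "real \<Rightarrow> 'a \<Rightarrow> real" where
  "bm s x = measure \<mu> (ball x s)"

lemma bm_nonneg: "0 \<le> bm s x" and bm_le_1: "bm s x \<le> 1"
  by (auto simp: bm_def)

lemma bm_mono: "ball x s \<subseteq> ball y t \<Longrightarrow> bm s x \<le> bm t y"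
  unfolding bm_def by (intro finite_measure_mono) auto

lemma bm_meas [measurable]: "bm s \<in> borel_measurable borel"
proof -
  have "{p \<in> space (borel \<Otimes>\<^sub>M \<mu>). dist (fst p) (snd p) < s} \<in> sets (borel \<Otimes>\<^sub>M \<mu>)"
    by measurable
  then have "(\<lambda>x. emeasure \<mu> (Pair x -` {p. dist (fst p) (snd p) < s})) \<in> borel_measurable borel"
    by (intro measurable_emeasure_Pair) (simp add: space_pair_measure)
  then have "(\<lambda>x. enn2real (emeasure \<mu> (ball x s))) \<in> borel_measurable borel"
    by (simp add: vimage_def ball_def)
  then show ?thesis by (simp add: bm_def[abs_def] measure_def)
qed

lemma bm_rec: "bm s x = (\<Sum>i=1..N. p i * bm (s / r i) (inv (S i) x))"
  unfolding bm_def using measure_eq[of "ball x s"] by (simp add: vimage_ball)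

lemma bm_child_le: "i \<in> {1..N} \<Longrightarrow> p i * bm (s / r i) (inv (S i) x) \<le> bm s x"
  unfolding bm_rec[of s x]
  by (rule member_le_sum) (auto intro!: mult_nonneg_nonneg bm_nonneg intro: less_imp_le[OF p_pos])

lemma mem_nbhd_iff: "x \<in> open_nbhd K s \<longleftrightarrow> (\<exists>y\<in>K. dist x y < s)"
proof
  assume "x \<in> open_nbhd K s"
  then have "infdist x K < s" by (simp add: open_nbhd_def)
  moreover obtain y where "y \<in> K" "infdist x K = dist x y"
    using infdist_attains_inf[OF closed_K K_nonempty] by blast
  ultimately show "\<exists>y\<in>K. dist x y < s" by auto
next
  assume "\<exists>y\<in>K. dist x y < s"
  then obtain y where "y \<in> K" "dist x y < s" by blast
  then show "x \<in> open_nbhd K s"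
    using infdist_le[of y K x] by (simp add: open_nbhd_def)
qed

lemma K_bounded_by:
  obtains D where "0 < D" "\<And>x y. x \<in> K \<Longrightarrow> y \<in> K \<Longrightarrow> dist x y \<le> D"
proof -
  obtain e where "\<And>x y. x \<in> K \<Longrightarrow> y \<in> K \<Longrightarrow> dist x y \<le> e"
    using compact_imp_bounded[OF compact_K] by (auto simp: bounded_two_points)
  then show ?thesis by (intro that[of "max e 0 + 1"]) force+
qed

text \<open>The inclusion of \<open>K\<close> in the support. A ball of radius \<open>t\<close> at
  \<open>S i y\<close> has at least \<open>p i\<close> times the mass of the ball of radius
  \<open>t / r i\<close> at \<open>y\<close>; after finitely many enlargements the ball contains
  \<open>K\<close> and has mass 1.\<close>

lemma bm_pos_center:
  assumes "x \<in> K" "0 < s"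
  shows "0 < bm s x"
proof -
  obtain D0 where D0: "0 < D0" "\<And>x y. x \<in> K \<Longrightarrow> y \<in> K \<Longrightarrow> dist x y \<le> D0"
    by (rule K_bounded_by) (rule that)
  define D where "D = D0 + 1"
  have D: "0 < D" "\<And>x y. x \<in> K \<Longrightarrow> y \<in> K \<Longrightarrow> dist x y < D"
    using D0 by (force simp: D_def)+
  have "0 < bm t x" if "x \<in> K" "D * rmax ^ n \<le> t" for n t x
    using that
  proof (induction n arbitrary: t x)
    case 0
    then have "K \<subseteq> ball x t" using D by force
    then show ?case using measure_superset_K[of "ball x t"] by (simp add: bm_def)
  next
    case (Suc n)
    obtain i y where i: "i \<in> {1..N}" "y \<in> K" "x = S i y" using Suc.prems(1) K_eq by blast
    have "D * rmax ^ n * r i \<le> D * rmax ^ n * rmax"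
      using D rmax(1) rmax(3)[OF i(1)] by (intro mult_left_mono) auto
    then have "D * rmax ^ n \<le> t / r i"
      using Suc.prems(2) r_pos[OF i(1)] by (simp add: field_simps)
    then have "0 < bm (t / r i) y" using Suc.IH[OF i(2)] by simp
    then have "0 < p i * bm (t / r i) (inv (S i) x)" using p_pos[OF i(1)] i inv_S[OF i(1)] by simp
    then show ?case using bm_child_le[OF i(1), of t x] by linarith
  qed
  note far = this
  obtain n where "rmax ^ n < s / D"
    using real_arch_pow_inv[of "s / D" rmax] rmax assms D by auto
  then have "D * rmax ^ n \<le> s" using D(1) by (simp add: field_simps)
  then show ?thesis by (rule far[OF assms(1)])
qed

lemma bm_pos_iff: "0 < bm s x \<longleftrightarrow> (\<exists>y\<in>K. dist x y < s)"
proof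
  assume "0 < bm s x"
  then have "ball x s \<inter> K \<noteq> {}" using measure_disjoint_K[of "ball x s"] by (auto simp: bm_def)
  then show "\<exists>y\<in>K. dist x y < s" by auto
next
  assume "\<exists>y\<in>K. dist x y < s"
  then obtain y where y: "y \<in> K" "dist x y < s" by blast
  have "ball y (s - dist x y) \<subseteq> ball x s"
    by (simp add: ball_subset_ball_iff dist_commute)
  then show "0 < bm s x"
    using bm_mono[of y "s - dist x y" x s] bm_pos_center[OF y(1), of "s - dist x y"] y(2) by simp
qed

lemma bm_child_pos_iff:
  assumes "i \<in> {1..N}"
  shows "0 < bm (s / r i) (inv (S i) x) \<longleftrightarrow> (\<exists>y\<in>K. dist x (S i y) < s)"
proof -
  have "dist (inv (S i) x) y < s / r i \<longleftrightarrow> dist x (S i y) < s" for y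
    using dist_S[OF assms, of "inv (S i) x" y] r_pos[OF assms]
    by (simp add: S_inv[OF assms] field_simps)
  then show ?thesis by (simp add: bm_pos_iff)
qed

text \<open>Extended values keep an infinite integral apart from a vanishing one. Only
  \<open>enn2real\<close> merges them, in agreement with the default value of the Lebesgue
  integral.\<close>

definition I :: "real \<Rightarrow> ennreal" where
  "I s = (\<integral>\<^sup>+x. ennreal (bm s x powr q) \<partial>lborel)"

text \<open>The factor \<^term>\<open>indicator (open_nbhd K s)\<close> is redundant because \<open>0 powr q = 0\<close> for every \<open>q\<close>.\<close>

lemma volume_eq: "mf_minkowski_volume \<mu> q s K = enn2real (I s) / s ^ DIM('a)"
proof -
  have "(LINT x:open_nbhd K s|lborel. measure \<mu> (ball x s) powr q) = (LINT x|lborel. bm s x powr q)"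
    unfolding set_lebesgue_integral_def
  proof (intro Bochner_Integration.integral_cong refl)
    fix x
    show "indicator (open_nbhd K s) x *\<^sub>R measure \<mu> (ball x s) powr q = bm s x powr q"
      using bm_pos_iff[of s x] bm_nonneg[of s x] mem_nbhd_iff[of x s]
      by (auto simp: indicator_def bm_def less_le)
  qed
  also have "\<dots> = enn2real (I s)"
    unfolding I_def by (rule integral_eq_nn_integral) auto
  finally show ?thesis by (simp add: mf_minkowski_volume_def)
qed

lemma inv_S_meas [measurable]: "i \<in> {1..N} \<Longrightarrow> inv (S i) \<in> borel_measurable borel"
proof (rule borel_measurable_continuous_onI)
  assume i: "i \<in> {1..N}"
  have "similarity (1 / r i) (inv (S i))"
    unfolding similarity_def
  proof (intro allI)
    fix x y
    show "dist (inv (S i) x) (inv (S i) y) = 1 / r i * dist x y"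
      using dist_S[OF i, of "inv (S i) x" "inv (S i) y"] r_pos[OF i] by (simp add: S_inv[OF i])
  qed
  then show "continuous_on UNIV (inv (S i))" by (rule similarity_continuous)
qed

lemma nn_integral_child:
  assumes i: "i \<in> {1..N}"
  shows "(\<integral>\<^sup>+x. ennreal ((p i * bm (s / r i) (inv (S i) x)) powr q) \<partial>lborel) =
     ennreal (p i powr q * r i ^ DIM('a)) * I (s / r i)"
proof -
  note [measurable] = inv_S_meas[OF i]
  have "(\<integral>\<^sup>+x. ennreal ((p i * bm (s / r i) (inv (S i) x)) powr q) \<partial>lborel) =
      (\<integral>\<^sup>+x. ennreal (p i powr q) * ennreal (bm (s / r i) (inv (S i) x) powr q) \<partial>lborel)"
    using p_pos[OF i] bm_nonneg by (intro nn_integral_cong) (simp add: powr_mult ennreal_mult)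
  also have "\<dots> = ennreal (p i powr q) * (\<integral>\<^sup>+x. ennreal (bm (s / r i) (inv (S i) x) powr q) \<partial>lborel)"
    by (rule nn_integral_cmult) simp
  also have "(\<integral>\<^sup>+x. ennreal (bm (s / r i) (inv (S i) x) powr q) \<partial>lborel) = ennreal (r i ^ DIM('a)) * I (s / r i)"
    unfolding I_def
    by (subst nn_integral_similarity[OF sim[OF i] r_pos[OF i]]) (auto simp: inv_S[OF i])
  finally show ?thesis using r_pos[OF i] by (simp add: ennreal_mult mult.assoc)
qed

lemma I_mono:
  assumes "0 \<le> q" "s \<le> t"
  shows "I s \<le> I t"
  unfolding I_def
proof (rule nn_integral_mono)
  fix x
  have "bm s x \<le> bm t x" by (rule bm_mono) (rule subset_ball[OF assms(2)])
  then show "ennreal (bm s x powr q) \<le> ennreal (bm t x powr q)"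
    using assms(1) bm_nonneg by (intro ennreal_leI powr_mono2)
qed

text \<open>The integrand is at most 1 and vanishes outside a bounded set. This includes
  \<open>q = 0\<close>, because \<open>0 powr 0 = 0\<close> turns the integrand into the indicator
  of the neighbourhood.\<close>

lemma I_finite:
  assumes "0 \<le> q"
  shows "I s < \<infinity>"
proof -
  obtain D where D: "\<And>x y. x \<in> K \<Longrightarrow> y \<in> K \<Longrightarrow> dist x y \<le> D" using K_bounded_by by blast
  obtain z where z: "z \<in> K" using K_nonempty by blast
  have "I s \<le> (\<integral>\<^sup>+x. indicator (cball z (D + s)) x \<partial>lborel)"
    unfolding I_def
  proof (rule nn_integral_mono)
    fix x
    show "ennreal (bm s x powr q) \<le> indicator (cball z (D + s)) x"
    proof (cases "0 < bm s x")
      case True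
      then obtain y where "y \<in> K" "dist x y < s" by (auto simp: bm_pos_iff)
      then have "x \<in> cball z (D + s)" using D[OF z] dist_triangle[of z x y] by (force simp: dist_commute)
      moreover have "bm s x powr q \<le> 1" using powr_mono2[OF assms bm_nonneg bm_le_1, of s x] by simp
      ultimately show ?thesis by (simp add: ennreal_le_1)
    next
      case False
      then have "bm s x = 0" using bm_nonneg[of s x] by simp
      then show ?thesis by simp
    qed
  qed
  also have "\<dots> = emeasure lborel (cball z (D + s))" by simp
  also have "\<dots> < \<infinity>" by (rule emeasure_bounded_finite) simp
  finally show ?thesis .
qed

text \<open>For \<open>q < 0\<close> the volume decreases: pull every point \<open>x\<close> towards a nearest point of \<open>K\<close> by the
  factor \<open>s / t\<close>. As nearest point projections are monotone operators, this map is expanding up to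
  that factor, and the ball of radius \<open>s\<close> around the image lies in the ball of radius \<open>t\<close> around \<open>x\<close>.\<close>

lemma I_antimono:
  assumes q: "q \<le> 0" and st: "0 < s" "s \<le> t"
  shows "I t \<le> ennreal ((t / s) ^ DIM('a)) * I s"
proof -
  define P where "P x = (SOME y. y \<in> K \<and> infdist x K = dist x y)" for x
  have P: "P x \<in> K" "infdist x K = dist x (P x)" for x
    unfolding P_def using someI_ex[of "\<lambda>y. y \<in> K \<and> infdist x K = dist x y"]
      infdist_attains_inf[OF closed_K K_nonempty, of x] by blast+
  have nearest: "dist x (P x) \<le> dist x y" if "y \<in> K" for x y
    using infdist_le[OF that, of x] P(2)[of x] by simp
  \<comment> \<open>Adding the two nearest-point inequalities and expanding the squares leaves twice
    this inner product.\<close>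
  have monotone: "0 \<le> (P x - P y) \<bullet> (x - y)" for x y
  proof -
    have "(dist x (P x))\<^sup>2 \<le> (dist x (P y))\<^sup>2" "(dist y (P y))\<^sup>2 \<le> (dist y (P x))\<^sup>2"
      using nearest P(1) by (auto intro: power_mono)
    then show ?thesis
      by (simp add: dist_norm power2_norm_eq_inner inner_diff_left inner_diff_right inner_commute)
  qed
  define c where "c = s / t"
  have c: "0 < c" "c \<le> 1" using st by (auto simp: c_def)
  define T where "T x = P x + c *\<^sub>R (x - P x)" for x
  show ?thesis
    unfolding I_def
  proof (rule nn_integral_le_of_expanding[where T = T])
    show "dist x y \<le> t / s * dist (T x) (T y)" for x y
    proof -
      have "T x - T y = (1 - c) *\<^sub>R (P x - P y) + c *\<^sub>R (x - y)"
        by (simp add: T_def algebra_simps)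
      then have "(T x - T y) \<bullet> (x - y) = (1 - c) * ((P x - P y) \<bullet> (x - y)) + c * (norm (x - y))\<^sup>2"
        by (simp add: inner_add_left power2_norm_eq_inner)
      then have "c * (norm (x - y))\<^sup>2 \<le> (T x - T y) \<bullet> (x - y)" using monotone[of x y] c by simp
      also have "\<dots> \<le> norm (T x - T y) * norm (x - y)" by (rule norm_cauchy_schwarz)
      finally have "c * norm (x - y) \<le> norm (T x - T y)"
        by (cases "x = y") (auto simp: power2_eq_square mult.assoc[symmetric])
      then show ?thesis using st by (simp add: c_def dist_norm field_simps)
    qed
    show "bm t x powr q \<le> bm s (T x) powr q" if "0 < bm t x powr q" for x
    proof (rule powr_mono2'[OF q])
      have "bm t x \<noteq> 0" using that by auto
      then have "0 < bm t x" using bm_nonneg[of t x] by simp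
      then obtain y where y: "y \<in> K" "dist x y < t" by (auto simp: bm_pos_iff)
      have near: "dist x (P x) < t" using nearest[OF y(1), of x] y(2) by simp
      have "dist (T x) (P x) = c * dist x (P x)" using c by (simp add: T_def dist_norm)
      also have "\<dots> < c * t" using near c by simp
      finally have "dist (T x) (P x) < s" using st by (simp add: c_def)
      then show "0 < bm s (T x)" using P(1) by (auto simp: bm_pos_iff)
      have "x - T x = (1 - c) *\<^sub>R (x - P x)" by (simp add: T_def algebra_simps)
      then have "dist x (T x) = (1 - c) * dist x (P x)" using c by (simp add: dist_norm)
      also have "\<dots> \<le> (1 - c) * t" using near c by (intro mult_left_mono) auto
      also have "\<dots> = t - s" using st by (simp add: c_def algebra_simps)
      finally have "dist (T x) x + s \<le> t" by (simp add: dist_commute)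
      then show "bm s (T x) \<le> bm t x"
        by (intro bm_mono) (simp add: ball_subset_ball_iff)
    qed
  qed (use st in auto)
qed

end

section \<open>Words, cylinders and stopping sets\<close>

abbreviation wt :: "(nat \<Rightarrow> real) \<Rightarrow> nat list \<Rightarrow> real" where
  "wt f v \<equiv> prod_list (map f v)"

context self_similar
begin

abbreviation words :: "nat list set" where "words \<equiv> lists {1..N}"

primrec sw :: "nat list \<Rightarrow> 'a \<Rightarrow> 'a" where
  "sw [] x = x"
| "sw (i # v) x = S i (sw v x)"

lemma sw_append: "sw (u @ v) x = sw u (sw v x)"
  by (induction u) auto

lemma sw_in_K: "v \<in> words \<Longrightarrow> x \<in> K \<Longrightarrow> sw v x \<in> K"
  by (induction v) (auto intro: S_in_K)

lemma dist_sw: "v \<in> words \<Longrightarrow> dist (sw v x) (sw v y) = wt r v * dist x y"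
  by (induction v) (auto simp: dist_S)

lemma wt_pos: "(\<And>i. i \<in> {1..N} \<Longrightarrow> 0 < f i) \<Longrightarrow> v \<in> words \<Longrightarrow> 0 < wt f v"
  by (induction v) auto

lemma wt_r_pos: "v \<in> words \<Longrightarrow> 0 < wt r v"
  by (rule wt_pos[OF r_pos])

lemma wt_r_le_1: "v \<in> words \<Longrightarrow> wt r v \<le> 1"
proof (induction v)
  case (Cons i v)
  then have "r i * wt r v \<le> 1 * 1"
    using r_pos[of i] r_less[of i] wt_r_pos[of v] by (intro mult_mono) auto
  then show ?case by simp
qed simp

lemma wt_r_less_1: "v \<in> words \<Longrightarrow> v \<noteq> [] \<Longrightarrow> wt r v < 1"
proof (cases v)
  case (Cons i u)
  assume "v \<in> words"
  then have "i \<in> {1..N}" "u \<in> words" using Cons by auto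
  then have "r i * wt r u \<le> r i * 1" "r i < 1"
    using r_pos[of i] r_less[of i] wt_r_le_1[of u] by (auto simp del: mult_1_right)
  then show ?thesis using Cons by simp
qed simp

lemma wt_r_ge: "v \<in> words \<Longrightarrow> rmin ^ length v \<le> wt r v"
proof (induction v)
  case (Cons i v)
  then show ?case using rmin(1) rmin(3)[of i] r_pos[of i] by (auto intro!: mult_mono)
qed simp

lemma sw_surj: "v \<in> words \<Longrightarrow> \<exists>y. sw v y = x"
proof (induction v arbitrary: x)
  case (Cons i v)
  then obtain y where "sw v y = inv (S i) x" by auto
  then show ?case using Cons by (auto intro!: exI[of _ y] simp: S_inv)
qed simp

text \<open>The stopping set of scale \<open>\<rho>\<close>: words broken off as soon as their ratio
  is at most \<open>\<rho>\<close>. Their cylinders have comparable diameters although the lengths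
  differ, and every point of \<open>K\<close> lies in one of them. For \<open>\<rho> \<ge> 1\<close>
  only the empty word remains.\<close>

definition cut :: "real \<Rightarrow> nat list set" where
  "cut \<rho> = {v \<in> words. wt r v \<le> \<rho> \<and> (v = [] \<or> \<rho> < wt r (butlast v))}"

lemma cut_words: "v \<in> cut \<rho> \<Longrightarrow> v \<in> words"
  by (simp add: cut_def)

lemma butlast_words: "v \<in> words \<Longrightarrow> butlast v \<in> words"
  by (auto simp: in_lists_conv_set dest: in_set_butlastD)

lemma cut_ge_1:
  assumes "1 \<le> \<rho>"
  shows "cut \<rho> = {[]}"
proof -
  have "v = []" if "v \<in> cut \<rho>" for v
    using that wt_r_le_1[OF butlast_words, of v] assms by (auto simp: cut_def)
  moreover have "[] \<in> cut \<rho>" using assms by (simp add: cut_def)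
  ultimately show ?thesis by blast
qed

lemma cut_append_iff:
  assumes "x \<in> words" "\<rho> < wt r x"
  shows "x @ v \<in> cut \<rho> \<longleftrightarrow> v \<in> cut (\<rho> / wt r x)"
proof (cases "v = []")
  case True
  then show ?thesis using assms wt_r_pos[OF assms(1)] by (simp add: cut_def)
next
  case False
  then show ?thesis
    using assms wt_r_pos[OF assms(1)]
    by (simp add: cut_def butlast_append pos_le_divide_eq pos_divide_less_eq mult.commute)
qed

text \<open>If \<open>\<rho> \<ge> r i\<close>, a single letter already reaches the scale, and both
  sides force the tail to be empty. Otherwise the general prefix rule applies.\<close>

lemma cut_Cons_iff:
  assumes "\<rho> < 1" "i \<in> {1..N}"
  shows "i # v \<in> cut \<rho> \<longleftrightarrow> v \<in> cut (\<rho> / r i)"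
proof (cases "\<rho> < r i")
  case True
  then show ?thesis using cut_append_iff[of "[i]" \<rho> v] assms by simp
next
  case False
  then have c: "cut (\<rho> / r i) = {[]}" using r_pos[OF assms(2)] by (intro cut_ge_1) simp
  have n: "v = []" if "i # v \<in> cut \<rho>"
  proof (rule ccontr)
    assume "v \<noteq> []"
    then have less: "\<rho> < r i * wt r (butlast v)" and v: "v \<in> words" using that by (auto simp: cut_def)
    have "r i * wt r (butlast v) \<le> r i * 1"
      using wt_r_le_1[OF butlast_words[OF v]] r_pos[OF assms(2)] by (intro mult_left_mono) auto
    then show False using False less by simp
  qed
  show ?thesis
  proof
    assume "i # v \<in> cut \<rho>"
    then show "v \<in> cut (\<rho> / r i)" using n c by simp
  next
    assume "v \<in> cut (\<rho> / r i)"
    then have "v = []" using c by simp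
    then show "i # v \<in> cut \<rho>" using False assms by (simp add: cut_def)
  qed
qed

lemma cut_rec: "\<rho> < 1 \<Longrightarrow> cut \<rho> = (\<Union>i\<in>{1..N}. (#) i ` cut (\<rho> / r i))"
proof (intro equalityI subsetI)
  fix v assume \<rho>: "\<rho> < 1" and v: "v \<in> cut \<rho>"
  then have "v \<noteq> []" by (auto simp: cut_def)
  then obtain i u where "v = i # u" by (cases v) auto
  moreover from this have "i \<in> {1..N}" using cut_words[OF v] by simp
  ultimately show "v \<in> (\<Union>i\<in>{1..N}. (#) i ` cut (\<rho> / r i))" using cut_Cons_iff[OF \<rho>] v by auto
next
  fix v assume "\<rho> < 1" "v \<in> (\<Union>i\<in>{1..N}. (#) i ` cut (\<rho> / r i))"
  then show "v \<in> cut \<rho>" using cut_Cons_iff by blast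
qed

text \<open>Induction over scales: one letter enlarges the scale by at least the factor
  \<open>1 / rmax\<close>, so after finitely many letters it is at least 1.\<close>

lemma cut_induct [consumes 1, case_names top rec]:
  assumes "0 < \<rho>"
    and top: "\<And>\<rho>. 1 \<le> \<rho> \<Longrightarrow> P \<rho>"
    and rec: "\<And>\<rho>. 0 < \<rho> \<Longrightarrow> \<rho> < 1 \<Longrightarrow> (\<And>i. i \<in> {1..N} \<Longrightarrow> P (\<rho> / r i)) \<Longrightarrow> P \<rho>"
  shows "P \<rho>"
proof -
  have "P \<rho>" if "rmax ^ n \<le> \<rho>" for n \<rho>
    using that
  proof (induction n arbitrary: \<rho>)
    case 0 then show ?case using top by simp
  next
    case (Suc n)
    have "0 < rmax ^ Suc n" using rmax(1) by simp
    then have "0 < \<rho>" using Suc.prems by linarith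
    show ?case
    proof (cases "1 \<le> \<rho>")
      case False
      show ?thesis
      proof (rule rec)
        fix i assume i: "i \<in> {1..N}"
        have "rmax ^ n * r i \<le> rmax ^ n * rmax" using rmax(1) rmax(3)[OF i] by (intro mult_left_mono) auto
        also have "\<dots> \<le> \<rho>" using Suc.prems by (simp add: mult.commute)
        finally show "P (\<rho> / r i)" using r_pos[OF i] by (intro Suc.IH) (simp add: field_simps)
      qed (use False \<open>0 < \<rho>\<close> in auto)
    qed (rule top)
  qed
  moreover obtain n where "rmax ^ n < \<rho>" using real_arch_pow_inv[OF assms(1) rmax(2)] by blast
  ultimately show ?thesis by (meson less_imp_le)
qed

lemma finite_cut: "0 < \<rho> \<Longrightarrow> finite (cut \<rho>)"
  by (induction \<rho> rule: cut_induct) (auto simp: cut_ge_1 cut_rec)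

lemma sum_cut:
  assumes "0 < \<rho>" "\<rho> < 1"
  shows "sum f (cut \<rho>) = (\<Sum>i=1..N. \<Sum>v\<in>cut (\<rho> / r i). f (i # v))"
proof -
  have "sum f (cut \<rho>) = (\<Sum>i\<in>{1..N}. sum f ((#) i ` cut (\<rho> / r i)))"
    unfolding cut_rec[OF assms(2)] using assms(1) r_pos
    by (intro sum.UNION_disjoint) (auto intro!: finite_cut)
  then show ?thesis by (simp add: sum.reindex o_def)
qed

text \<open>Refining a word by all its one-letter extensions preserves the total multiplicative
  weight, whatever the lengths at which words stop.\<close>

lemma cut_weights:
  fixes f :: "nat \<Rightarrow> real"
  assumes "(\<Sum>i=1..N. f i) = 1" "0 < \<rho>"
  shows "(\<Sum>v\<in>cut \<rho>. wt f v) = 1"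
  using assms(2)
proof (induction \<rho> rule: cut_induct)
  case (rec \<rho>)
  then have "(\<Sum>v\<in>cut \<rho>. wt f v) = (\<Sum>i=1..N. f i * (\<Sum>v\<in>cut (\<rho> / r i). wt f v))"
    by (simp add: sum_cut flip: sum_distrib_left)
  also have "\<dots> = (\<Sum>i=1..N. f i * 1)" by (intro sum.cong refl) (simp only: rec.IH)
  finally show ?case using assms(1) by simp
qed (simp add: cut_ge_1)

lemma cut_cover:
  assumes "0 < \<rho>" "x \<in> K"
  shows "\<exists>v\<in>cut \<rho>. \<exists>y\<in>K. x = sw v y"
  using assms
proof (induction \<rho> arbitrary: x rule: cut_induct)
  case (top \<rho>)
  then show ?case by (simp add: cut_ge_1)
next
  case (rec \<rho>)
  obtain i y where i: "i \<in> {1..N}" "y \<in> K" "x = S i y" using rec.prems K_eq by blast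
  obtain v z where "v \<in> cut (\<rho> / r i)" "z \<in> K" "y = sw v z" using rec.IH[OF i(1,2)] by blast
  then show ?case using i cut_Cons_iff[OF rec.hyps(2) i(1)]
    by (intro bexI[of _ "i # v"] bexI[of _ z]) auto
qed

text \<open>Iterating self-similarity down to the stopping set, only cylinders that meet the ball
  contribute, each with at most its full weight.\<close>

lemma bm_le_cut:
  assumes "0 < \<rho>"
  shows "bm s x \<le> (\<Sum>v\<in>cut \<rho>. wt p v * of_bool (\<exists>y\<in>K. dist x (sw v y) < s))"
  using assms
proof (induction \<rho> arbitrary: s x rule: cut_induct)
  case (top \<rho>)
  then show ?case
    using bm_le_1[of s x] bm_pos_iff[of s x] bm_nonneg[of s x] by (auto simp: cut_ge_1)
next
  case (rec \<rho>)
  have "bm s x = (\<Sum>i=1..N. p i * bm (s / r i) (inv (S i) x))" by (rule bm_rec)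
  also have "\<dots> \<le> (\<Sum>i=1..N. p i * (\<Sum>v\<in>cut (\<rho> / r i). wt p v * of_bool (\<exists>y\<in>K. dist (inv (S i) x) (sw v y) < s / r i)))"
    using p_pos by (intro sum_mono mult_left_mono rec.IH) (auto intro: less_imp_le)
  also have "\<dots> = (\<Sum>i=1..N. \<Sum>v\<in>cut (\<rho> / r i). wt p (i # v) * of_bool (\<exists>y\<in>K. dist x (sw (i # v) y) < s))"
  proof (intro sum.cong refl)
    fix i assume i: "i \<in> {1..N}"
    have "dist (inv (S i) x) y < s / r i \<longleftrightarrow> dist x (S i y) < s" for y
      using dist_S[OF i, of "inv (S i) x" y] r_pos[OF i] by (simp add: S_inv[OF i] field_simps)
    then show "p i * (\<Sum>v\<in>cut (\<rho> / r i). wt p v * of_bool (\<exists>y\<in>K. dist (inv (S i) x) (sw v y) < s / r i)) =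
      (\<Sum>v\<in>cut (\<rho> / r i). wt p (i # v) * of_bool (\<exists>y\<in>K. dist x (sw (i # v) y) < s))"
      by (simp add: sum_distrib_left mult.assoc)
  qed
  also have "\<dots> = (\<Sum>v\<in>cut \<rho>. wt p v * of_bool (\<exists>y\<in>K. dist x (sw v y) < s))"
    using rec.hyps by (simp add: sum_cut)
  finally show ?case .
qed

text \<open>The parent word still exceeds \<open>\<rho>\<close>, and the last letter costs at most
  the factor \<open>rmin\<close>. The bound \<open>\<rho> \<le> 1\<close> takes care of the empty
  word.\<close>

lemma cut_ge:
  assumes "v \<in> cut \<rho>" "\<rho> \<le> 1"
  shows "rmin * \<rho> \<le> wt r v"
proof (cases "v = []")
  case True
  then show ?thesis using assms rmin by (auto intro: mult_le_one less_imp_le simp: cut_def)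
next
  case False
  have l: "last v \<in> {1..N}" using False cut_words[OF assms(1)] by (auto simp: in_lists_conv_set)
  have "wt r v = wt r (butlast v @ [last v])" using False by simp
  also have "\<dots> = wt r (butlast v) * r (last v)" by simp
  finally have e: "wt r v = wt r (butlast v) * r (last v)" .
  have "\<rho> < wt r (butlast v)" using False assms by (simp add: cut_def)
  then have "rmin * \<rho> \<le> r (last v) * wt r (butlast v)"
    using rmin(1) rmin(3)[OF l] wt_r_pos[OF butlast_words[OF cut_words[OF assms(1)]]]
    by (intro order_trans[OF mult_left_mono[of \<rho> "wt r (butlast v)"] mult_right_mono]) auto
  then show ?thesis using e by (simp add: mult.commute)
qed

lemma sw_in_invariant:
  assumes U: "(\<Union>i\<in>{1..N}. S i ` U) \<subseteq> U" and "v \<in> words" "x \<in> U"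
  shows "sw v x \<in> U"
  using assms(2)
proof (induction v)
  case (Cons i v)
  then have i: "i \<in> {1..N}" and v: "sw v x \<in> U" by (simp_all only: Cons_in_lists_iff simp_thms)
  have "S i (sw v x) \<in> U"
    by (rule subsetD[OF U], rule UN_I, rule i, rule imageI, rule v)
  then show ?case by simp
qed (simp add: assms(3))

section \<open>Packing of cylinders under the open set condition\<close>

context
  fixes U :: "'a set"
  assumes U: "open U" "U \<noteq> {}" "bounded U" "(\<Union>i\<in>{1..N}. S i ` U) \<subseteq> U"
    and disj: "\<And>i j. i \<in> {1..N} \<Longrightarrow> j \<in> {1..N} \<Longrightarrow> i \<noteq> j \<Longrightarrow> S i ` U \<inter> S j ` U = {}"
begin

lemma sw_U_disjoint:
  assumes "0 < \<rho>" "v \<in> cut \<rho>" "w \<in> cut \<rho>" "v \<noteq> w"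
  shows "sw v ` U \<inter> sw w ` U = {}"
  using assms
proof (induction \<rho> arbitrary: v w rule: cut_induct)
  case (top \<rho>)
  then show ?case by (simp add: cut_ge_1)
next
  case (rec \<rho>)
  obtain i v' j w' where vw: "i \<in> {1..N}" "v = i # v'" "v' \<in> cut (\<rho> / r i)"
     "j \<in> {1..N}" "w = j # w'" "w' \<in> cut (\<rho> / r j)"
    using rec.prems(1,2) cut_rec[OF rec.hyps(2)] by auto
  have im: "sw v ` U = S i ` (sw v' ` U)" "sw w ` U = S j ` (sw w' ` U)" by (auto simp: vw)
  show ?case
  proof (cases "i = j")
    case False
    have "sw v' ` U \<subseteq> U" "sw w' ` U \<subseteq> U" using sw_in_invariant[OF U(4)] cut_words vw by blast+
    then show ?thesis using disj[OF vw(1,4) False] unfolding im by blast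
  next
    case True
    then have "sw v' ` U \<inter> sw w' ` U = {}" using rec.IH[OF vw(1), of v' w'] vw rec.prems(3) by auto
    then show ?thesis unfolding im True
      using image_Int[OF similarity_inj[OF sim[OF vw(4)] r_pos[OF vw(4)]], of "sw v' ` U" "sw w' ` U"] by simp
  qed
qed

text \<open>Volume packing. If a ball of radius \<open>a\<close> around \<open>z\<close> lies in
  \<open>U\<close>, each counted cylinder contains a ball of radius \<open>rmin * \<rho> * a\<close>
  around \<open>sw v z\<close>. These balls are disjoint and lie in one ball of radius
  \<open>(c + M + a) * \<rho>\<close>, where \<open>M\<close> bounds the distance from
  \<open>K\<close> to \<open>z\<close>; the scale cancels.\<close>

lemma count_cut:
  assumes c: "0 < c"
  obtains n :: nat where "\<And>\<rho> x. 0 < \<rho> \<Longrightarrow> \<rho> \<le> 1 \<Longrightarrow> card {v \<in> cut \<rho>. \<exists>y\<in>K. dist x (sw v y) < c * \<rho>} \<le> n"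
proof -
  obtain z where z: "z \<in> U" using U(2) by blast
  obtain a where a: "0 < a" "ball z a \<subseteq> U" using U(1) z by (meson openE)
  have "bounded (insert z K)" using compact_imp_bounded[OF compact_K] by simp
  then obtain M where M: "\<And>y. y \<in> K \<Longrightarrow> dist y z \<le> M" by (auto simp: bounded_two_points)
  have M0: "0 \<le> M" using M K_nonempty zero_le_dist order_trans by blast
  define n where "n = nat \<lceil>((c + M + a) / (rmin * a)) ^ DIM('a)\<rceil>"
  have "card {v \<in> cut \<rho>. \<exists>y\<in>K. dist x (sw v y) < c * \<rho>} \<le> n" if \<rho>: "0 < \<rho>" "\<rho> \<le> 1" for \<rho> x
  proof -
    define \<epsilon> where "\<epsilon> = rmin * \<rho> * a"
    define R where "R = (c + M + a) * \<rho>"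
    have R: "0 \<le> R" using c M0 a \<rho> by (simp add: R_def)
    define W where "W = {v \<in> cut \<rho>. \<exists>y\<in>K. dist x (sw v y) < c * \<rho>}"
    define B where "B v = ball (sw v z) \<epsilon>" for v
    have fin: "finite W" unfolding W_def using finite_cut[OF \<rho>(1)] by simp
    have B_sub: "B v \<subseteq> sw v ` U" if "v \<in> cut \<rho>" for v
    proof
      fix t assume t: "t \<in> B v"
      have v: "v \<in> words" using that by (rule cut_words)
      obtain t' where t': "t = sw v t'" using sw_surj[OF v] by metis
      have "wt r v * dist z t' < \<epsilon>" using t dist_sw[OF v, of z t'] by (simp add: B_def t')
      also have "\<dots> \<le> wt r v * a"
        unfolding \<epsilon>_def using cut_ge[OF that \<rho>(2)] a by (intro mult_right_mono) auto
      finally have "t' \<in> ball z a" using wt_r_pos[OF v] by simp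
      then show "t \<in> sw v ` U" using a t' by blast
    qed
    have disjB: "disjoint_family_on B W"
      unfolding disjoint_family_on_def
    proof (intro ballI impI)
      fix v w assume "v \<in> W" "w \<in> W" "v \<noteq> w"
      then have "v \<in> cut \<rho>" "w \<in> cut \<rho>" "v \<noteq> w" by (auto simp: W_def)
      then show "B v \<inter> B w = {}" using sw_U_disjoint[OF \<rho>(1)] B_sub[of v] B_sub[of w] by blast
    qed
    have sub: "B v \<subseteq> ball x R" if vW: "v \<in> W" for v
    proof -
      obtain y where y: "v \<in> cut \<rho>" "y \<in> K" "dist x (sw v y) < c * \<rho>" using vW unfolding W_def by blast
      have "dist (sw v y) (sw v z) = wt r v * dist y z" using dist_sw[OF cut_words[OF y(1)]] .
      also have "\<dots> \<le> \<rho> * M"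
        using y(1) M[OF y(2)] \<rho> M0 by (intro mult_mono) (auto simp: cut_def)
      finally have dyz: "dist (sw v y) (sw v z) \<le> \<rho> * M" .
      have "dist x (sw v z) < c * \<rho> + \<rho> * M"
        using y(3) dyz dist_triangle[of x "sw v z" "sw v y"] by linarith
      moreover have "\<epsilon> \<le> \<rho> * a"
        unfolding \<epsilon>_def using rmin(1,2) \<rho> a by (intro mult_right_mono) auto
      ultimately have "dist (sw v z) x + \<epsilon> \<le> R"
        by (simp add: R_def dist_commute algebra_simps)
      then show ?thesis by (simp add: B_def ball_subset_ball_iff)
    qed
    have pos: "0 < \<epsilon>" using rmin \<rho> a by (simp add: \<epsilon>_def)
    let ?u = "unit_ball_vol DIM('a)"
    have u: "0 < ?u" by simp
    have "ennreal (real (card W) * (?u * \<epsilon> ^ DIM('a))) = (\<Sum>v\<in>W. ennreal (?u * \<epsilon> ^ DIM('a)))"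
      using pos by (subst sum_ennreal) auto
    also have "\<dots> = (\<Sum>v\<in>W. emeasure lborel (B v))"
      unfolding B_def using pos by (intro sum.cong refl emeasure_ball[symmetric]) simp
    also have "\<dots> = emeasure lborel (\<Union>v\<in>W. B v)"
    proof (rule sum_emeasure[OF _ disjB fin])
      show "B ` W \<subseteq> sets lborel" by (auto simp: B_def)
    qed
    also have "\<dots> \<le> emeasure lborel (ball x R)"
      using sub by (intro emeasure_mono) auto
    also have "\<dots> = ennreal (?u * R ^ DIM('a))"
      using R by (simp add: emeasure_ball)
    finally have "ennreal (real (card W) * (?u * \<epsilon> ^ DIM('a))) \<le> ennreal (?u * R ^ DIM('a))" .
    then have "real (card W) * (?u * \<epsilon> ^ DIM('a)) \<le> ?u * R ^ DIM('a)"
      using R by (subst (asm) ennreal_le_iff) auto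
    then have "?u * (real (card W) * \<epsilon> ^ DIM('a)) \<le> ?u * R ^ DIM('a)"
      by (simp only: mult.left_commute)
    then have "real (card W) * \<epsilon> ^ DIM('a) \<le> R ^ DIM('a)"
      using u by (simp only: mult_le_cancel_left_pos)
    then have "real (card W) \<le> R ^ DIM('a) / \<epsilon> ^ DIM('a)"
      using pos by (simp only: pos_le_divide_eq zero_less_power)
    also have "\<dots> = ((c + M + a) / (rmin * a)) ^ DIM('a)"
      using \<rho> by (subst power_divide[symmetric]) (simp add: \<epsilon>_def R_def)
    finally show ?thesis unfolding n_def W_def[symmetric] by linarith
  qed
  then show ?thesis by (rule that)
qed

end

section \<open>Separated words\<close>

text \<open>Words of the same scale as \<open>v\<close> whose pieces of \<open>K\<close> come closer
  to that of \<open>v\<close> than its own ratio.\<close>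

definition nbrs :: "nat list \<Rightarrow> nat list set" where
  "nbrs v = {u \<in> cut (wt r v). \<exists>y\<in>K. \<exists>z\<in>K. dist (sw u y) (sw v z) < wt r v}"

lemma finite_nbrs: "v \<in> words \<Longrightarrow> finite (nbrs v)"
  unfolding nbrs_def using finite_cut[OF wt_r_pos] by simp

lemma append_in_nbrs:
  assumes x: "x \<in> words" and v: "v \<in> words" "v \<noteq> []" and u: "u \<in> nbrs v"
  shows "x @ u \<in> nbrs (x @ v)"
proof -
  obtain y z where yz: "y \<in> K" "z \<in> K" "dist (sw u y) (sw v z) < wt r v" and uc: "u \<in> cut (wt r v)"
    using u by (auto simp: nbrs_def)
  have px: "0 < wt r x" by (rule wt_r_pos[OF x])
  \<comment> \<open>Here \<open>v \<noteq> []\<close> matters: the stopping rule must not yet have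
    acted within the prefix \<open>x\<close>.\<close>
  have "wt r x * wt r v < wt r x" using wt_r_less_1[OF v] px by simp
  then have "x @ u \<in> cut (wt r (x @ v))"
    using cut_append_iff[OF x, of "wt r (x @ v)" u] uc px by simp
  moreover have "dist (sw (x @ u) y) (sw (x @ v) z) < wt r (x @ v)"
    using yz(3) px by (simp add: sw_append dist_sw[OF x])
  ultimately show ?thesis using yz by (auto simp: nbrs_def)
qed

text \<open>The argument of Bandt and Graf: a word with the maximal number of neighbours keeps exactly these
  neighbours under every prefix, so its prefixed copies stay away from the other first level pieces.\<close>

lemma separated_word:
  assumes bound: "\<And>v. v \<in> words \<Longrightarrow> card (nbrs v) \<le> n"
  obtains w where "w \<in> words" "w \<noteq> []"
    "\<And>i x j y z. i # x \<in> words \<Longrightarrow> j \<in> {1..N} \<Longrightarrow> i \<noteq> j \<Longrightarrow> y \<in> K \<Longrightarrow> z \<in> K \<Longrightarrow>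
       wt r (i # x @ w) \<le> dist (sw (i # x @ w) y) (S j z)"
proof -
  \<comment> \<open>The maximum is taken over non-empty words because only their neighbours are
    carried along by prefixes in \<open>append_in_nbrs\<close>.\<close>
  have "\<exists>w. (w \<in> words \<and> w \<noteq> []) \<and> (\<forall>v. v \<in> words \<and> v \<noteq> [] \<longrightarrow> card (nbrs v) \<le> card (nbrs w))"
  proof (rule ex_has_greatest_nat[where P = "\<lambda>v. v \<in> words \<and> v \<noteq> []" and k = "[1]" and f = "\<lambda>v. card (nbrs v)" and b = "Suc n"])
    show "[1] \<in> words \<and> [1] \<noteq> []" using N by simp
    show "\<forall>v. v \<in> words \<and> v \<noteq> [] \<longrightarrow> card (nbrs v) < Suc n"
      using bound by (simp add: less_Suc_eq_le)
  qed
  then obtain w where w: "w \<in> words" "w \<noteq> []" "\<And>v. v \<in> words \<Longrightarrow> v \<noteq> [] \<Longrightarrow> card (nbrs v) \<le> card (nbrs w)"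
    by blast
  have stable: "nbrs (x @ w) = (@) x ` nbrs w" if x: "x \<in> words" for x
  proof (rule card_subset_eq[symmetric])
    show "finite (nbrs (x @ w))" using x w by (intro finite_nbrs) simp
    show sub: "(@) x ` nbrs w \<subseteq> nbrs (x @ w)" using append_in_nbrs[OF x w(1,2)] by blast
    have "card ((@) x ` nbrs w) = card (nbrs w)" by (intro card_image) (simp add: inj_on_def)
    moreover have "card ((@) x ` nbrs w) \<le> card (nbrs (x @ w))"
      using x w by (intro card_mono sub finite_nbrs) simp
    moreover have "card (nbrs (x @ w)) \<le> card (nbrs w)" using x w by simp
    ultimately show "card ((@) x ` nbrs w) = card (nbrs (x @ w))" by simp
  qed
  have "wt r (i # x @ w) \<le> dist (sw (i # x @ w) y) (S j z)"
    if x: "i # x \<in> words" and j: "j \<in> {1..N}" "i \<noteq> j" and yz: "y \<in> K" "z \<in> K" for i x j y z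
  proof (rule ccontr)
    let ?v = "(i # x) @ w"
    assume "\<not> ?thesis"
    then have close: "dist (sw ?v y) (S j z) < wt r ?v" by simp
    have v: "?v \<in> words" using x w by simp
    have \<rho>: "0 < wt r ?v" "wt r ?v < 1" using wt_r_pos[OF v] wt_r_less_1[OF v] by auto
    obtain u t where u: "u \<in> cut (wt r ?v / r j)" "t \<in> K" "z = sw u t"
      using cut_cover[of "wt r ?v / r j" z] \<rho>(1) r_pos[OF j(1)] yz(2) by auto
    have "j # u \<in> cut (wt r ?v)" using cut_Cons_iff[OF \<rho>(2) j(1)] u(1) by blast
    moreover have "dist (sw (j # u) t) (sw ?v y) < wt r ?v" using close u(3) by (simp add: dist_commute)
    \<comment> \<open>By \<open>stable\<close> every neighbour of \<open>?v\<close> begins with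
      \<open>i\<close>, while this one begins with \<open>j\<close>.\<close>
    ultimately have "j # u \<in> nbrs ?v" unfolding nbrs_def using yz(1) u(2) by blast
    then show False using stable[OF x] j(2) by auto
  qed
  with w(1,2) show ?thesis by (rule that)
qed

section \<open>Words that avoid a given block\<close>

definition words_of :: "nat \<Rightarrow> nat list set" where
  "words_of l = {x \<in> words. length x = l}"

lemma words_of_0: "words_of 0 = {[]}"
  by (auto simp: words_of_def)

lemma words_of_Suc: "words_of (Suc l) = (\<Union>i\<in>{1..N}. (#) i ` words_of l)"
proof (intro equalityI subsetI)
  fix v assume "v \<in> words_of (Suc l)"
  then show "v \<in> (\<Union>i\<in>{1..N}. (#) i ` words_of l)"
    by (cases v) (auto simp: words_of_def)
qed (auto simp: words_of_def)

lemma finite_words_of: "finite (words_of l)"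
  by (induction l) (auto simp: words_of_0 words_of_Suc)

lemma sum_words_of_Suc: "sum f (words_of (Suc l)) = (\<Sum>i=1..N. \<Sum>x\<in>words_of l. f (i # x))"
proof -
  have "sum f (words_of (Suc l)) = (\<Sum>i\<in>{1..N}. sum f ((#) i ` words_of l))"
    unfolding words_of_Suc by (intro sum.UNION_disjoint) (auto intro!: finite_words_of)
  then show ?thesis by (simp add: sum.reindex o_def)
qed

lemma words_of_weights:
  fixes f :: "nat \<Rightarrow> real"
  assumes "(\<Sum>i=1..N. f i) = 1"
  shows "(\<Sum>x\<in>words_of l. wt f x) = 1"
proof (induction l)
  case (Suc l)
  have "(\<Sum>x\<in>words_of (Suc l). wt f x) = (\<Sum>i=1..N. f i * (\<Sum>x\<in>words_of l. wt f x))"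
    by (simp add: sum_words_of_Suc sum_distrib_left)
  also have "\<dots> = (\<Sum>i=1..N. f i * 1)" by (simp only: Suc)
  finally show ?case using assms by simp
qed (simp add: words_of_0)

text \<open>Below scale \<open>rmin ^ l\<close> no word of the stopping set ends within its first
  \<open>l\<close> letters, so an initial block of fixed length can be split off.\<close>

lemma sum_cut_words_of:
  assumes "0 < \<rho>" "\<rho> < rmin ^ l"
  shows "sum f (cut \<rho>) = (\<Sum>x\<in>words_of l. \<Sum>v\<in>cut (\<rho> / wt r x). f (x @ v))"
  using assms
proof (induction l arbitrary: \<rho> f)
  case 0
  then show ?case by (simp add: words_of_0)
next
  case (Suc l)
  have "rmin * rmin ^ l \<le> rmin ^ l" using rmin(1,2) by simp
  moreover have "rmin ^ l \<le> 1" using rmin(1,2) by (intro power_le_one) auto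
  ultimately have \<rho>: "\<rho> < 1" using Suc.prems(2) by simp
  have "sum f (cut \<rho>) = (\<Sum>i=1..N. \<Sum>v\<in>cut (\<rho> / r i). f (i # v))"
    by (rule sum_cut[OF Suc.prems(1) \<rho>])
  also have "\<dots> = (\<Sum>i=1..N. \<Sum>x\<in>words_of l. \<Sum>v\<in>cut (\<rho> / r i / wt r x). f (i # x @ v))"
  proof (rule sum.cong[OF refl])
    fix i assume i: "i \<in> {1..N}"
    have "\<rho> < rmin ^ l * rmin" using Suc.prems(2) by (simp add: mult.commute)
    also have "\<dots> \<le> rmin ^ l * r i" using rmin(1) rmin(3)[OF i] by (intro mult_left_mono) auto
    finally have "\<rho> / r i < rmin ^ l" using r_pos[OF i] by (simp add: pos_divide_less_eq)
    then show "(\<Sum>v\<in>cut (\<rho> / r i). f (i # v)) = (\<Sum>x\<in>words_of l. \<Sum>v\<in>cut (\<rho> / r i / wt r x). f (i # x @ v))"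
      using Suc.prems(1) r_pos[OF i] by (intro Suc.IH) auto
  qed
  also have "\<dots> = (\<Sum>x\<in>words_of (Suc l). \<Sum>v\<in>cut (\<rho> / wt r x). f (x @ v))"
    by (simp add: sum_words_of_Suc)
  finally show ?case .
qed

lemma wt_le_1:
  fixes f :: "nat \<Rightarrow> real"
  assumes f: "\<And>i. i \<in> {1..N} \<Longrightarrow> 0 < f i" "(\<Sum>i=1..N. f i) = 1" and w: "w \<in> words"
  shows "wt f w \<le> 1"
proof -
  have "w \<in> words_of (length w)" using w by (simp add: words_of_def)
  then have "wt f w \<le> (\<Sum>x\<in>words_of (length w). wt f x)"
  proof (rule member_le_sum[OF _ _ finite_words_of])
    fix x assume "x \<in> words_of (length w) - {w}"
    then show "0 \<le> wt f x" using wt_pos[of f x] f(1) by (simp add: words_of_def)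
  qed
  then show ?thesis using words_of_weights[OF f(2), of "length w"] by simp
qed

text \<open>Only occurrences of \<open>w\<close> aligned to multiples of its length are tested,
  among the first \<open>k\<close> blocks. Aligned blocks are independent under multiplicative
  weights.\<close>

definition avoids :: "nat list \<Rightarrow> nat \<Rightarrow> nat list \<Rightarrow> bool" where
  "avoids w k v \<longleftrightarrow> (\<forall>m<k. take (length w) (drop (m * length w) v) \<noteq> w)"

lemma avoids_Suc:
  assumes "length x = length w"
  shows "avoids w (Suc k) (x @ v) \<longleftrightarrow> x \<noteq> w \<and> avoids w k v"
proof -
  have "avoids w (Suc k) (x @ v) \<longleftrightarrow> take (length w) (drop (0 * length w) (x @ v)) \<noteq> w \<and>
     (\<forall>m<k. take (length w) (drop (Suc m * length w) (x @ v)) \<noteq> w)"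
    unfolding avoids_def by (subst All_less_Suc2) simp
  then show ?thesis using assms by (simp add: avoids_def)
qed

text \<open>Each of the \<open>k\<close> blocks contributes the factor \<open>1 - wt f w\<close>,
  the weight of all blocks other than \<open>w\<close>. The bound on \<open>\<rho>\<close>
  guarantees that all words of the stopping set contain \<open>k\<close> full blocks.\<close>

lemma avoids_sum_le:
  fixes f :: "nat \<Rightarrow> real"
  assumes f: "\<And>i. i \<in> {1..N} \<Longrightarrow> 0 < f i" "(\<Sum>i=1..N. f i) = 1"
    and w: "w \<in> words"
    and \<rho>: "0 < \<rho>" "\<rho> < rmin ^ (k * length w)"
  shows "(\<Sum>v\<in>cut \<rho>. wt f v * of_bool (avoids w k v)) \<le> (1 - wt f w) ^ k"
  using \<rho>
proof (induction k arbitrary: \<rho>)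
  case 0
  then show ?case using cut_weights[OF f(2), of \<rho>] by (simp add: avoids_def)
next
  case (Suc k)
  let ?l = "length w"
  have wl: "w \<in> words_of ?l" using w by (simp add: words_of_def)
  have "rmin ^ (Suc k * ?l) = rmin ^ ?l * rmin ^ (k * ?l)" by (simp add: power_add)
  also have "\<dots> \<le> rmin ^ ?l * 1" using rmin(1,2) by (intro mult_left_mono power_le_one) auto
  finally have \<rho>l: "\<rho> < rmin ^ ?l" using Suc.prems by simp
  have "(\<Sum>v\<in>cut \<rho>. wt f v * of_bool (avoids w (Suc k) v)) =
      (\<Sum>x\<in>words_of ?l. \<Sum>v\<in>cut (\<rho> / wt r x). wt f (x @ v) * of_bool (avoids w (Suc k) (x @ v)))"
    by (rule sum_cut_words_of[OF Suc.prems(1) \<rho>l])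
  also have "\<dots> = (\<Sum>x\<in>words_of ?l. of_bool (x \<noteq> w) * wt f x * (\<Sum>v\<in>cut (\<rho> / wt r x). wt f v * of_bool (avoids w k v)))"
    by (intro sum.cong refl) (auto simp: words_of_def avoids_Suc sum_distrib_left mult.assoc intro!: sum.cong)
  also have "\<dots> \<le> (\<Sum>x\<in>words_of ?l. of_bool (x \<noteq> w) * wt f x * (1 - wt f w) ^ k)"
  proof (intro sum_mono mult_left_mono)
    fix x assume x: "x \<in> words_of ?l"
    then have xw: "x \<in> words" "length x = ?l" by (auto simp: words_of_def)
    show "0 \<le> of_bool (x \<noteq> w) * wt f x" using wt_pos[of f x] f(1) xw(1) by simp
    have "\<rho> < rmin ^ ?l * rmin ^ (k * ?l)" using Suc.prems by (simp add: power_add)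
    also have "\<dots> \<le> wt r x * rmin ^ (k * ?l)"
      using wt_r_ge[OF xw(1)] xw(2) rmin(1) by (intro mult_right_mono) auto
    finally show "(\<Sum>v\<in>cut (\<rho> / wt r x). wt f v * of_bool (avoids w k v)) \<le> (1 - wt f w) ^ k"
      using Suc.prems(1) wt_r_pos[OF xw(1)] by (intro Suc.IH) (auto simp: pos_divide_less_eq mult.commute)
  qed
  also have "\<dots> = (\<Sum>x\<in>words_of ?l. of_bool (x \<noteq> w) * wt f x) * (1 - wt f w) ^ k"
    by (simp only: sum_distrib_right)
  also have "(\<Sum>x\<in>words_of ?l. of_bool (x \<noteq> w) * wt f x) = (\<Sum>x\<in>words_of ?l - {w}. wt f x)"
    by (intro sum.mono_neutral_cong_right finite_words_of) auto
  also have "\<dots> = 1 - wt f w"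
    using sum.remove[OF finite_words_of wl, of "wt f"] words_of_weights[OF f(2), of ?l] by simp
  finally show ?case by simp
qed

section \<open>Decay of the error term\<close>

abbreviation \<beta> :: real where "\<beta> \<equiv> mf_beta N p r q"

definition \<omega> :: "nat \<Rightarrow> real" where
  "\<omega> i = p i powr q * r i powr \<beta>"

text \<open>This is the defining equation of \<open>\<beta>\<close>; what has to be shown is that
  \<open>THE\<close> is well defined. The sum is continuous and strictly decreasing in the exponent,
  tends to 0, and is at least 1 somewhere.\<close>

lemma \<omega>_sum: "(\<Sum>i=1..N. \<omega> i) = 1"
proof -
  define \<phi> where "\<phi> b = (\<Sum>i=1..N. p i powr q * r i powr b)" for b
  have one: "1 \<in> {1..N}" using N by simp
  have anti: "\<phi> c < \<phi> b" if "b < c" for b c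
    unfolding \<phi>_def
  proof (rule sum_strict_mono)
    fix i assume i: "i \<in> {1..N}"
    show "p i powr q * r i powr c < p i powr q * r i powr b"
      using that r[OF i] p_pos[OF i] by (intro mult_strict_left_mono powr_less_mono') auto
  qed (use N in auto)
  have "(\<phi> \<longlongrightarrow> (\<Sum>i=1..N. p i powr q * 0)) at_top"
    unfolding \<phi>_def
  proof (intro tendsto_sum tendsto_mult tendsto_const)
    fix i assume "i \<in> {1..N}"
    then have "0 < r i" "r i < 1" using r by auto
    then show "((\<lambda>b. r i powr b) \<longlongrightarrow> 0) at_top"
      by real_asymp
  qed
  then have "\<forall>\<^sub>F b in at_top. \<phi> b < 1" by (intro order_tendstoD(2)) auto
  then obtain c where c: "\<phi> c < 1" using eventually_happens by (metis trivial_limit_at_top_linorder)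
  \<comment> \<open>Chosen so that the summand of index 1 alone equals 1.\<close>
  define b where "b = - ln (p 1 powr q) / ln (r 1)"
  have "r 1 powr b = exp (- ln (p 1 powr q))"
    using r[OF one] by (simp add: powr_def b_def)
  also have "\<dots> = inverse (p 1 powr q)"
    using p_pos[OF one] by (auto simp: exp_minus simp del: ln_powr)
  finally have "p 1 powr q * r 1 powr b = 1" using p_pos[OF one] by simp
  moreover have "p 1 powr q * r 1 powr b \<le> \<phi> b"
    unfolding \<phi>_def by (rule member_le_sum[OF one]) auto
  ultimately have b: "1 \<le> \<phi> b" by simp
  have bc: "b \<le> c"
  proof (rule ccontr)
    assume "\<not> b \<le> c"
    then show False using anti[of c b] b c by simp
  qed
  have "continuous_on {b..c} \<phi>"
    unfolding \<phi>_def using r_pos by (intro continuous_intros) force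
  then obtain x where x: "\<phi> x = 1" using IVT2'[of \<phi> c 1 b] b c bc by auto
  have "\<beta> = x"
    unfolding mf_beta_def
  proof (rule the_equality)
    show "(\<Sum>i=1..N. p i powr q * r i powr x) = 1" using x by (simp add: \<phi>_def)
    fix y assume "(\<Sum>i=1..N. p i powr q * r i powr y) = 1"
    then have "\<phi> y = \<phi> x" using x by (simp add: \<phi>_def)
    then show "y = x" using anti[of x y] anti[of y x] by (cases x y rule: linorder_cases) auto
  qed
  then show ?thesis using x by (simp add: \<omega>_def \<phi>_def)
qed

lemma \<omega>_pos: "i \<in> {1..N} \<Longrightarrow> 0 < \<omega> i"
  using p_pos[of i] r_pos[of i] by (simp add: \<omega>_def)

lemma wt_\<omega>: "v \<in> words \<Longrightarrow> wt \<omega> v = wt p v powr q * wt r v powr \<beta>"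
proof (induction v)
  case (Cons i v)
  then have "0 \<le> p i" "0 \<le> r i" "0 \<le> wt p v" "0 \<le> wt r v"
    using p_pos[of i] r_pos[of i] wt_r_pos[of v] wt_pos[of p v] p_pos by (auto intro: less_imp_le)
  then show ?case using Cons by (simp add: \<omega>_def powr_mult)
qed simp

abbreviation V :: "real \<Rightarrow> real" where "V s \<equiv> mf_minkowski_volume \<mu> q s K"

abbreviation \<Lambda> :: "real \<Rightarrow> real" where "\<Lambda> \<equiv> mf_lambda N p r \<mu> K q"

text \<open>For \<open>s \<le> rmin\<close> all indicators in \<open>\<Lambda>\<close> equal 1, so
  it becomes the plain defect of the self-similarity relation for \<open>I\<close>.\<close>

lemma \<Lambda>_eq:
  assumes "0 < s" "s \<le> rmin"
  shows "s ^ DIM('a) * \<Lambda> s =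
    enn2real (I s) - (\<Sum>i=1..N. p i powr q * r i ^ DIM('a) * enn2real (I (s / r i)))"
proof -
  have "s ^ DIM('a) * \<Lambda> s = s ^ DIM('a) * V s - (\<Sum>i=1..N. s ^ DIM('a) * (p i powr q * indicator {0<..r i} s * V (inverse (r i) * s)))"
    by (simp add: mf_lambda_def right_diff_distrib sum_distrib_left)
  also have "s ^ DIM('a) * V s = enn2real (I s)"
    using assms by (simp add: volume_eq)
  also have "(\<Sum>i=1..N. s ^ DIM('a) * (p i powr q * indicator {0<..r i} s * V (inverse (r i) * s))) =
      (\<Sum>i=1..N. p i powr q * r i ^ DIM('a) * enn2real (I (s / r i)))"
  proof (rule sum.cong[OF refl])
    fix i assume i: "i \<in> {1..N}"
    have "s \<le> r i" using assms rmin(3)[OF i] by simp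
    then have ind: "indicator {0<..r i} s = (1::real)" using assms by simp
    have "s ^ DIM('a) * V (inverse (r i) * s) = r i ^ DIM('a) * enn2real (I (s / r i))"
      using assms r_pos[OF i] by (simp add: volume_eq power_divide inverse_eq_divide)
    then show "s ^ DIM('a) * (p i powr q * indicator {0<..r i} s * V (inverse (r i) * s)) =
        p i powr q * r i ^ DIM('a) * enn2real (I (s / r i))"
      unfolding ind by (simp add: algebra_simps)
  qed
  finally show ?thesis .
qed

text \<open>The part of the mass of the ball that comes from the piece \<open>i\<close>, namely
  \<open>p i\<close> times the measure of the preimage of the ball under \<open>S i\<close>.\<close>

definition child :: "nat \<Rightarrow> real \<Rightarrow> 'a \<Rightarrow> real" where
  "child i s x = p i * bm (s / r i) (inv (S i) x)"

lemma child_meas [measurable]: "i \<in> {1..N} \<Longrightarrow> child i s \<in> borel_measurable borel"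
  unfolding child_def[abs_def] by measurable

lemma child_nonneg: "i \<in> {1..N} \<Longrightarrow> 0 \<le> child i s x"
  using p_pos[of i] bm_nonneg by (simp add: child_def)

lemma bm_children: "bm s x = (\<Sum>i=1..N. child i s x)"
  unfolding child_def by (rule bm_rec)

lemma child_pos_iff: "i \<in> {1..N} \<Longrightarrow> 0 < child i s x \<longleftrightarrow> (\<exists>y\<in>K. dist x (S i y) < s)"
  using bm_child_pos_iff[of i s x] p_pos[of i] by (simp add: child_def zero_less_mult_iff)

definition overlap :: "real \<Rightarrow> 'a set" where
  "overlap s = {x. \<exists>i\<in>{1..N}. \<exists>j\<in>{1..N}. i \<noteq> j \<and> 0 < child i s x \<and> 0 < child j s x}"

text \<open>At most one summand of the ball mass is positive, so the power commutes with the sum.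
  The case of no positive summand uses \<open>0 powr q = 0\<close>.\<close>

lemma no_overlap:
  assumes "x \<notin> overlap s"
  shows "bm s x powr q = (\<Sum>i=1..N. child i s x powr q)"
proof (cases "\<exists>i\<in>{1..N}. 0 < child i s x")
  case True
  then obtain i where i: "i \<in> {1..N}" "0 < child i s x" by blast
  have zero: "child j s x = 0" if "j \<in> {1..N} - {i}" for j
    using assms i that child_nonneg[of j s x] by (fastforce simp: overlap_def)
  have "bm s x = child i s x"
    unfolding bm_children using i zero by (subst sum.remove[of _ i]) auto
  moreover have "(\<Sum>i=1..N. child i s x powr q) = child i s x powr q"
    using i zero by (subst sum.remove[of _ i]) auto
  ultimately show ?thesis by simp
next
  case False
  then have zero: "child j s x = 0" if "j \<in> {1..N}" for j using that child_nonneg[OF that, of s x] by force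
  then show ?thesis unfolding bm_children by simp
qed

lemma integrable_bm: "0 \<le> q \<Longrightarrow> integrable lborel (\<lambda>x. bm s x powr q)"
  using I_finite[of s] by (intro integrableI_nonneg) (auto simp: I_def)

lemma integral_bm: "(LINT x|lborel. bm s x powr q) = enn2real (I s)"
  unfolding I_def by (rule integral_eq_nn_integral) auto

lemma integral_child:
  assumes "i \<in> {1..N}"
  shows "(LINT x|lborel. child i s x powr q) = p i powr q * r i ^ DIM('a) * enn2real (I (s / r i))"
proof -
  have "(LINT x|lborel. child i s x powr q) = enn2real (\<integral>\<^sup>+x. ennreal (child i s x powr q) \<partial>lborel)"
    using assms by (intro integral_eq_nn_integral) auto
  also have "\<dots> = p i powr q * r i ^ DIM('a) * enn2real (I (s / r i))"
    using nn_integral_child[OF assms, of s] r_pos[OF assms] by (simp add: child_def enn2real_mult)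
  finally show ?thesis .
qed

lemma integrable_child:
  assumes "i \<in> {1..N}" "0 \<le> q"
  shows "integrable lborel (\<lambda>x. child i s x powr q)"
proof (rule integrableI_nonneg)
  show "(\<integral>\<^sup>+x. ennreal (child i s x powr q) \<partial>lborel) < \<infinity>"
    using nn_integral_child[OF assms(1), of s] I_finite[OF assms(2), of "s / r i"]
    by (simp add: child_def ennreal_mult_less_top)
qed (use assms(1) in auto)

text \<open>\<open>\<Lambda>\<close> integrates the pointwise defect \<open>h\<close>. It vanishes
  off the overlap; on it, \<open>q \<ge> 0\<close> bounds each of the \<open>N\<close> child powers
  by the power of the whole ball mass.\<close>

lemma \<Lambda>_le_overlap:
  assumes q: "0 \<le> q" and s: "0 < s" "s \<le> rmin"
    and G: "integrable lborel G" "\<And>x. x \<in> overlap s \<Longrightarrow> bm s x powr q \<le> G x" "\<And>x. 0 \<le> G x"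
  shows "\<bar>s ^ DIM('a) * \<Lambda> s\<bar> \<le> real (N + 1) * (LINT x|lborel. G x)"
proof -
  define h where "h x = bm s x powr q - (\<Sum>i=1..N. child i s x powr q)" for x
  have int: "integrable lborel h"
    unfolding h_def using integrable_bm integrable_child q by (intro Bochner_Integration.integrable_diff Bochner_Integration.integrable_sum) auto
  have "s ^ DIM('a) * \<Lambda> s = (LINT x|lborel. h x)"
    unfolding h_def using q s integrable_bm integrable_child
    by (subst Bochner_Integration.integral_diff) (auto simp: \<Lambda>_eq integral_bm integral_child Bochner_Integration.integral_sum)
  also have "\<bar>\<dots>\<bar> \<le> (LINT x|lborel. \<bar>h x\<bar>)" by (rule integral_abs_bound)
  also have "\<dots> \<le> (LINT x|lborel. real (N + 1) * G x)"
  proof (rule integral_mono)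
    show "integrable lborel (\<lambda>x. \<bar>h x\<bar>)" using int by simp
    show "integrable lborel (\<lambda>x. real (N + 1) * G x)" using G(1) by simp
    fix x
    show "\<bar>h x\<bar> \<le> real (N + 1) * G x"
    proof (cases "x \<in> overlap s")
      case False
      then have "h x = 0" using no_overlap by (simp add: h_def)
      then show ?thesis using G(3)[of x] by simp
    next
      case True
      have "(\<Sum>i=1..N. child i s x powr q) \<le> (\<Sum>i=1..N. bm s x powr q)"
        using q child_nonneg bm_child_le by (intro sum_mono powr_mono2) (auto simp: child_def)
      then have c: "(\<Sum>i=1..N. child i s x powr q) \<le> real N * bm s x powr q" by simp
      have "0 \<le> (\<Sum>i=1..N. child i s x powr q)" by (intro sum_nonneg) simp
      then have "\<bar>h x\<bar> \<le> bm s x powr q + real N * bm s x powr q"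
        using c mult_nonneg_nonneg[of "real N" "bm s x powr q"] unfolding h_def abs_le_iff
        by (simp add: add_increasing)
      also have "\<dots> = real (N + 1) * bm s x powr q" by (simp add: distrib_right)
      also have "\<dots> \<le> real (N + 1) * G x" using G(2)[OF True] by (intro mult_left_mono) auto
      finally show ?thesis .
    qed
  qed
  also have "\<dots> = real (N + 1) * (LINT x|lborel. G x)" by simp
  finally show ?thesis .
qed

text \<open>A sum of at most \<open>n\<close> terms is at most \<open>n\<close> times its maximum.
  The power of the maximum is one of the summands on the right, so the estimate works for
  \<open>q\<close> below and above 1 alike.\<close>

lemma bm_powr_le_cut:
  assumes q: "0 \<le> q" and s: "0 < s"
    and n: "card {v \<in> cut s. \<exists>y\<in>K. dist x (sw v y) < s} \<le> n"
  shows "bm s x powr q \<le> real n powr q * (\<Sum>v\<in>cut s. wt p v powr q * of_bool (\<exists>y\<in>K. dist x (sw v y) < s))"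
proof -
  define W where "W = {v \<in> cut s. \<exists>y\<in>K. dist x (sw v y) < s}"
  have fin: "finite W" using finite_cut[OF s] by (simp add: W_def)
  have sumW: "(\<Sum>v\<in>cut s. f v * of_bool (\<exists>y\<in>K. dist x (sw v y) < s)) = sum f W" for f :: "nat list \<Rightarrow> real"
    unfolding W_def using finite_cut[OF s] by (intro sum.mono_neutral_cong_right) auto
  have bmW: "bm s x \<le> sum (wt p) W" using bm_le_cut[OF s, of s x] by (simp add: sumW)
  show ?thesis
  proof (cases "W = {}")
    case True
    then have "bm s x = 0" using bmW bm_nonneg[of s x] by simp
    then show ?thesis by (simp add: sum_nonneg)
  next
    case False
    define m where "m = Max (wt p ` W)"
    have "m \<in> wt p ` W" unfolding m_def using fin False by (intro Max_in) auto
    then obtain v where v: "v \<in> W" "m = wt p v" by blast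
    have m0: "0 \<le> m" using v wt_pos[of p v] p_pos cut_words[of v s] by (auto simp: W_def intro: less_imp_le)
    have "sum (wt p) W \<le> real (card W) * m"
      unfolding m_def using fin by (intro sum_bounded_above) auto
    also have "\<dots> \<le> real n * m" using n m0 by (intro mult_right_mono) (auto simp: W_def)
    finally have "bm s x \<le> real n * m" using bmW by simp
    then have "bm s x powr q \<le> (real n * m) powr q" using q bm_nonneg by (intro powr_mono2)
    also have "\<dots> = real n powr q * m powr q" using m0 by (simp add: powr_mult)
    also have "m powr q \<le> (\<Sum>v\<in>W. wt p v powr q)"
      unfolding v(2) by (rule member_le_sum[OF v(1)]) (use fin in auto)
    finally show ?thesis by (simp add: sumW mult_left_mono)
  qed
qed

lemma powr_comparable:
  fixes t s b :: real
  assumes s: "0 < s" and t: "rmin * s \<le> t" "t \<le> s"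
  shows "t powr b \<le> rmin powr (- \<bar>b\<bar>) * s powr b"
proof -
  define a where "a = t / s"
  have a: "rmin \<le> a" "a \<le> 1" using s t by (auto simp: a_def pos_le_divide_eq)
  then have a0: "0 < a" using rmin(1) by simp
  have "a powr b \<le> a powr (- \<bar>b\<bar>)"
    using a a0 by (intro powr_mono') auto
  also have "\<dots> \<le> rmin powr (- \<bar>b\<bar>)"
    using a rmin(1) by (intro powr_mono2') auto
  finally have "a powr b * s powr b \<le> rmin powr (- \<bar>b\<bar>) * s powr b"
    by (rule mult_right_mono) simp
  moreover have "t powr b = a powr b * s powr b"
    using s a0 by (simp add: a_def powr_mult[symmetric])
  ultimately show ?thesis by simp
qed

text \<open>Converts decay in the number of blocks into a power of the scale: \<open>k\<close> is
  the last exponent with \<open>x \<le> a ^ k\<close>, and \<open>\<theta>\<close> is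
  \<open>a\<close> to the power \<open>ln \<theta> / ln a\<close>.\<close>

lemma geometric_scale:
  fixes a \<theta> x :: real
  assumes "0 < a" "a < 1" "0 < \<theta>" "\<theta> < 1" "0 < x" "x \<le> 1"
  obtains k where "x \<le> a ^ k" "\<theta> ^ k \<le> x powr (ln \<theta> / ln a) / \<theta>"
proof -
  obtain m where m: "a ^ m < x" using real_arch_pow_inv[OF assms(5,2)] by blast
  obtain k where k: "\<forall>i\<le>k. \<not> a ^ i < x" "a ^ (k + 1) < x"
    using ex_least_nat_less[of "\<lambda>m. a ^ m < x" m] m assms(6) by auto
  define \<gamma> where "\<gamma> = ln \<theta> / ln a"
  have \<gamma>: "0 < \<gamma>" using assms by (simp add: \<gamma>_def zero_less_divide_iff)
  have "a powr \<gamma> = \<theta>" using assms by (simp add: powr_def \<gamma>_def)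
  moreover have "(a ^ n) powr \<gamma> = (a powr \<gamma>) ^ n" for n
    using assms by (induction n) (simp_all add: powr_mult)
  ultimately have "\<theta> ^ (k + 1) = (a ^ (k + 1)) powr \<gamma>" by metis
  also have "\<dots> \<le> x powr \<gamma>"
    using k(2) \<gamma> assms by (intro powr_mono2) auto
  finally have "\<theta> ^ k \<le> x powr \<gamma> / \<theta>" using assms by (simp add: pos_le_divide_eq mult.commute)
  then show ?thesis using k(1) by (intro that[of k]) (auto simp: \<gamma>_def not_less)
qed

text \<open>If some block of \<open>v\<close> were \<open>w\<close>, the cylinder up to that block
  would keep a distance of at least \<open>2 * s\<close> from the other first level pieces. A point
  of the overlap is within \<open>s\<close> of both. The \<open>Suc\<close> in the exponent accounts
  for the first letter \<open>i\<close>.\<close>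

lemma overlap_avoids:
  assumes w: "w \<in> words"
    and sep: "\<And>i x j y z. i # x \<in> words \<Longrightarrow> j \<in> {1..N} \<Longrightarrow> i \<noteq> j \<Longrightarrow> y \<in> K \<Longrightarrow> z \<in> K \<Longrightarrow>
       wt r (i # x @ w) \<le> dist (sw (i # x @ w) y) (S j z)"
    and s: "2 * s \<le> rmin ^ Suc (k * length w)"
    and v: "i # v \<in> words" and x: "x \<in> overlap s" and near: "y \<in> K" "dist x (sw (i # v) y) < s"
  shows "avoids w k v"
proof (rule ccontr)
  assume "\<not> avoids w k v"
  then obtain m where m: "m < k" "take (length w) (drop (m * length w) v) = w"
    by (auto simp: avoids_def)
  define x1 where "x1 = take (m * length w) v"
  define x2 where "x2 = drop (length w) (drop (m * length w) v)"
  have v_eq: "v = x1 @ w @ x2"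
    unfolding x1_def x2_def using m(2) by (metis append_take_drop_id)
  have words: "i # x1 \<in> words" "x2 \<in> words" using v by (auto simp: v_eq)
  obtain j where j: "j \<in> {1..N}" "j \<noteq> i" "0 < child j s x"
    using x unfolding overlap_def by blast
  then obtain z where z: "z \<in> K" "dist x (S j z) < s" using child_pos_iff by blast
  have "wt r (i # x1 @ w) \<le> dist (sw (i # x1 @ w) (sw x2 y)) (S j z)"
    using words j z near by (intro sep sw_in_K) auto
  also have "sw (i # x1 @ w) (sw x2 y) = sw (i # v) y" by (simp add: v_eq sw_append)
  also have "dist (sw (i # v) y) (S j z) < 2 * s"
    using near(2) z(2) dist_triangle2[of "sw (i # v) y" "S j z" x] by (simp add: dist_commute)
  also have "2 * s \<le> rmin ^ Suc (k * length w)" by (rule s)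
  also have "\<dots> \<le> rmin ^ length (i # x1 @ w)"
  proof (rule power_decreasing)
    have "m * length w + length w \<le> k * length w"
      using mult_le_mono1[of "Suc m" k "length w"] m(1) by simp
    then show "length (i # x1 @ w) \<le> Suc (k * length w)" by (simp add: x1_def)
  qed (use rmin in auto)
  also have "\<dots> \<le> wt r (i # x1 @ w)" using words w by (intro wt_r_ge) simp
  finally show False by simp
qed

lemma osc_count:
  assumes "open_set_condition N S" "0 < c"
  obtains n where
    "\<And>\<rho> x. 0 < \<rho> \<Longrightarrow> \<rho> \<le> 1 \<Longrightarrow> card {v \<in> cut \<rho>. \<exists>y\<in>K. dist x (sw v y) < c * \<rho>} \<le> n"
proof -
  obtain U where "open U" "U \<noteq> {}" "bounded U" "(\<Union>i\<in>{1..N}. S i ` U) \<subseteq> U"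
    "\<And>i j. i \<in> {1..N} \<Longrightarrow> j \<in> {1..N} \<Longrightarrow> i \<noteq> j \<Longrightarrow> S i ` U \<inter> S j ` U = {}"
    using assms(1) unfolding open_set_condition_def by meson
  from count_cut[OF this assms(2)] that show ?thesis by blast
qed

text \<open>Every neighbour of \<open>v\<close> has a point within \<open>(D + 1) * wt r v\<close>
  of one fixed point of the piece of \<open>v\<close>: \<open>D\<close> covers that piece, 1 the
  gap. The uniform packing bound then applies.\<close>

lemma osc_card_nbrs:
  assumes "open_set_condition N S"
  obtains n where "\<And>v. v \<in> words \<Longrightarrow> card (nbrs v) \<le> n"
proof -
  obtain D where D: "0 < D" "\<And>x y. x \<in> K \<Longrightarrow> y \<in> K \<Longrightarrow> dist x y \<le> D" by (rule K_bounded_by) (rule that)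
  obtain z0 where z0: "z0 \<in> K" using K_nonempty by blast
  have "0 < D + 1" using D(1) by simp
  then obtain n where n: "\<And>\<rho> x. 0 < \<rho> \<Longrightarrow> \<rho> \<le> 1 \<Longrightarrow>
      card {v \<in> cut \<rho>. \<exists>y\<in>K. dist x (sw v y) < (D + 1) * \<rho>} \<le> n"
    by (rule osc_count[OF assms]) (rule that)
  have "card (nbrs v) \<le> n" if v: "v \<in> words" for v
  proof -
    let ?\<rho> = "wt r v" and ?W = "{u \<in> cut (wt r v). \<exists>y\<in>K. dist (sw v z0) (sw u y) < (D + 1) * wt r v}"
    have \<rho>: "0 < ?\<rho>" "?\<rho> \<le> 1" using wt_r_pos[OF v] wt_r_le_1[OF v] by auto
    have "nbrs v \<subseteq> ?W"
    proof
      fix u assume "u \<in> nbrs v"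
      then obtain y z where yz: "u \<in> cut ?\<rho>" "y \<in> K" "z \<in> K" "dist (sw u y) (sw v z) < ?\<rho>"
        by (auto simp: nbrs_def)
      have "dist (sw v z0) (sw v z) \<le> ?\<rho> * D"
        unfolding dist_sw[OF v] using D(2)[OF z0 yz(3)] \<rho> by (intro mult_left_mono) auto
      then have "dist (sw v z0) (sw u y) < (D + 1) * ?\<rho>"
        using yz(4) dist_triangle[of "sw v z0" "sw u y" "sw v z"] by (simp add: dist_commute algebra_simps)
      then show "u \<in> ?W" using yz by blast
    qed
    then have "card (nbrs v) \<le> card ?W"
      using finite_cut[OF \<rho>(1)] by (intro card_mono) auto
    also have "\<dots> \<le> n" by (rule n[OF \<rho>])
    finally show ?thesis .
  qed
  then show ?thesis by (rule that)
qed

text \<open>The first letter is dropped because it only names the first level piece; the blocks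
  tested in \<open>overlap_avoids\<close> start after it.\<close>

lemma tail_avoids_sum_le:
  assumes w: "w \<in> words" and s: "0 < s" "2 * s \<le> rmin ^ Suc (k * length w)"
  shows "(\<Sum>v\<in>cut s. wt \<omega> v * of_bool (avoids w k (tl v))) \<le> (1 - wt \<omega> w) ^ k"
proof -
  have "rmin ^ Suc (k * length w) \<le> 1" using rmin by (intro power_le_one) auto
  then have "s < 1" using s by simp
  then have "(\<Sum>v\<in>cut s. wt \<omega> v * of_bool (avoids w k (tl v))) =
      (\<Sum>i=1..N. \<omega> i * (\<Sum>v\<in>cut (s / r i). wt \<omega> v * of_bool (avoids w k v)))"
    by (simp add: sum_cut[OF s(1)] sum_distrib_left mult.assoc)
  also have "\<dots> \<le> (\<Sum>i=1..N. \<omega> i * (1 - wt \<omega> w) ^ k)"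
  proof (intro sum_mono mult_left_mono)
    fix i assume i: "i \<in> {1..N}"
    show "0 \<le> \<omega> i" using \<omega>_pos[OF i] by simp
    have "s < rmin * rmin ^ (k * length w)" using s by simp
    also have "\<dots> \<le> r i * rmin ^ (k * length w)" using rmin(1) rmin(3)[OF i] by (intro mult_right_mono) auto
    finally have "s / r i < rmin ^ (k * length w)" using r_pos[OF i] by (simp add: pos_divide_less_eq mult.commute)
    then show "(\<Sum>v\<in>cut (s / r i). wt \<omega> v * of_bool (avoids w k v)) \<le> (1 - wt \<omega> w) ^ k"
      using s(1) r_pos[OF i] by (intro avoids_sum_le \<omega>_pos \<omega>_sum w) auto
  qed
  also have "\<dots> = (1 - wt \<omega> w) ^ k" by (simp only: sum_distrib_right[symmetric] \<omega>_sum mult_1_left)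
  finally show ?thesis .
qed

text \<open>Cylinders of scale \<open>s\<close> that charge a point of the overlap avoid
  \<open>w\<close>. Each is seen on a set of volume of order \<open>s ^ DIM('a)\<close> with
  \<open>p\<close>-weight to the power \<open>q\<close>, which is comparable to its
  \<open>\<omega>\<close>-weight times \<open>s powr (- \<beta>)\<close>. So
  \<open>s powr \<beta> * \<Lambda> s\<close> is bounded by the total \<open>\<omega>\<close>-weight
  of avoiding words.\<close>

theorem osc_decay:
  assumes osc: "open_set_condition N S" and q: "0 \<le> q"
  obtains C \<gamma> s0 where "0 < \<gamma>" "0 < s0" "\<And>s. 0 < s \<Longrightarrow> s \<le> s0 \<Longrightarrow> \<bar>s powr \<beta> * \<Lambda> s\<bar> \<le> C * s powr \<gamma>"
proof -
  obtain D where D: "0 < D" "\<And>x y. x \<in> K \<Longrightarrow> y \<in> K \<Longrightarrow> dist x y \<le> D" by (rule K_bounded_by) (rule that)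
  obtain z0 where z0: "z0 \<in> K" using K_nonempty by blast
  obtain n where n: "\<And>\<rho> x. 0 < \<rho> \<Longrightarrow> \<rho> \<le> 1 \<Longrightarrow> card {v \<in> cut \<rho>. \<exists>y\<in>K. dist x (sw v y) < 1 * \<rho>} \<le> n"
    by (rule osc_count[OF osc zero_less_one]) (rule that)
  obtain n1 where n1: "\<And>v. v \<in> words \<Longrightarrow> card (nbrs v) \<le> n1"
    by (rule osc_card_nbrs[OF osc]) (rule that)
  obtain w where w: "w \<in> words" "w \<noteq> []"
    "\<And>i x j y z. i # x \<in> words \<Longrightarrow> j \<in> {1..N} \<Longrightarrow> i \<noteq> j \<Longrightarrow> y \<in> K \<Longrightarrow> z \<in> K \<Longrightarrow>
       wt r (i # x @ w) \<le> dist (sw (i # x @ w) y) (S j z)"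
    using separated_word[OF n1] by blast
  have \<omega>w: "0 < wt \<omega> w" by (rule wt_pos[OF \<omega>_pos w(1)])
  \<comment> \<open>The maximum keeps \<open>\<theta>\<close> positive, so that its logarithm can
    serve in \<open>\<gamma>\<close>.\<close>
  define \<theta> where "\<theta> = max (1 - wt \<omega> w) (1 / 2)"
  have \<theta>: "0 < \<theta>" "\<theta> < 1" using \<omega>w by (auto simp: \<theta>_def)
  define a where "a = rmin ^ length w"
  have a: "0 < a" "a < 1" using rmin w(2) by (auto simp: a_def power_less_one_iff)
  define \<gamma> where "\<gamma> = ln \<theta> / ln a"
  have \<gamma>: "0 < \<gamma>" using a \<theta> by (simp add: \<gamma>_def zero_less_divide_iff)
  define c where "c = rmin powr (- \<bar>- \<beta>\<bar>)"
  define u where "u = unit_ball_vol DIM('a) * (1 + D) ^ DIM('a)"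
  define A where "A = real (N + 1) * (real n powr q * (c * u))"
  have u: "0 \<le> u" using D by (simp add: u_def)
  have A: "0 \<le> A" using u by (simp add: A_def c_def)
  have main: "\<bar>s powr \<beta> * \<Lambda> s\<bar> \<le> A * (2 / rmin) powr \<gamma> / \<theta> * s powr \<gamma>" if s: "0 < s" "s \<le> rmin / 2" for s
  proof -
    have s1: "s < 1" "s \<le> rmin" using s rmin by auto
    obtain k where k: "2 * s / rmin \<le> a ^ k" "\<theta> ^ k \<le> (2 * s / rmin) powr \<gamma> / \<theta>"
      using geometric_scale[OF a \<theta>, of "2 * s / rmin"] s rmin(1) by (auto simp: \<gamma>_def)
    have k': "2 * s \<le> rmin ^ Suc (k * length w)"
      using k(1) rmin(1) by (simp add: a_def power_mult[symmetric] pos_divide_le_eq mult.commute)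
    define b where "b v = of_bool (avoids w k (tl v)) * wt p v powr q" for v
    \<comment> \<open>Contains every point within \<open>s\<close> of the cylinder of
      \<open>v\<close>, whose diameter is at most \<open>s * D\<close>.\<close>
    define B where "B v = cball (sw v z0) (s * (1 + D))" for v
    have vol: "(LINT x|lborel. indicator (B v) x) = s ^ DIM('a) * u" for v
      using s D by (simp add: B_def u_def content_cball power_mult_distrib)
    have intB: "integrable lborel (indicator (B v) :: 'a \<Rightarrow> real)" for v
      unfolding B_def by (rule integrable_real_indicator) (use emeasure_bounded_finite[OF bounded_cball] in auto)
    define G where "G x = real n powr q * (\<Sum>v\<in>cut s. b v * indicator (B v) x)" for x
    have "\<bar>s ^ DIM('a) * \<Lambda> s\<bar> \<le> real (N + 1) * (LINT x|lborel. G x)"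
    proof (rule \<Lambda>_le_overlap[OF q s(1) s1(2)])
      show "integrable lborel G"
        unfolding G_def using intB by (intro integrable_mult_right Bochner_Integration.integrable_sum) auto
      show "0 \<le> G x" for x by (auto simp: G_def b_def intro!: mult_nonneg_nonneg sum_nonneg)
      fix x assume x: "x \<in> overlap s"
      have "bm s x powr q \<le> real n powr q * (\<Sum>v\<in>cut s. wt p v powr q * of_bool (\<exists>y\<in>K. dist x (sw v y) < s))"
        using n[of s x] s s1 by (intro bm_powr_le_cut[OF q]) auto
      also have "\<dots> \<le> G x"
        unfolding G_def
      proof (intro mult_left_mono sum_mono)
        fix v assume v: "v \<in> cut s"
        show "wt p v powr q * of_bool (\<exists>y\<in>K. dist x (sw v y) < s) \<le> b v * indicator (B v) x"
        proof (cases "\<exists>y\<in>K. dist x (sw v y) < s")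
          case True
          then obtain y where y: "y \<in> K" "dist x (sw v y) < s" by blast
          have vw: "v \<in> words" using v by (rule cut_words)
          obtain i v' where v': "v = i # v'" using v s1(1) by (cases v) (auto simp: cut_def)
          have "avoids w k v'"
            using overlap_avoids[OF w(1) w(3) k' _ x y(1)] vw y(2) by (simp add: v')
          moreover have "dist (sw v y) (sw v z0) \<le> s * D"
            unfolding dist_sw[OF vw] using D y(1) z0 v s(1) by (intro mult_mono) (auto simp: cut_def)
          then have "x \<in> B v"
            using y(2) dist_triangle[of "sw v z0" x "sw v y"] by (simp add: B_def dist_commute algebra_simps)
          ultimately show ?thesis by (simp add: b_def v')
        next
          case False
          then have e: "of_bool (\<exists>y\<in>K. dist x (sw v y) < s) = (0::real)" by simp
          show ?thesis unfolding e by (simp add: b_def)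
        qed
      qed simp
      finally show "bm s x powr q \<le> G x" .
    qed
    also have "(LINT x|lborel. G x) = real n powr q * (\<Sum>v\<in>cut s. b v * (LINT x|lborel. indicator (B v) x))"
      unfolding G_def using intB by (simp add: Bochner_Integration.integral_sum)
    also have "\<dots> = real n powr q * ((\<Sum>v\<in>cut s. b v) * (s ^ DIM('a) * u))"
      by (simp only: vol sum_distrib_right)
    also have "real (N + 1) * (real n powr q * ((\<Sum>v\<in>cut s. b v) * (s ^ DIM('a) * u))) \<le>
       real (N + 1) * (real n powr q * ((c * s powr (- \<beta>) * \<theta> ^ k) * (s ^ DIM('a) * u)))"
    proof (intro mult_left_mono mult_right_mono)
      \<comment> \<open>The \<open>p\<close>-weight to the power \<open>q\<close> is the
        \<open>\<omega>\<close>-weight times the ratio to the power \<open>- \<beta>\<close>; on the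
        stopping set that ratio lies between \<open>rmin * s\<close> and \<open>s\<close>.\<close>
      have "(\<Sum>v\<in>cut s. b v) \<le> (\<Sum>v\<in>cut s. c * s powr (- \<beta>) * (wt \<omega> v * of_bool (avoids w k (tl v))))"
      proof (rule sum_mono)
        fix v assume v: "v \<in> cut s"
        have vw: "v \<in> words" using v by (rule cut_words)
        have "wt p v powr q = wt \<omega> v * wt r v powr (- \<beta>)"
          using wt_r_pos[OF vw] by (simp add: wt_\<omega>[OF vw] powr_minus)
        also have "\<dots> \<le> wt \<omega> v * (c * s powr (- \<beta>))"
        proof (rule mult_left_mono)
          show "wt r v powr - \<beta> \<le> c * s powr - \<beta>"
            unfolding c_def using cut_ge[OF v] s1 v by (intro powr_comparable[OF s(1)]) (auto simp: cut_def)
          show "0 \<le> wt \<omega> v" using wt_pos[of \<omega> v] \<omega>_pos vw by (simp add: less_imp_le)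
        qed
        finally show "b v \<le> c * s powr (- \<beta>) * (wt \<omega> v * of_bool (avoids w k (tl v)))"
          by (auto simp: b_def mult.commute)
      qed
      also have "\<dots> = c * s powr (- \<beta>) * (\<Sum>v\<in>cut s. wt \<omega> v * of_bool (avoids w k (tl v)))"
        by (simp only: sum_distrib_left)
      also have "\<dots> \<le> c * s powr (- \<beta>) * \<theta> ^ k"
      proof (rule mult_left_mono)
        have "(1 - wt \<omega> w) ^ k \<le> \<theta> ^ k"
          using wt_le_1[OF \<omega>_pos \<omega>_sum w(1)] by (intro power_mono) (auto simp: \<theta>_def)
        then show "(\<Sum>v\<in>cut s. wt \<omega> v * of_bool (avoids w k (tl v))) \<le> \<theta> ^ k"
          using tail_avoids_sum_le[OF w(1) s(1) k'] by simp
      qed (simp add: c_def)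
      finally show "(\<Sum>v\<in>cut s. b v) \<le> c * s powr (- \<beta>) * \<theta> ^ k" .
    qed (use s u in auto)
    also have "\<dots> = s ^ DIM('a) * (A * \<theta> ^ k * s powr (- \<beta>))"
      by (simp only: A_def mult.assoc mult.commute mult.left_commute)
    finally have "s ^ DIM('a) * \<bar>\<Lambda> s\<bar> \<le> s ^ DIM('a) * (A * \<theta> ^ k * s powr (- \<beta>))"
      using s by (simp add: abs_mult)
    then have "\<bar>\<Lambda> s\<bar> \<le> A * \<theta> ^ k * s powr (- \<beta>)" using s by (simp only: mult_le_cancel_left_pos zero_less_power)
    then have "s powr \<beta> * \<bar>\<Lambda> s\<bar> \<le> s powr \<beta> * (A * \<theta> ^ k * s powr (- \<beta>))" by (rule mult_left_mono) simp
    also have "\<dots> = A * \<theta> ^ k" using s by (simp add: powr_minus)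
    also have "\<dots> \<le> A * ((2 * s / rmin) powr \<gamma> / \<theta>)" using k(2) A by (intro mult_left_mono)
    also have "(2 * s / rmin) powr \<gamma> = (2 / rmin) powr \<gamma> * s powr \<gamma>"
      using s rmin(1) by (subst powr_mult[symmetric]) auto
    finally show ?thesis by (simp add: abs_mult)
  qed
  show ?thesis
  proof (rule that[OF \<gamma>])
    show "0 < rmin / 2" using rmin by simp
  qed (rule main)
qed

section \<open>Strong separation\<close>

lemma K_subset_closure:
  assumes U: "U \<noteq> {}" "bounded U" "(\<Union>i\<in>{1..N}. S i ` U) \<subseteq> U"
  shows "K \<subseteq> closure U"
proof
  fix x assume x: "x \<in> K"
  obtain z where z: "z \<in> U" using U(1) by blast
  have "bounded (insert z K)" using compact_imp_bounded[OF compact_K] by simp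
  then obtain M where M: "\<And>y. y \<in> K \<Longrightarrow> dist y z \<le> M" by (auto simp: bounded_two_points)
  have M0: "0 \<le> M" using M[OF x] zero_le_dist order_trans by blast
  show "x \<in> closure U"
    unfolding closure_approachable
  proof (intro allI impI)
    fix e :: real assume e: "0 < e"
    \<comment> \<open>At this scale the image of \<open>z\<close> under a cylinder map lies within
      \<open>\<rho> * M < e\<close> of the given point of that cylinder.\<close>
    define \<rho> where "\<rho> = e / (M + 1)"
    have \<rho>: "0 < \<rho>" using e M0 by (simp add: \<rho>_def)
    obtain v y where v: "v \<in> cut \<rho>" "y \<in> K" "x = sw v y" using cut_cover[OF \<rho> x] by blast
    have vw: "v \<in> words" using v(1) by (rule cut_words)
    have "sw v z \<in> U" by (rule sw_in_invariant[OF U(3) vw z])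
    moreover have "dist (sw v z) x < e"
    proof -
      have "dist (sw v z) x = wt r v * dist y z" using dist_sw[OF vw, of z y] by (simp add: v(3) dist_commute)
      also have "\<dots> \<le> \<rho> * M" using v(1) M[OF v(2)] \<rho> M0 by (intro mult_mono) (auto simp: cut_def)
      also have "\<dots> < e" using e M0 by (simp add: \<rho>_def field_simps)
      finally show ?thesis .
    qed
    ultimately show "\<exists>y\<in>U. dist y x < e" by blast
  qed
qed

text \<open>The first level pieces of \<open>K\<close> lie in disjoint closures, so being compact
  they have a positive minimal distance; a ball of radius at most half of it meets only one
  piece.\<close>

lemma ssc_no_overlap:
  assumes "strong_separation_condition N S"
  obtains s0 where "0 < s0" "\<And>s. s \<le> s0 \<Longrightarrow> overlap s = {}"
proof -
  obtain U where U: "open U" "U \<noteq> {}" "bounded U" "(\<Union>i\<in>{1..N}. S i ` U) \<subseteq> U"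
    "\<And>i j. i \<in> {1..N} \<Longrightarrow> j \<in> {1..N} \<Longrightarrow> i \<noteq> j \<Longrightarrow> closure (S i ` U) \<inter> closure (S j ` U) = {}"
    using assms unfolding strong_separation_condition_def by meson
  have sub: "S i ` K \<subseteq> closure (S i ` U)" if i: "i \<in> {1..N}" for i
  proof -
    have "S i ` closure U \<subseteq> closure (S i ` U)"
      by (rule image_closure_subset[OF similarity_continuous[OF sim[OF i]] closed_closure closure_subset])
    then show ?thesis using K_subset_closure[OF U(2,3,4)] by blast
  qed
  define P where "P = {(i, j). i \<in> {1..N} \<and> j \<in> {1..N} \<and> i \<noteq> j}"
  have finP: "finite P" by (rule finite_subset[of _ "{1..N} \<times> {1..N}"]) (auto simp: P_def)
  have "\<exists>e>0. \<forall>x\<in>S (fst a) ` K. \<forall>y\<in>S (snd a) ` K. e \<le> dist x y" if "a \<in> P" for a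
  proof (rule separate_compact_closed)
    have ij: "fst a \<in> {1..N}" "snd a \<in> {1..N}" "fst a \<noteq> snd a" using that by (auto simp: P_def)
    show "compact (S (fst a) ` K)"
      by (rule compact_continuous_image[OF similarity_continuous[OF sim[OF ij(1)]] compact_K])
    show "closed (S (snd a) ` K)"
      by (rule compact_imp_closed[OF compact_continuous_image[OF similarity_continuous[OF sim[OF ij(2)]] compact_K]])
    show "S (fst a) ` K \<inter> S (snd a) ` K = {}"
      using sub[OF ij(1)] sub[OF ij(2)] U(5)[OF ij] by blast
  qed
  then obtain e where e: "\<And>a. a \<in> P \<Longrightarrow> 0 < e a"
    "\<And>a x y. a \<in> P \<Longrightarrow> x \<in> S (fst a) ` K \<Longrightarrow> y \<in> S (snd a) ` K \<Longrightarrow> e a \<le> dist x y" by metis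
  define \<delta> where "\<delta> = Min (insert 1 (e ` P))"
  have \<delta>: "0 < \<delta>" "\<And>a. a \<in> P \<Longrightarrow> \<delta> \<le> e a"
    unfolding \<delta>_def using finP e(1) by auto
  have "overlap s = {}" if s: "s \<le> \<delta> / 2" for s
  proof (rule ccontr)
    assume "overlap s \<noteq> {}"
    then obtain x i j where ij: "i \<in> {1..N}" "j \<in> {1..N}" "i \<noteq> j" "0 < child i s x" "0 < child j s x"
      unfolding overlap_def by blast
    obtain y where y: "y \<in> K" "dist x (S i y) < s" using ij child_pos_iff by blast
    obtain z where z: "z \<in> K" "dist x (S j z) < s" using ij child_pos_iff by blast
    have a: "(i, j) \<in> P" using ij by (simp add: P_def)
    have "\<delta> \<le> dist (S i y) (S j z)"
      using \<delta>(2)[OF a] e(2)[OF a, of "S i y" "S j z"] y z by simp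
    also have "\<dots> < s + s" using y(2) z(2) dist_triangle2[of "S i y" "S j z" x] by (simp add: dist_commute)
    finally show False using s by simp
  qed
  then show ?thesis using \<delta>(1) by (intro that[of "\<delta> / 2"]) auto
qed

lemma nn_integral_children:
  "(\<integral>\<^sup>+x. ennreal (\<Sum>i=1..N. child i s x powr q) \<partial>lborel) = (\<Sum>i=1..N. ennreal (p i powr q * r i ^ DIM('a)) * I (s / r i))"
proof -
  have "(\<integral>\<^sup>+x. ennreal (\<Sum>i=1..N. child i s x powr q) \<partial>lborel) = (\<integral>\<^sup>+x. (\<Sum>i=1..N. ennreal (child i s x powr q)) \<partial>lborel)"
    by (intro nn_integral_cong) (simp add: sum_ennreal)
  also have "\<dots> = (\<Sum>i=1..N. (\<integral>\<^sup>+x. ennreal (child i s x powr q) \<partial>lborel))"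
    by (intro nn_integral_sum) auto
  also have "\<dots> = (\<Sum>i=1..N. ennreal (p i powr q * r i ^ DIM('a)) * I (s / r i))"
    using nn_integral_child by (intro sum.cong refl) (simp add: child_def)
  finally show ?thesis .
qed

text \<open>For negative exponents a single positive child already dominates, since the ball has at
  least its mass. Points without a positive child contribute 0 on both sides.\<close>

lemma I_le_children:
  assumes "q \<le> 0"
  shows "I s \<le> (\<Sum>i=1..N. ennreal (p i powr q * r i ^ DIM('a)) * I (s / r i))"
proof -
  have "bm s x powr q \<le> (\<Sum>i=1..N. child i s x powr q)" for x
  proof (cases "\<exists>i\<in>{1..N}. 0 < child i s x")
    case True
    then obtain i where i: "i \<in> {1..N}" "0 < child i s x" by blast
    have "bm s x powr q \<le> child i s x powr q"
      using assms i bm_child_le[OF i(1), of s x] by (intro powr_mono2') (auto simp: child_def)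
    also have "\<dots> \<le> (\<Sum>i=1..N. child i s x powr q)" by (rule member_le_sum[OF i(1)]) auto
    finally show ?thesis .
  next
    case False
    then have zero: "child j s x = 0" if "j \<in> {1..N}" for j using that child_nonneg[OF that, of s x] by force
    then show ?thesis unfolding bm_children by simp
  qed
  then have "I s \<le> (\<integral>\<^sup>+x. ennreal (\<Sum>i=1..N. child i s x powr q) \<partial>lborel)"
    unfolding I_def by (intro nn_integral_mono ennreal_leI)
  then show ?thesis by (simp only: nn_integral_children)
qed

text \<open>Finiteness passes to larger radii by \<open>I_antimono\<close> and to smaller ones by
  \<open>I_le_children\<close>, one level of the construction at a time.\<close>

lemma I_finite_everywhere:
  assumes q: "q \<le> 0" and s: "0 < s" "I s < \<infinity>" and t: "0 < t"
  shows "I t < \<infinity>"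
proof -
  have "I t < \<infinity>" if "s * rmax ^ n \<le> t" for n t
    using that
  proof (induction n arbitrary: t)
    case 0
    then have st: "s \<le> t" by simp
    have "I t \<le> ennreal ((t / s) ^ DIM('a)) * I s" by (rule I_antimono[OF q s(1) st])
    also have "\<dots> < \<infinity>" using s(2) by (simp add: ennreal_mult_less_top)
    finally show ?case .
  next
    case (Suc n)
    have "I (t / r i) < \<infinity>" if i: "i \<in> {1..N}" for i
    proof (rule Suc.IH)
      have "s * rmax ^ n * r i \<le> s * rmax ^ n * rmax"
        using s(1) rmax(1) rmax(3)[OF i] by (intro mult_left_mono) auto
      then show "s * rmax ^ n \<le> t / r i" using Suc.prems r_pos[OF i] by (simp add: pos_le_divide_eq mult.commute mult.left_commute)
    qed
    then have "(\<Sum>i=1..N. ennreal (p i powr q * r i ^ DIM('a)) * I (t / r i)) < \<infinity>"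
      by (simp add: ennreal_mult_less_top)
    then show ?case using I_le_children[OF q, of t] by (rule le_less_trans[rotated])
  qed
  note far = this
  obtain n where "rmax ^ n < t / s"
    using real_arch_pow_inv[of "t / s" rmax] rmax s(1) t by auto
  then have "s * rmax ^ n \<le> t" using s(1) by (simp add: field_simps)
  then show ?thesis by (rule far)
qed

text \<open>Without overlaps the self-similarity relation for \<open>I\<close> is exact. Finiteness
  does not depend on the scale, so either \<open>enn2real\<close> distributes over the sum or it
  sends every term to 0; both make the defect vanish.\<close>

lemma ssc_vanishing:
  assumes ssc: "strong_separation_condition N S" and q: "q \<le> 0"
  obtains s0 where "0 < s0" "\<And>s. 0 < s \<Longrightarrow> s \<le> s0 \<Longrightarrow> \<Lambda> s = 0"
proof -
  obtain s1 where s1: "0 < s1" "\<And>s. s \<le> s1 \<Longrightarrow> overlap s = {}" using ssc_no_overlap[OF ssc] by blast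
  have "\<Lambda> s = 0" if s: "0 < s" "s \<le> min s1 rmin" for s
  proof -
    have "I s = (\<integral>\<^sup>+x. ennreal (\<Sum>i=1..N. child i s x powr q) \<partial>lborel)"
      unfolding I_def using s s1(2)[of s] by (intro nn_integral_cong) (simp add: no_overlap)
    then have split: "I s = (\<Sum>i=1..N. ennreal (p i powr q * r i ^ DIM('a)) * I (s / r i))"
      by (simp only: nn_integral_children)
    have "enn2real (I s) = (\<Sum>i=1..N. p i powr q * r i ^ DIM('a) * enn2real (I (s / r i)))"
    proof (cases "I s < \<infinity>")
      case True
      have "I (s / r i) < top" if "i \<in> {1..N}" for i
        using I_finite_everywhere[OF q s(1) True, of "s / r i"] s(1) r_pos[OF that] by simp
      then have "enn2real (I s) = (\<Sum>i=1..N. enn2real (ennreal (p i powr q * r i ^ DIM('a)) * I (s / r i)))"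
        by (subst split, subst enn2real_sum) (auto simp: ennreal_mult_less_top o_def)
      also have "\<dots> = (\<Sum>i=1..N. p i powr q * r i ^ DIM('a) * enn2real (I (s / r i)))"
      proof (rule sum.cong[OF refl])
        fix i assume "i \<in> {1..N}"
        then have "0 \<le> p i powr q * r i ^ DIM('a)" using r_pos[of i] by simp
        then show "enn2real (ennreal (p i powr q * r i ^ DIM('a)) * I (s / r i)) = p i powr q * r i ^ DIM('a) * enn2real (I (s / r i))"
          by (simp add: enn2real_mult)
      qed
      finally show ?thesis .
    next
      case False
      have "I (s / r i) = top" if "i \<in> {1..N}" for i
      proof (rule ccontr)
        assume "I (s / r i) \<noteq> top"
        then have "I (s / r i) < \<infinity>" by (simp add: less_top)
        then have "I s < \<infinity>" using s(1) r_pos[OF that] by (intro I_finite_everywhere[OF q _ _ s(1)]) auto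
        then show False using False by simp
      qed
      moreover have "I s = top" using False by (simp add: less_top[symmetric])
      ultimately show ?thesis by simp
    qed
    then have "s ^ DIM('a) * \<Lambda> s = 0" using s by (simp add: \<Lambda>_eq)
    then show ?thesis using s by simp
  qed
  then show ?thesis using s1(1) rmin(1) by (intro that[of "min s1 rmin"]) auto
qed

text \<open>For \<open>q \<ge> 0\<close> ball masses grow with the radius, so the integral without
  normalisation increases. For \<open>q < 0\<close> the pulling argument behind
  \<open>I_antimono\<close> shows that the normalised volume decreases, also when infinite values
  default to 0.\<close>

lemma V_monotone:
  "(\<forall>s t. 0 < s \<longrightarrow> s \<le> t \<longrightarrow> s ^ DIM('a) * V s \<le> t ^ DIM('a) * V t) \<or>
   (\<forall>s t. 0 < s \<longrightarrow> s \<le> t \<longrightarrow> V t \<le> V s)"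
proof (cases "0 \<le> q")
  case True
  have "s ^ DIM('a) * V s \<le> t ^ DIM('a) * V t" if "0 < s" "s \<le> t" for s t
  proof -
    have "enn2real (I s) \<le> enn2real (I t)"
      using I_mono[OF True that(2)] I_finite[OF True, of t] by (intro enn2real_mono) auto
    then show ?thesis using that by (simp add: volume_eq)
  qed
  then show ?thesis by blast
next
  case False
  then have q: "q \<le> 0" by simp
  have "V t \<le> V s" if st: "0 < s" "s \<le> t" for s t
  proof (cases "I s < \<infinity>")
    case True
    have "enn2real (I t) \<le> enn2real (ennreal ((t / s) ^ DIM('a)) * I s)"
      using I_antimono[OF q st] True by (intro enn2real_mono) (auto simp: ennreal_mult_less_top)
    also have "\<dots> = (t / s) ^ DIM('a) * enn2real (I s)" using st by (simp add: enn2real_mult)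
    finally show ?thesis using st by (simp add: volume_eq power_divide field_simps)
  next
    case False
    then have "\<not> I t < \<infinity>" using I_finite_everywhere[OF q, of t s] st by auto
    then have "I t = top" by (simp add: less_top[symmetric])
    then show ?thesis using st by (simp add: volume_eq)
  qed
  then show ?thesis by blast
qed

lemma V_nonneg: "0 < s \<Longrightarrow> 0 \<le> V s"
  by (simp add: volume_eq)

text \<open>Sets with disjoint closures are disjoint, so strong separation with
  \<open>q \<ge> 0\<close> is a case of the open set condition. For \<open>q < 0\<close> the error
  is zero at small scales.\<close>

lemma \<Lambda>_decay:
  assumes cond: "(open_set_condition N S \<and> 0 \<le> q) \<or> strong_separation_condition N S"
  obtains C \<gamma> s0 where "0 < \<gamma>" "0 < s0" "\<And>s. 0 < s \<Longrightarrow> s \<le> s0 \<Longrightarrow> \<bar>s powr \<beta> * \<Lambda> s\<bar> \<le> C * s powr \<gamma>"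
proof (cases "0 \<le> q")
  case True
  have "open_set_condition N S" if ssc: "strong_separation_condition N S"
  proof -
    obtain U where U: "open U" "U \<noteq> {}" "bounded U" "(\<Union>i\<in>{1..N}. S i ` U) \<subseteq> U"
      "\<And>i j. i \<in> {1..N} \<Longrightarrow> j \<in> {1..N} \<Longrightarrow> i \<noteq> j \<Longrightarrow> closure (S i ` U) \<inter> closure (S j ` U) = {}"
      using ssc unfolding strong_separation_condition_def by meson
    have "S i ` U \<inter> S j ` U = {}" if "i \<in> {1..N}" "j \<in> {1..N}" "i \<noteq> j" for i j
      using U(5)[OF that] closure_subset[of "S i ` U"] closure_subset[of "S j ` U"] by blast
    then show ?thesis unfolding open_set_condition_def
      by (intro exI[of _ U] conjI U ballI impI)
  qed
  then have "open_set_condition N S" using cond by blast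
  then show ?thesis using osc_decay[OF _ True] that by blast
next
  case False
  then obtain s0 where "0 < s0" "\<And>s. 0 < s \<Longrightarrow> s \<le> s0 \<Longrightarrow> \<Lambda> s = 0"
    using ssc_vanishing cond by (metis less_imp_le not_le)
  then show ?thesis by (intro that[of 1 s0 0]) auto
qed

end

section \<open>Multifractal Minkowski content\<close>

text \<open>The substitution \<open>s = exp (- t)\<close> turns \<open>ds / s\<close> into
  \<open>dt\<close>. It is carried out for the completed measure; Borel measurability brings the
  result back to \<open>lborel\<close>.\<close>

lemma exp_substitution:
  fixes f :: "real \<Rightarrow> real"
  assumes A: "A \<in> sets borel" and B: "B \<in> sets borel" "B = (\<lambda>t. exp (- t)) ` A"
    and f [measurable]: "f \<in> borel_measurable borel" and int: "set_integrable lborel A f"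
  shows "set_integrable lborel B (\<lambda>s. f (- ln s) / s)"
    and "(LINT s:B|lborel. f (- ln s) / s) = (LINT t:A|lborel. f t)"
proof -
  define h where "h s = f (- ln s) / s" for s
  have [measurable]: "h \<in> borel_measurable borel" unfolding h_def by measurable
  have A' [measurable]: "A \<in> sets borel" and B' [measurable]: "B \<in> sets borel" using A B by auto
  have fA: "f absolutely_integrable_on A" "integral A f = (LINT t:A|lborel. f t)"
  proof -
    show "f absolutely_integrable_on A"
      using int unfolding set_integrable_def by (simp add: integrable_completion)
    then show "integral A f = (LINT t:A|lborel. f t)"
      using set_lebesgue_integral_eq_integral(2)[of A f]
      unfolding set_lebesgue_integral_def by (simp add: integral_completion)
  qed
  have "(\<lambda>x. \<bar>- exp (- x)\<bar> * h (exp (- x))) absolutely_integrable_on A \<and>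
      integral A (\<lambda>x. \<bar>- exp (- x)\<bar> * h (exp (- x))) = integral A f \<longleftrightarrow>
      h absolutely_integrable_on (\<lambda>t. exp (- t)) ` A \<and> integral ((\<lambda>t. exp (- t)) ` A) h = integral A f"
  proof (rule has_absolute_integral_change_of_variables_1')
    show "A \<in> sets lebesgue" using A by simp
    show "((\<lambda>t. exp (- t)) has_real_derivative - exp (- x)) (at x within A)" for x
      by (auto intro!: derivative_eq_intros)
    show "inj_on (\<lambda>t::real. exp (- t)) A" by (auto simp: inj_on_def)
  qed
  moreover have "(\<lambda>x. \<bar>- exp (- x)\<bar> * h (exp (- x))) = f" by (simp add: h_def)
  ultimately have hB: "h absolutely_integrable_on B" "integral B h = (LINT t:A|lborel. f t)"
    using fA B(2) by auto
  then show "set_integrable lborel B (\<lambda>s. f (- ln s) / s)"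
    unfolding set_integrable_def by (simp add: integrable_completion h_def[abs_def])
  show "(LINT s:B|lborel. f (- ln s) / s) = (LINT t:A|lborel. f t)"
    using set_lebesgue_integral_eq_integral(2)[OF hB(1)] hB(2)
    unfolding set_lebesgue_integral_def by (simp add: integral_completion h_def[abs_def])
qed

lemma filterlim_neg_ln: "filterlim (\<lambda>s::real. - ln s) at_top (at_right 0)"
  by real_asymp

context self_similar
begin

definition \<tau> :: "nat \<Rightarrow> real" where "\<tau> i = ln (inverse (r i))"

definition F :: "real \<Rightarrow> real" where
  "F t = (if t < 0 then 0 else exp (- \<beta> * t) * V (exp (- t)))"

definition g :: "real \<Rightarrow> real" where
  "g t = F t - (\<Sum>i=1..N. \<omega> i * F (t - \<tau> i))"

lemma \<tau>_eq: "i \<in> {1..N} \<Longrightarrow> \<tau> i = - ln (r i)"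
  using r_pos by (simp add: \<tau>_def ln_inverse)

lemma \<tau>_gt_0: "i \<in> {1..N} \<Longrightarrow> 0 < \<tau> i"
  using r[of i] by (simp add: \<tau>_eq)

lemma F_ln: "0 < s \<Longrightarrow> s \<le> 1 \<Longrightarrow> F (- ln s) = s powr \<beta> * V s"
  by (simp add: F_def powr_def)

text \<open>The indicator of \<open>{0<..r i}\<close> says that the rescaled radius
  \<open>s / r i\<close> is at most 1, that is, that \<open>- ln s - \<tau> i\<close> is not
  negative. Elsewhere the truncated \<open>F\<close> is 0.\<close>

lemma g_ln:
  assumes "0 < s" "s \<le> 1"
  shows "g (- ln s) = s powr \<beta> * \<Lambda> s"
proof -
  have "\<omega> i * F (- ln s - \<tau> i) = s powr \<beta> * (p i powr q * indicator {0<..r i} s * V (inverse (r i) * s))"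
    if i: "i \<in> {1..N}" for i
  proof (cases "s \<le> r i")
    case True
    have "- ln s - \<tau> i = - ln (inverse (r i) * s)"
      using assms r_pos[OF i] by (simp add: \<tau>_eq[OF i] ln_mult ln_inverse)
    moreover have "0 < inverse (r i) * s" "inverse (r i) * s \<le> 1"
      using assms True r_pos[OF i] by (simp_all add: inverse_eq_divide)
    ultimately have "F (- ln s - \<tau> i) = (inverse (r i) * s) powr \<beta> * V (inverse (r i) * s)"
      by (simp only: F_ln)
    also have "(inverse (r i) * s) powr \<beta> = s powr \<beta> / r i powr \<beta>"
      using assms r_pos[OF i] by (simp add: powr_mult inverse_eq_divide powr_divide)
    finally show ?thesis using assms True r_pos[OF i] by (simp add: \<omega>_def)
  next
    case False
    then have "ln (r i) < ln s" using assms r_pos[OF i] by simp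
    then have "F (- ln s - \<tau> i) = 0" by (simp add: F_def \<tau>_eq[OF i])
    then show ?thesis using False by simp
  qed
  then have "(\<Sum>i=1..N. \<omega> i * F (- ln s - \<tau> i)) =
      s powr \<beta> * (\<Sum>i=1..N. p i powr q * indicator {0<..r i} s * V (inverse (r i) * s))"
    by (simp add: sum_distrib_left)
  then show ?thesis
    unfolding g_def F_ln[OF assms] mf_lambda_def by (simp add: right_diff_distrib)
qed

lemma F_nonneg: "0 \<le> F t"
  using V_nonneg by (simp add: F_def)

text \<open>Measurability comes from monotonicity, after removing the factor
  \<open>s ^ DIM('a)\<close> where necessary; no continuity in the radius is involved.\<close>

lemma V_exp_meas: "(\<lambda>t. V (exp (- t))) \<in> borel_measurable borel"
  using V_monotone
proof
  assume m: "\<forall>s t. 0 < s \<longrightarrow> s \<le> t \<longrightarrow> s ^ DIM('a) * V s \<le> t ^ DIM('a) * V t"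
  have "mono (\<lambda>t. exp t ^ DIM('a) * V (exp t))" using m by (auto intro!: monoI)
  then have [measurable]: "(\<lambda>t. exp t ^ DIM('a) * V (exp t)) \<in> borel_measurable borel"
    by (rule borel_measurable_mono)
  have "(\<lambda>t. exp (- t) ^ DIM('a) * V (exp (- t)) / exp (- t) ^ DIM('a)) \<in> borel_measurable borel"
    using measurable_compose[OF _ \<open>(\<lambda>t. exp t ^ DIM('a) * V (exp t)) \<in> borel_measurable borel\<close>, of uminus borel]
    by (intro borel_measurable_divide) auto
  then show ?thesis by simp
next
  assume m: "\<forall>s t. 0 < s \<longrightarrow> s \<le> t \<longrightarrow> V t \<le> V s"
  have "mono (\<lambda>t. V (exp (- t)))" using m by (auto intro!: monoI)
  then show ?thesis by (rule borel_measurable_mono)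
qed

lemma F_borel: "F \<in> borel_measurable borel"
proof -
  have [measurable]: "(\<lambda>t. V (exp (- t))) \<in> borel_measurable borel" by (rule V_exp_meas)
  show ?thesis unfolding F_def[abs_def] by measurable
qed

text \<open>Monotonicity of \<open>V\<close>, or of \<open>s ^ DIM('a) * V s\<close>, becomes
  one-sided exponential growth of \<open>F\<close>. The rate only has to absorb the factors
  \<open>s powr \<beta>\<close> and \<open>s ^ DIM('a)\<close>, whence
  \<open>\<bar>\<beta>\<bar> + DIM('a)\<close>.\<close>

lemma F_growth:
  obtains a where "0 \<le> a"
    "(\<forall>s t. 0 \<le> s \<longrightarrow> s \<le> t \<longrightarrow> F t \<le> exp (a * (t - s)) * F s) \<or>
     (\<forall>s t. 0 \<le> s \<longrightarrow> s \<le> t \<longrightarrow> F s \<le> exp (a * (t - s)) * F t)"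
proof -
  define a where "a = \<bar>\<beta>\<bar> + real DIM('a)"
  have a: "0 \<le> a" by (simp add: a_def)
  have grow: "x \<le> exp (a * (t - s)) * F y" if "x = exp (b * (t - s)) * F y" "b \<le> a" "s \<le> t" for b s t x y
    unfolding that(1) using that F_nonneg by (intro mult_right_mono) (auto intro: mult_right_mono)
  from V_monotone show ?thesis
  proof
    assume m: "\<forall>s t. 0 < s \<longrightarrow> s \<le> t \<longrightarrow> s ^ DIM('a) * V s \<le> t ^ DIM('a) * V t"
    let ?d = "real DIM('a)"
    have F: "F t = exp ((?d - \<beta>) * t) * (exp (- t) ^ DIM('a) * V (exp (- t)))" if "0 \<le> t" for t
      using that by (simp add: F_def algebra_simps flip: exp_of_nat_mult exp_add mult.assoc)
    have "F t \<le> exp (a * (t - s)) * F s" if st: "0 \<le> s" "s \<le> t" for s t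
    proof -
      have "F t \<le> exp ((?d - \<beta>) * t) * (exp (- s) ^ DIM('a) * V (exp (- s)))"
        using m st by (simp add: F)
      also have "\<dots> \<le> exp (a * (t - s)) * F s"
        using st by (intro grow[of _ "?d - \<beta>"])
          (auto simp: F a_def algebra_simps simp flip: exp_add mult.assoc)
      finally show ?thesis .
    qed
    then show ?thesis using that[OF a] by blast
  next
    assume m: "\<forall>s t. 0 < s \<longrightarrow> s \<le> t \<longrightarrow> V t \<le> V s"
    have "F s \<le> exp (a * (t - s)) * F t" if st: "0 \<le> s" "s \<le> t" for s t
    proof -
      have "F s \<le> exp (- \<beta> * s) * V (exp (- t))"
        using m st by (simp add: F_def)
      also have "\<dots> \<le> exp (a * (t - s)) * F t"
        using st by (intro grow[of _ \<beta>])
          (auto simp: F_def a_def algebra_simps simp flip: exp_add mult.assoc)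
      finally show ?thesis .
    qed
    then show ?thesis using that[OF a] by blast
  qed
qed

lemma g_decay:
  assumes cond: "(open_set_condition N S \<and> 0 \<le> q) \<or> strong_separation_condition N S"
  obtains C \<gamma> where "0 < \<gamma>" "\<forall>t\<ge>0. \<bar>g t\<bar> \<le> C * exp (- \<gamma> * t)"
proof -
  obtain C \<gamma> s0 where *: "0 < \<gamma>" "0 < s0"
    "\<And>s. 0 < s \<Longrightarrow> s \<le> s0 \<Longrightarrow> \<bar>s powr \<beta> * \<Lambda> s\<bar> \<le> C * s powr \<gamma>"
    by (rule \<Lambda>_decay[OF cond]) (rule that)
  obtain a where a: "0 \<le> a"
    "(\<forall>s t. 0 \<le> s \<longrightarrow> s \<le> t \<longrightarrow> F t \<le> exp (a * (t - s)) * F s) \<or>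
     (\<forall>s t. 0 \<le> s \<longrightarrow> s \<le> t \<longrightarrow> F s \<le> exp (a * (t - s)) * F t)"
    by (rule F_growth) (rule that)
  define T where "T = - ln s0"
  have T: "exp (- T) = s0" using *(2) by (simp add: T_def)
  \<comment> \<open>Depending on the direction of the growth bound, \<open>F\<close> on the initial
    interval is controlled from its left end 0 or from its right end
    \<open>\<bar>T\<bar>\<close>.\<close>
  define E where "E = exp (a * \<bar>T\<bar>) * (F 0 + F \<bar>T\<bar>)"
  have E: "0 \<le> E" using F_nonneg by (simp add: E_def)
  have F_le: "\<bar>F t\<bar> \<le> E" if "t \<le> T" for t
  proof (cases "t < 0")
    case False
    have le_E: "exp (a * x) * F y \<le> E" if "x \<le> \<bar>T\<bar>" "y \<in> {0, \<bar>T\<bar>}" for x y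
      unfolding E_def using a(1) F_nonneg that by (intro mult_mono) (auto intro: mult_left_mono)
    have "F t \<le> exp (a * (t - 0)) * F 0 \<or> F t \<le> exp (a * (\<bar>T\<bar> - t)) * F \<bar>T\<bar>"
      using a(2)
    proof
      assume m: "\<forall>s t. 0 \<le> s \<longrightarrow> s \<le> t \<longrightarrow> F t \<le> exp (a * (t - s)) * F s"
      show ?thesis using m[rule_format, of 0 t] False by (intro disjI1) simp
    next
      assume m: "\<forall>s t. 0 \<le> s \<longrightarrow> s \<le> t \<longrightarrow> F s \<le> exp (a * (t - s)) * F t"
      show ?thesis using m[rule_format, of t "\<bar>T\<bar>"] False that by (intro disjI2) simp
    qed
    moreover have "exp (a * (t - 0)) * F 0 \<le> E" using that by (intro le_E) auto
    moreover have "exp (a * (\<bar>T\<bar> - t)) * F \<bar>T\<bar> \<le> E" using False by (intro le_E) auto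
    ultimately have "F t \<le> E" by linarith
    then show ?thesis using F_nonneg[of t] by simp
  qed (simp add: F_def E)
  have g_le: "\<bar>g t\<bar> \<le> 2 * E" if "t \<le> T" for t
  proof -
    have "\<bar>\<Sum>i=1..N. \<omega> i * F (t - \<tau> i)\<bar> \<le> (\<Sum>i=1..N. \<omega> i * E)"
    proof (rule order_trans[OF sum_abs sum_mono])
      fix i assume i: "i \<in> {1..N}"
      have "\<bar>F (t - \<tau> i)\<bar> \<le> E" using that \<tau>_gt_0[OF i] by (intro F_le) simp
      then show "\<bar>\<omega> i * F (t - \<tau> i)\<bar> \<le> \<omega> i * E"
        using \<omega>_pos[OF i] by (simp add: abs_mult)
    qed
    also have "\<dots> = E" by (simp only: sum_distrib_right[symmetric] \<omega>_sum mult_1_left)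
    finally show ?thesis using F_le[OF that] unfolding g_def by linarith
  qed
  \<comment> \<open>The first summand serves \<open>t \<ge> T\<close>, where
    \<open>\<Lambda>_decay\<close> applies. The second serves the bounded range before
    \<open>T\<close>, where \<open>exp (\<gamma> * \<bar>T\<bar>)\<close> compensates the
    exponential.\<close>
  have "\<bar>g t\<bar> \<le> (\<bar>C\<bar> + 2 * E * exp (\<gamma> * \<bar>T\<bar>)) * exp (- \<gamma> * t)" if t: "0 \<le> t" for t
  proof (cases "T \<le> t")
    case True
    then have s: "exp (- t) \<le> s0" by (simp add: T[symmetric])
    have "g t = exp (- t) powr \<beta> * \<Lambda> (exp (- t))" using g_ln[of "exp (- t)"] t by simp
    then have "\<bar>g t\<bar> \<le> C * exp (- t) powr \<gamma>" using *(3)[of "exp (- t)"] s by simp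
    also have "\<dots> = C * exp (- \<gamma> * t)" by (simp add: powr_def)
    also have "\<dots> \<le> (\<bar>C\<bar> + 2 * E * exp (\<gamma> * \<bar>T\<bar>)) * exp (- \<gamma> * t)"
      using E by (intro mult_right_mono) (auto intro: add_increasing2)
    finally show ?thesis .
  next
    case False
    then have "\<gamma> * t \<le> \<gamma> * \<bar>T\<bar>" using *(1) by (intro mult_left_mono) auto
    then have "1 \<le> exp (\<gamma> * \<bar>T\<bar>) * exp (- \<gamma> * t)" by (simp flip: exp_add)
    then have "2 * E * 1 \<le> 2 * E * (exp (\<gamma> * \<bar>T\<bar>) * exp (- \<gamma> * t))" using E by (intro mult_left_mono) auto
    moreover have "0 \<le> \<bar>C\<bar> * exp (- \<gamma> * t)" by simp
    ultimately show ?thesis using g_le[of t] False unfolding distrib_right mult.assoc by linarith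
  qed
  then show ?thesis by (intro that[OF *(1)] allI impI)
qed

section \<open>Translation of the renewal theorems back to the radius\<close>

context
  fixes C \<gamma> :: real
  assumes \<gamma>: "0 < \<gamma>" and g_bound: "\<forall>t\<ge>0. \<bar>g t\<bar> \<le> C * exp (- \<gamma> * t)"
begin

interpretation R: renewal_equation "{1..N}" \<omega> \<tau> F g C \<gamma>
proof
  show "F t = (\<Sum>i\<in>{1..N}. \<omega> i * F (t - \<tau> i)) + g t" for t by (simp add: g_def)
  show "F \<in> borel_measurable borel" by (rule F_borel)
qed (use \<omega>_pos \<omega>_sum \<tau>_gt_0 \<gamma> g_bound in \<open>auto simp: F_def\<close>)

lemma mean_eq: "R.mean = mf_entropy N p r q"
proof -
  have "R.mean = (\<Sum>i=1..N. - (p i powr q * r i powr \<beta> * ln (r i)))"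
    unfolding R.mean_def by (intro sum.cong refl) (simp add: \<tau>_eq \<omega>_def)
  then show ?thesis by (simp add: mf_entropy_def sum_negf)
qed

lemma image_exp_neg: "(\<lambda>t::real. exp (- t)) ` {0..} = {0<..1}"
  "0 < x \<Longrightarrow> (\<lambda>t::real. exp (- t)) ` {0..- ln x} = {x..1}"
proof -
  show "(\<lambda>t::real. exp (- t)) ` {0..} = {0<..1}"
  proof (intro equalityI subsetI)
    fix s :: real assume "s \<in> {0<..1}"
    then show "s \<in> (\<lambda>t::real. exp (- t)) ` {0..}" by (intro image_eqI[of _ _ "- ln s"]) auto
  qed auto
  assume x: "0 < x"
  show "(\<lambda>t::real. exp (- t)) ` {0..- ln x} = {x..1}"
  proof (intro equalityI subsetI)
    fix s assume "s \<in> (\<lambda>t::real. exp (- t)) ` {0..- ln x}"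
    then obtain t where t: "0 \<le> t" "t \<le> - ln x" "s = exp (- t)" by auto
    then have "exp (ln x) \<le> s" by simp
    then show "s \<in> {x..1}" using t x by simp
  next
    fix s :: real assume "s \<in> {x..1}"
    then show "s \<in> (\<lambda>t::real. exp (- t)) ` {0..- ln x}" using x by (intro image_eqI[of _ _ "- ln s"]) auto
  qed
qed

lemma \<Lambda>_integrable: "set_integrable lborel {0<..1} (\<lambda>s. s powr \<beta> * \<Lambda> s / s)"
  and level_eq: "R.level = mf_constant N p r \<mu> K q"
proof -
  have int: "set_integrable lborel {0..} g"
    using integrable_mult_indicator[OF _ R.g_integrable, of "{0..}"] by (simp add: set_integrable_def)
  note sub = exp_substitution[OF _ _ image_exp_neg(1)[symmetric] R.g_meas int]
  have "set_integrable lborel {0<..1} (\<lambda>s. g (- ln s) / s)" by (rule sub(1)) auto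
  then show "set_integrable lborel {0<..1} (\<lambda>s. s powr \<beta> * \<Lambda> s / s)"
    by (subst (asm) set_integrable_cong[OF refl refl, of _ _ "\<lambda>s. s powr \<beta> * \<Lambda> s / s"]) (auto simp: g_ln)
  have "(LINT s:{0<..1}|lborel. s powr \<beta> * \<Lambda> s / s) = (LINT s:{0<..1}|lborel. g (- ln s) / s)"
    by (rule set_lebesgue_integral_cong) (auto simp: g_ln)
  also have "\<dots> = (LINT t:{0..}|lborel. g t)" by (rule sub(2)) auto
  also have "\<dots> = R.total"
    unfolding R.total_def set_lebesgue_integral_def
    by (intro Bochner_Integration.integral_cong) (auto simp: indicator_def R.g_neg)
  finally have total: "(LINT s:{0<..1}|lborel. s powr \<beta> * \<Lambda> s / s) = R.total" .
  show "R.level = mf_constant N p r \<mu> K q"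
    unfolding R.level_def mf_constant_def mean_eq total by simp
qed

lemma content_F: "0 < s \<Longrightarrow> s \<le> 1 \<Longrightarrow> 1 / s powr (- \<beta>) * V s = F (- ln s)"
  by (simp add: F_ln powr_minus_divide)

lemma eventually_content_F: "\<forall>\<^sub>F s in at_right 0. F (- ln s) = 1 / s powr (- \<beta>) * V s"
  using eventually_at_right_real[OF zero_less_one]
  by (rule eventually_mono) (rule content_F[symmetric]; simp)

lemma nonarithmetic_content:
  assumes "\<not> in_discrete_subgroup (\<tau> ` {1..N})"
  shows "((\<lambda>s. 1 / s powr (- \<beta>) * V s) \<longlongrightarrow> mf_constant N p r \<mu> K q) (at_right 0)"
proof -
  obtain a where "0 \<le> a"
    "(\<forall>s t. 0 \<le> s \<longrightarrow> s \<le> t \<longrightarrow> F t \<le> exp (a * (t - s)) * F s) \<or>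
     (\<forall>s t. 0 \<le> s \<longrightarrow> s \<le> t \<longrightarrow> F s \<le> exp (a * (t - s)) * F t)"
    by (rule F_growth) (rule that)
  then have "(F \<longlongrightarrow> R.level) at_top"
    by (intro R.nonarithmetic_tendsto[OF assms _ F_nonneg])
  then have "((\<lambda>s. F (- ln s)) \<longlongrightarrow> R.level) (at_right 0)"
    by (rule filterlim_compose[OF _ filterlim_neg_ln])
  then have "((\<lambda>s. 1 / s powr (- \<beta>) * V s) \<longlongrightarrow> R.level) (at_right 0)"
    by (rule tendsto_cong[THEN iffD1, OF eventually_content_F])
  then show ?thesis by (simp only: level_eq)
qed

lemma average_integrable:
  assumes x: "0 < x"
  shows "set_integrable lborel {x..1} (\<lambda>s. 1 / s powr (- \<beta>) * V s / s)"
    and "(LINT s:{x..1}|lborel. 1 / s powr (- \<beta>) * V s / s) = R.cum (- ln x)"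
proof -
  have eq: "1 / s powr (- \<beta>) * V s / s = F (- ln s) / s" if "s \<in> {x..1}" for s
    using content_F[of s] that x by (simp only: atLeastAtMost_iff) simp
  note sub = exp_substitution[OF _ _ image_exp_neg(2)[OF x, symmetric] F_borel R.F_integrable]
  have "set_integrable lborel {x..1} (\<lambda>s. F (- ln s) / s)" by (rule sub(1)) auto
  then show "set_integrable lborel {x..1} (\<lambda>s. 1 / s powr (- \<beta>) * V s / s)"
    by (subst set_integrable_cong[OF refl refl eq])
  have "(LINT s:{x..1}|lborel. 1 / s powr (- \<beta>) * V s / s) = (LINT s:{x..1}|lborel. F (- ln s) / s)"
  proof (rule set_lebesgue_integral_cong)
    show "\<forall>s. s \<in> {x..1} \<longrightarrow> 1 / s powr (- \<beta>) * V s / s = F (- ln s) / s"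
      using eq by (intro allI impI)
  qed simp
  also have "\<dots> = R.cum (- ln x)" unfolding R.cum_def by (rule sub(2)) auto
  finally show "(LINT s:{x..1}|lborel. 1 / s powr (- \<beta>) * V s / s) = R.cum (- ln x)" .
qed

lemma average_content:
  "(mf_minkowski_average \<mu> q \<beta> K \<longlongrightarrow> mf_constant N p r \<mu> K q) (at_right 0)"
proof -
  have "((\<lambda>x. R.cum (- ln x) / - ln x) \<longlongrightarrow> R.level) (at_right 0)"
    by (rule filterlim_compose[OF R.average_tendsto filterlim_neg_ln])
  moreover have "\<forall>\<^sub>F x in at_right 0. R.cum (- ln x) / - ln x = mf_minkowski_average \<mu> q \<beta> K x"
    using eventually_at_right_less[of 0]
  proof eventually_elim
    case (elim x)
    show ?case unfolding mf_minkowski_average_def average_integrable(2)[OF elim] by simp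
  qed
  ultimately have "(mf_minkowski_average \<mu> q \<beta> K \<longlongrightarrow> R.level) (at_right 0)"
    by (rule tendsto_cong[THEN iffD1, rotated])
  then show ?thesis by (simp only: level_eq)
qed

context
  fixes u :: real
  assumes u: "0 < u" and closure_eq: "group_closure (\<tau> ` {1..N}) = range (\<lambda>n::int. u * of_int n)"
begin

lemma shifted_scale:
  assumes s: "0 < s"
  shows "s * exp (of_int n * u) \<le> 1 \<longleftrightarrow> of_int n * u \<le> - ln s"
    and "s * exp (of_int n * u) \<le> 1 \<Longrightarrow>
      (s * exp (of_int n * u)) powr \<beta> * \<Lambda> (s * exp (of_int n * u)) = g (- ln s - of_int n * u)"
proof -
  have e: "s * exp (of_int n * u) = exp (ln s + of_int n * u)" using s by (simp add: exp_add)
  show "s * exp (of_int n * u) \<le> 1 \<longleftrightarrow> of_int n * u \<le> - ln s" unfolding e by auto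
  assume le: "s * exp (of_int n * u) \<le> 1"
  have "- ln (s * exp (of_int n * u)) = - ln s - of_int n * u" unfolding e by simp
  then show "(s * exp (of_int n * u)) powr \<beta> * \<Lambda> (s * exp (of_int n * u)) = g (- ln s - of_int n * u)"
    using g_ln[of "s * exp (of_int n * u)"] le s by simp
qed

text \<open>Multiplying the radius by \<open>exp (n * u)\<close> moves time back by
  \<open>n * u\<close>, so the series over scales is the lattice sum of \<open>g\<close>. The
  restriction to radii at most 1 is the restriction to non-negative times.\<close>

lemma periodic_has_sum:
  assumes "0 < s"
  shows "((\<lambda>n::int. (s * exp (of_int n * u)) powr \<beta> * \<Lambda> (s * exp (of_int n * u)) * u) has_sum (R.comb u (- ln s) * u))
     {n. s * exp (of_int n * u) \<le> 1}"
proof -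
  have "((\<lambda>n::int. g (- ln s - of_int n * u) * u) has_sum (R.comb u (- ln s) * u)) {n. of_int n * u \<le> - ln s}"
    by (intro has_sum_cmult_left R.has_sum_comb[OF u])
  also have "{n::int. of_int n * u \<le> - ln s} = {n. s * exp (of_int n * u) \<le> 1}"
    using shifted_scale(1)[OF assms] by simp
  finally show ?thesis
    using shifted_scale(2)[OF assms] by (subst has_sum_cong[where g = "\<lambda>n::int. g (- ln s - of_int n * u) * u"]) auto
qed

lemma periodic_eq:
  assumes "0 < s"
  shows "mf_periodic N p r \<mu> K q u s = u / R.mean * R.comb u (- ln s)"
  unfolding mf_periodic_def mean_eq infsumI[OF periodic_has_sum[OF assms]] by simp

lemma periodic_period:
  assumes "0 < s"
  shows "mf_periodic N p r \<mu> K q u (exp u * s) = mf_periodic N p r \<mu> K q u s"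
proof -
  have "- ln (exp u * s) = - ln s - of_nat 1 * u" using assms by (simp add: ln_mult)
  moreover have "0 < exp u * s" using assms by simp
  ultimately show ?thesis using assms by (simp only: periodic_eq R.comb_periodic[OF u])
qed

lemma arithmetic_content:
  "((\<lambda>s. 1 / s powr (- \<beta>) * V s - mf_periodic N p r \<mu> K q u s) \<longlongrightarrow> 0) (at_right 0)"
proof -
  have "u \<in> group_closure (\<tau> ` {1..N})" unfolding closure_eq by (rule image_eqI[of _ _ 1]) auto
  moreover have "\<exists>k. \<tau> i = of_nat k * u" if i: "i \<in> {1..N}" for i
  proof -
    have "\<tau> i \<in> group_closure (\<tau> ` {1..N})" using i by (auto intro: group_closure.base)
    then obtain n :: int where n: "\<tau> i = u * of_int n" unfolding closure_eq by blast
    \<comment> \<open>Steps are positive, so an integer multiple of \<open>u\<close> is a natural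
      one, which is what \<open>arithmetic_tendsto\<close> asks for.\<close>
    then have "0 < n" using \<tau>_gt_0[OF i] u by (simp add: zero_less_mult_iff)
    then have "\<tau> i = of_nat (nat n) * u" using n by simp
    then show ?thesis by blast
  qed
  ultimately have "((\<lambda>t. F t - u / R.mean * R.comb u t) \<longlongrightarrow> 0) at_top"
    by (rule R.arithmetic_tendsto[OF u])
  then have "((\<lambda>s. F (- ln s) - u / R.mean * R.comb u (- ln s)) \<longlongrightarrow> 0) (at_right 0)"
    by (rule filterlim_compose[OF _ filterlim_neg_ln])
  moreover have "\<forall>\<^sub>F s in at_right 0. F (- ln s) - u / R.mean * R.comb u (- ln s) =
      1 / s powr (- \<beta>) * V s - mf_periodic N p r \<mu> K q u s"
    using eventually_content_F eventually_at_right_less[of 0]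
    by eventually_elim (simp add: periodic_eq)
  ultimately show ?thesis by (simp add: tendsto_cong)
qed

end

end

end

text \<open>Integrals and infinite sums default to 0 when they do not exist. The integrability and
  summability conclusions certify that \<open>c\<close> and \<open>\<pi>\<close> are genuine values.
  The function \<open>\<epsilon>\<close> is the difference of the two sides, so its content is the
  limit.\<close>

theorem theorem3p3:
  fixes N :: nat
    and S :: "nat \<Rightarrow> 'a::euclidean_space \<Rightarrow> 'a"
    and r p :: "nat \<Rightarrow> real"
    and K :: "'a set"
    and \<mu> :: "'a measure"
    and q :: real
  assumes "N \<ge> 2"
    and "\<And>i. i \<in> {1..N} \<Longrightarrow> 0 < r i \<and> r i < 1"
    and "\<And>i. i \<in> {1..N} \<Longrightarrow> similarity (r i) (S i)"
    and "\<And>i. i \<in> {1..N} \<Longrightarrow> 0 < p i"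
    and "(\<Sum>i=1..N. p i) = 1"
    and "self_similar_set N S K"
    and "self_similar_measure N S p \<mu>"
    and "(open_set_condition N S \<and> 0 \<le> q) \<or> strong_separation_condition N S"
  defines "\<beta> \<equiv> mf_beta N p r q"
    and "V \<equiv> \<lambda>s. mf_minkowski_volume \<mu> q s K"
    and "\<Lambda> \<equiv> mf_lambda N p r \<mu> K q"
    and "c \<equiv> mf_constant N p r \<mu> K q"
    and "\<pi> \<equiv> mf_periodic N p r \<mu> K q"
    and "L \<equiv> (\<lambda>i. ln (inverse (r i))) ` {1..N}"
  shows
    "(\<not> in_discrete_subgroup L \<longrightarrow>
        set_integrable lborel {0<..1} (\<lambda>s. s powr \<beta> * \<Lambda> s / s) \<and>
        (\<exists>\<epsilon>. (\<forall>s>0. 1 / s powr (- \<beta>) * V s = c + \<epsilon> s) \<and> (\<epsilon> \<longlongrightarrow> 0) (at_right 0)) \<and>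
        mf_minkowski_measurable \<mu> q \<beta> K \<and>
        mf_minkowski_content \<mu> q \<beta> K = c) \<and>
     (\<forall>u>0. in_discrete_subgroup L \<and> group_closure L = range (\<lambda>n::int. u * of_int n) \<longrightarrow>
        set_integrable lborel {0<..1} (\<lambda>s. s powr \<beta> * \<Lambda> s / s) \<and>
        (\<forall>s>0. (\<lambda>n::int. (s * exp (of_int n * u)) powr \<beta> * \<Lambda> (s * exp (of_int n * u)) * u)
                 summable_on {n. s * exp (of_int n * u) \<le> 1}) \<and>
        (\<forall>s>0. \<pi> u (exp u * s) = \<pi> u s) \<and>
        (\<exists>\<epsilon>. (\<forall>s>0. 1 / s powr (- \<beta>) * V s = \<pi> u s + \<epsilon> s) \<and> (\<epsilon> \<longlongrightarrow> 0) (at_right 0)) \<and>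
        mf_avg_minkowski_measurable \<mu> q \<beta> K \<and>
        mf_avg_minkowski_content \<mu> q \<beta> K = c)"
proof -
  interpret self_similar N S r p K \<mu> q
    by unfold_locales (use assms in auto)
  have L: "L = \<tau> ` {1..N}" by (simp add: L_def \<tau>_def[abs_def])
  obtain \<gamma> C where \<gamma>: "0 < \<gamma>" "\<forall>t\<ge>0. \<bar>g t\<bar> \<le> C * exp (- \<gamma> * t)"
    by (rule g_decay[OF assms(8)]) (rule that)
  have int: "set_integrable lborel {0<..1} (\<lambda>s. s powr \<beta> * \<Lambda> s / s)"
    unfolding \<beta>_def \<Lambda>_def by (rule \<Lambda>_integrable[OF \<gamma>])
  show ?thesis
  proof (intro conjI impI allI)
    assume "\<not> in_discrete_subgroup L"
    then have lim: "((\<lambda>s. 1 / s powr (- \<beta>) * V s) \<longlongrightarrow> c) (at_right 0)"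
      unfolding \<beta>_def V_def c_def L by (rule nonarithmetic_content[OF \<gamma>])
    show "\<exists>\<epsilon>. (\<forall>s>0. 1 / s powr (- \<beta>) * V s = c + \<epsilon> s) \<and> (\<epsilon> \<longlongrightarrow> 0) (at_right 0)"
      using LIM_zero[OF lim] by (intro exI[of _ "\<lambda>s. 1 / s powr (- \<beta>) * V s - c"]) auto
    show "mf_minkowski_measurable \<mu> q \<beta> K"
      unfolding mf_minkowski_measurable_def using lim unfolding V_def by blast
    show "mf_minkowski_content \<mu> q \<beta> K = c"
      unfolding mf_minkowski_content_def using lim unfolding V_def by (intro tendsto_Lim) auto
  next
    fix u :: real assume u: "0 < u" and "in_discrete_subgroup L \<and> group_closure L = range (\<lambda>n::int. u * of_int n)"
    then have cl: "group_closure (\<tau> ` {1..N}) = range (\<lambda>n::int. u * of_int n)" by (simp add: L)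
    show "\<exists>\<epsilon>. (\<forall>s>0. 1 / s powr (- \<beta>) * V s = \<pi> u s + \<epsilon> s) \<and> (\<epsilon> \<longlongrightarrow> 0) (at_right 0)"
      using arithmetic_content[OF \<gamma> u cl]
      by (intro exI[of _ "\<lambda>s. 1 / s powr (- \<beta>) * V s - \<pi> u s"]) (auto simp: \<beta>_def V_def \<pi>_def)
    show "(\<lambda>n::int. (s * exp (of_int n * u)) powr \<beta> * \<Lambda> (s * exp (of_int n * u)) * u)
        summable_on {n. s * exp (of_int n * u) \<le> 1}" if "0 < s" for s
      using has_sum_imp_summable[OF periodic_has_sum[OF \<gamma> u cl that]] by (simp add: \<beta>_def \<Lambda>_def)
    show "\<pi> u (exp u * s) = \<pi> u s" if "0 < s" for s
      unfolding \<pi>_def by (rule periodic_period[OF \<gamma> u cl that])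
    have lim: "(mf_minkowski_average \<mu> q \<beta> K \<longlongrightarrow> c) (at_right 0)"
      unfolding \<beta>_def c_def by (rule average_content[OF \<gamma>])
    show "mf_avg_minkowski_measurable \<mu> q \<beta> K"
      unfolding mf_avg_minkowski_measurable_def
      using lim average_integrable(1)[OF \<gamma>] by (auto simp: \<beta>_def)
    show "mf_avg_minkowski_content \<mu> q \<beta> K = c"
      unfolding mf_avg_minkowski_content_def using lim by (intro tendsto_Lim) auto
  qed (use int in auto)
qed

end
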